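(* Let $A$ be a commutative associative superalgebra with parity $p$. The $\mathbb Z_+$-graded superspace $\mathcal G(A)=\bigoplus_{k=0}^\infty\mathcal G_k(A)$, where $\mathcal G_k(A)=\Pi W^{\mathrm{as}}_{k-1}(\Pi A)$, with parity denoted by $p$, together with the concatenation product $\wedge:\mathcal G_h(A)\times\mathcal G_{k-h}(A)\to\mathcal G_k(A)$ given by $$(X\wedge Y)(a_1,\dots,a_k)=\sum_{\substack{i_1<\dots<i_h\\ i_{h+1}<\dots<i_k}}\epsilon_a(i_1,\dots,i_k)(-1)^{p(Y)(\bar p(a_{i_1})+\dots+\bar p(a_{i_h}))}X(a_{i_1},\dots,a_{i_h})Y(a_{i_{h+1}},\dots,a_{i_k}),$$ and with the Lie superalgebra bracket on $\Pi\mathcal G(A)=W^{\mathrm{as}}(\Pi A)$, is a $\mathbb Z_+$-graded odd Poisson superalgebra.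
   Context: All spaces are over a field $\mathbb F$ of characteristic $0$. For a superspace $U$ with parity $p$, $\Pi U$ is the same space with parity $\bar p=p+\bar1$. Universal Lie superalgebra: for a superspace $V$ with parity $\bar p$, $W(V)=\bigoplus_{k\ge-1}W_k(V)$, $W_k(V)=\mathrm{Hom}(S^{k+1}(V),V)$ (supersymmetric $(k+1)$-linear maps), with induced parity $\bar p$. For $X\in W_h(V)$, $Y\in W_{k-h}(V)$ put $$(X\Box Y)(v_0,\dots,v_k)=\sum_{\substack{i_0<\dots<i_{k-h}\\ i_{k-h+1}<\dots<i_k}}\epsilon_v(i_0,\dots,i_k)X(Y(v_{i_0},\dots,v_{i_{k-h}}),v_{i_{k-h+1}},\dots,v_{i_k}),$$ the sum being over permutations $(i_0,\dots,i_k)$ of $(0,\dots,k)$ and $\epsilon_v(i_0,\dots,i_k)=(-1)^M$, with $M$ the number of interchanges of indices of odd $v_i$'s in the permutation. $[X,Y]=X\Box Y-(-1)^{\bar p(X)\bar p(Y)}Y\Box X$ is a Lie superalgebra bracket; for $Y\in W_{-1}(V)=V$, $[X,Y](v_1,\dots,v_k)=X(Y,v_1,\dots,v_k)$. $\mathrm{Der}(A)$ is the Lie superalgebra of linear maps $X:A\to A$ with $X(ab)=X(a)b+(-1)^{p(a)p(b)}X(b)a$, regarded inside $W_0(\Pi A)=\mathrm{End}(\Pi A)$. $W^{\mathrm{as}}(\Pi A)=\bigoplus_{k\ge-1}W^{\mathrm{as}}_k(\Pi A)$ is its full prolongation: $W^{\mathrm{as}}_{-1}=\Pi A$, $W_0^{\mathrm{as}}=\mathrm{Der}(A)$,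 and $W_k^{\mathrm{as}}=\{X\in W_k(\Pi A):[X,\Pi A]\subset W^{\mathrm{as}}_{k-1}\}$ for $k\ge1$; it is a subalgebra of $W(\Pi A)$. In the product formula $X\in\Pi W^{\mathrm{as}}_{h-1}(\Pi A)$, $Y\in\Pi W^{\mathrm{as}}_{k-h-1}(\Pi A)$ with $h\ge 0$, $k-h\ge 0$; $p(X),p(Y)$ are their parities in $\Pi W^{\mathrm{as}}$; $\bar p(a_i)$ and $\epsilon_a$ refer to $a_i$ as elements of $\Pi A$; the sum is over permutations of $(1,\dots,k)$ with the indicated inequalities; the product on the right is that of $A$. An odd Poisson (Gerstenhaber) superalgebra is a commutative associative superalgebra $\mathcal P$ with parity $p$ and a bracket making $\Pi\mathcal P$ a Lie superalgebra, with $[a,bc]=[a,b]c+(-1)^{(p(a)+\bar1)p(b)}b[a,c]$. The grading here is such that $\mathcal G_h\wedge\mathcal G_k\subset\mathcal G_{h+k}$ and the bracket is the $\mathbb Z$-graded bracket of $W^{\mathrm{as}}(\Pi A)$. *)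

theory Defs
  imports
    Complex_Main
    "HOL-Combinatorics.Permutations"
    "HOL-Library.Z2"
    "HOL-Library.Function_Algebras"
begin

section \<open>Superspaces and superalgebras\<close>

text \<open>
  Parities live in \<open>bit\<close>, the integers mod 2. A superspace is given inside an ambient vector space
  by its even part \<open>U 0\<close> and its odd part \<open>U 1\<close>; the superspace itself is \<open>carrier_of U\<close>.
  The ambient space may be larger, and operations are unconstrained outside \<open>carrier_of U\<close>.
\<close>

definition sgn_pow :: "bit \<Rightarrow> 'v::ab_group_add \<Rightarrow> 'v" where
  "sgn_pow p x = (if p = 0 then x else - x)"

definition carrier_of :: "(bit \<Rightarrow> 'v::ab_group_add set) \<Rightarrow> 'v set" where
  "carrier_of U = {x + y | x y. x \<in> U 0 \<and> y \<in> U 1}"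

definition parity_shift :: "(bit \<Rightarrow> 'v set) \<Rightarrow> bit \<Rightarrow> 'v set" where
  "parity_shift U p = U (p + 1)"

text \<open>The component of parity \<open>p\<close> of an element of a superspace.\<close>

definition hcomp :: "(bit \<Rightarrow> 'v::ab_group_add set) \<Rightarrow> bit \<Rightarrow> 'v \<Rightarrow> 'v" where
  "hcomp U p u = (THE x. x \<in> U p \<and> u - x \<in> U (p + 1))"

locale superspace = vector_space scale
  for scale :: "'f::field_char_0 \<Rightarrow> 'v::ab_group_add \<Rightarrow> 'v" +
  fixes U :: "bit \<Rightarrow> 'v set"
  assumes subspace_parity: "subspace (U p)"
    and parity_disjoint: "U 0 \<inter> U 1 = {0}"

lemma (in superspace) hcomp_homogeneous:
  assumes "u \<in> U p" shows "hcomp U q u = (if q = p then u else 0)"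
proof -
  have z: "0 \<in> U r" for r using subspace_parity subspace_0 by blast
  have two: "r + 1 \<noteq> r" for r :: bit by (cases r) auto
  have dis: "x = 0" if "x \<in> U r" "x \<in> U (r + 1)" for x r
    using parity_disjoint that by (cases r) auto
  show ?thesis
  proof (cases "q = p")
    case True
    then show ?thesis unfolding hcomp_def
    proof (simp only: True if_True, intro the_equality conjI)
      show "u \<in> U p" "u - u \<in> U (p+1)" using assms z by auto
      fix x assume "x \<in> U p \<and> u - x \<in> U (p + 1)"
      then show "x = u" using dis[of "u - x" p] subspace_diff[OF subspace_parity assms] by auto
    qed
  next
    case False
    then have q: "q = p + 1" "q + 1 = p" by (cases p; cases q; simp)+
    show ?thesis unfolding hcomp_def
    proof (simp only: False if_False, intro the_equality conjI)
      show "0 \<in> U q" by (rule z)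
      show "u - 0 \<in> U (q+1)" using assms q(2) by simp
      fix x assume x: "x \<in> U q \<and> u - x \<in> U (q + 1)"
      then have "u - x \<in> U p" using q(2) by simp
      from subspace_diff[OF subspace_parity assms this] have "x \<in> U p" by simp
      then show "x = 0" using dis[of x p] x q(1) by simp
    qed
  qed
qed

locale superalgebra = superspace scale U
  for scale :: "'f::field_char_0 \<Rightarrow> 'v::ab_group_add \<Rightarrow> 'v" and U +
  fixes prd :: "'v \<Rightarrow> 'v \<Rightarrow> 'v"
  assumes prd_parity: "a \<in> U p \<Longrightarrow> b \<in> U q \<Longrightarrow> prd a b \<in> U (p + q)"
    and prd_add_left: "\<lbrakk>a \<in> carrier_of U; b \<in> carrier_of U; c \<in> carrier_of U\<rbrakk>
      \<Longrightarrow> prd (a + b) c = prd a c + prd b c"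
    and prd_add_right: "\<lbrakk>a \<in> carrier_of U; b \<in> carrier_of U; c \<in> carrier_of U\<rbrakk>
      \<Longrightarrow> prd a (b + c) = prd a b + prd a c"
    and prd_scale_left: "\<lbrakk>a \<in> carrier_of U; b \<in> carrier_of U\<rbrakk>
      \<Longrightarrow> prd (scale r a) b = scale r (prd a b)"
    and prd_scale_right: "\<lbrakk>a \<in> carrier_of U; b \<in> carrier_of U\<rbrakk>
      \<Longrightarrow> prd a (scale r b) = scale r (prd a b)"

locale comm_assoc_superalgebra = superalgebra +
  assumes prd_assoc: "\<lbrakk>a \<in> carrier_of U; b \<in> carrier_of U; c \<in> carrier_of U\<rbrakk>
      \<Longrightarrow> prd (prd a b) c = prd a (prd b c)"
    and prd_comm: "a \<in> U p \<Longrightarrow> b \<in> U q \<Longrightarrow> prd a b = sgn_pow (p * q) (prd b a)"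

locale lie_superalgebra = superalgebra scale U brk
  for scale :: "'f::field_char_0 \<Rightarrow> 'v::ab_group_add \<Rightarrow> 'v" and U brk +
  assumes brk_skew: "a \<in> U p \<Longrightarrow> b \<in> U q \<Longrightarrow> brk a b = - sgn_pow (p * q) (brk b a)"
    and brk_jacobi: "a \<in> U p \<Longrightarrow> b \<in> U q \<Longrightarrow> c \<in> carrier_of U
      \<Longrightarrow> brk a (brk b c) = brk (brk a b) c + sgn_pow (p * q) (brk b (brk a c))"

locale odd_poisson_superalgebra =
  comm_assoc_superalgebra scale U prd + shifted: lie_superalgebra scale "parity_shift U" brk
  for scale :: "'f::field_char_0 \<Rightarrow> 'v::ab_group_add \<Rightarrow> 'v" and U prd brk +
  assumes leibniz: "a \<in> U p \<Longrightarrow> b \<in> U q \<Longrightarrow> c \<in> carrier_of U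
      \<Longrightarrow> brk a (prd b c) = prd (brk a b) c + sgn_pow ((p + 1) * q) (prd b (brk a c))"

text \<open>The sum of a family of subspaces; that it is direct is required separately.\<close>

definition sum_of_family :: "(nat \<Rightarrow> 'v::ab_group_add set) \<Rightarrow> 'v set" where
  "sum_of_family G = {\<Sum>k\<in>K. x k | K x. finite K \<and> (\<forall>k\<in>K. x k \<in> G k)}"

text \<open>
  The bracket has degree -1 with respect to the grading of the product: \<open>G k\<close> is the piece of
  degree \<open>k - 1\<close> of the Lie superalgebra, whose grading starts at -1.
\<close>

locale graded_odd_poisson_superalgebra = odd_poisson_superalgebra scale U prd brk
  for scale :: "'f::field_char_0 \<Rightarrow> 'v::ab_group_add \<Rightarrow> 'v" and U prd brk +
  fixes G :: "nat \<Rightarrow> 'v set"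
  assumes subspace_piece: "subspace (G k)"
    and piece_parity: "x \<in> G k \<Longrightarrow> \<exists>x0 \<in> G k \<inter> U 0. \<exists>x1 \<in> G k \<inter> U 1. x = x0 + x1"
    and carrier_eq_sum: "carrier_of U = sum_of_family G"
    and sum_direct: "\<lbrakk>finite K; \<And>k. k \<in> K \<Longrightarrow> f k \<in> G k; (\<Sum>k\<in>K. f k) = 0; k \<in> K\<rbrakk> \<Longrightarrow> f k = 0"
    and prd_graded: "x \<in> G h \<Longrightarrow> y \<in> G k \<Longrightarrow> prd x y \<in> G (h + k)"
    and brk_graded: "x \<in> G h \<Longrightarrow> y \<in> G k \<Longrightarrow> h + k \<ge> 1 \<Longrightarrow> brk x y \<in> G (h + k - 1)"
    and brk_graded_0: "x \<in> G 0 \<Longrightarrow> y \<in> G 0 \<Longrightarrow> brk x y = 0"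


section \<open>The universal Lie superalgebra\<close>

text \<open>
  An \<open>n\<close>-linear map on a superspace \<open>V\<close> is a function on lists that vanishes except on lists of
  length \<open>n\<close> in \<open>carrier_of V\<close>. Maps of different arities thus live in one ambient vector space of
  functions, with pointwise operations, and direct sums over the arity are internal.
  \<open>hom_sym scale V n\<close> is the space of supersymmetric \<open>n\<close>-linear maps from \<open>V\<close> to \<open>V\<close>, i.e. the
  piece of degree \<open>n - 1\<close> of the universal Lie superalgebra \<open>W(V)\<close>; an element \<open>v\<close> of \<open>V\<close>, the
  piece of degree -1, is the function with value \<open>v\<close> at the empty list.
\<close>

definition fscale :: "('f \<Rightarrow> 'v \<Rightarrow> 'v) \<Rightarrow> 'f \<Rightarrow> ('b \<Rightarrow> 'v) \<Rightarrow> ('b \<Rightarrow> 'v)" where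
  "fscale scale r f = (\<lambda>x. scale r (f x))"

definition hom_sym ::
  "('f::field_char_0 \<Rightarrow> 'v::ab_group_add \<Rightarrow> 'v) \<Rightarrow> (bit \<Rightarrow> 'v set) \<Rightarrow> nat \<Rightarrow> ('v list \<Rightarrow> 'v) set" where
  "hom_sym scale V n = {f.
     (\<forall>vs. length vs = n \<and> set vs \<subseteq> carrier_of V \<longrightarrow> f vs \<in> carrier_of V) \<and>
     (\<forall>vs. \<not> (length vs = n \<and> set vs \<subseteq> carrier_of V) \<longrightarrow> f vs = 0) \<and>
     (\<forall>xs u v ys. length xs + length ys + 1 = n \<and> set xs \<union> {u, v} \<union> set ys \<subseteq> carrier_of V \<longrightarrow>
        f (xs @ (u + v) # ys) = f (xs @ u # ys) + f (xs @ v # ys)) \<and>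
     (\<forall>xs u ys r. length xs + length ys + 1 = n \<and> set xs \<union> {u} \<union> set ys \<subseteq> carrier_of V \<longrightarrow>
        f (xs @ scale r u # ys) = scale r (f (xs @ u # ys))) \<and>
     (\<forall>xs u v ys p q. length xs + length ys + 2 = n \<and> set xs \<union> set ys \<subseteq> carrier_of V \<and>
        u \<in> V p \<and> v \<in> V q \<longrightarrow>
        f (xs @ u # v # ys) = sgn_pow (p * q) (f (xs @ v # u # ys)))}"

definition has_map_parity :: "(bit \<Rightarrow> 'v set) \<Rightarrow> bit \<Rightarrow> ('v list \<Rightarrow> 'v) \<Rightarrow> bool" where
  "has_map_parity V q f \<longleftrightarrow>
     (\<forall>vs ps. list_all2 (\<lambda>v p. v \<in> V p) vs ps \<longrightarrow> f vs \<in> V (q + sum_list ps))"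

definition W_parity ::
  "('f::field_char_0 \<Rightarrow> 'v::ab_group_add \<Rightarrow> 'v) \<Rightarrow> (bit \<Rightarrow> 'v set) \<Rightarrow> bit \<Rightarrow> ('v list \<Rightarrow> 'v) set" where
  "W_parity scale V q = {f \<in> sum_of_family (hom_sym scale V). has_map_parity V q f}"

text \<open>
  Multilinear maps are defined below by formulas \<open>F ps vs\<close> for homogeneous arguments \<open>vs\<close> of
  parities \<open>ps\<close>; \<open>multilin_ext\<close> extends such a formula to arbitrary arguments by expanding
  each of them into its even and odd components.
\<close>

definition multilin_ext ::
  "(bit \<Rightarrow> 'v::ab_group_add set) \<Rightarrow> (bit list \<Rightarrow> 'v list \<Rightarrow> 'v) \<Rightarrow> 'v list \<Rightarrow> 'v" where
  "multilin_ext V F vs =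
     (if set vs \<subseteq> carrier_of V
      then \<Sum>ps | length ps = length vs. F ps (map2 (hcomp V) ps vs) else 0)"

text \<open>On homogeneous arguments \<open>multilin_ext\<close> returns the defining formula.\<close>

lemma (in superspace) multilin_ext_homogeneous:
  assumes vs: "list_all2 (\<lambda>v p. v \<in> U p) vs ps"
    and F0: "\<And>qs ws. length qs = length ws \<Longrightarrow> 0 \<in> set ws \<Longrightarrow> F qs ws = 0"
  shows "multilin_ext U F vs = F ps vs"
proof -
  have len: "length ps = length vs" using vs by (simp add: list_all2_lengthD)
  have inU: "vs ! i \<in> U (ps ! i)" if "i < length vs" for i using vs that by (simp add: list_all2_conv_all_nth)
  have z: "0 \<in> U r" for r using subspace_parity subspace_0 by blast
  have car: "U r \<subseteq> carrier_of U" for r using z by (cases r) (force simp: carrier_of_def)+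
  have sub: "set vs \<subseteq> carrier_of U" using inU car by (fastforce simp: in_set_conv_nth)
  have same: "map2 (hcomp U) ps vs = vs"
    by (rule nth_equalityI) (use len in \<open>auto simp: hcomp_homogeneous[OF inU]\<close>)
  have other: "F qs (map2 (hcomp U) qs vs) = 0" if qs: "length qs = length vs" "qs \<noteq> ps" for qs
  proof -
    obtain i where i: "i < length vs" "qs ! i \<noteq> ps ! i" using qs len by (auto simp: list_eq_iff_nth_eq)
    then have "map2 (hcomp U) qs vs ! i = 0" using qs by (auto simp: hcomp_homogeneous[OF inU])
    then have "0 \<in> set (map2 (hcomp U) qs vs)" using i qs nth_mem[of i "map2 (hcomp U) qs vs"] by simp
    then show ?thesis using F0 qs by auto
  qed
  have "(\<Sum>qs | length qs = length vs. F qs (map2 (hcomp U) qs vs)) = (\<Sum>qs\<in>{ps}. F qs (map2 (hcomp U) qs vs))"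
  proof (rule sum.mono_neutral_right)
    have "finite (UNIV :: bit set)" by (rule finite_subset[of _ "{0,1}"]) auto
    then show "finite {qs :: bit list. length qs = length vs}"
      using finite_lists_length_eq[of "UNIV::bit set"] by auto
  qed (use len other in auto)
  then show ?thesis using sub same by (simp add: multilin_ext_def)
qed
text \<open>
  Indices start at 0: the permutations \<open>\<sigma>\<close> of \<open>{..<n}\<close> that are increasing on the first \<open>m\<close> and on
  the last \<open>n - m\<close> positions.
\<close>

definition shuffle_perms :: "nat \<Rightarrow> nat \<Rightarrow> (nat \<Rightarrow> nat) set" where
  "shuffle_perms m n =
     {\<sigma>. \<sigma> permutes {..<n} \<and> strict_mono_on {..<m} \<sigma> \<and> strict_mono_on {m..<n} \<sigma>}"

text \<open>The exponent \<open>M\<close>, mod 2, for arguments of parities \<open>ps\<close>.\<close>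

definition interchanges :: "bit list \<Rightarrow> (nat \<Rightarrow> nat) \<Rightarrow> bit" where
  "interchanges ps \<sigma> = of_nat (card {(i, j). i < j \<and> j < length ps \<and> \<sigma> j < \<sigma> i \<and>
     ps ! \<sigma> i = 1 \<and> ps ! \<sigma> j = 1})"

text \<open>
  The sum over \<open>m\<close> extends the operation bilinearly to maps of mixed arity: if \<open>X\<close> has degree
  \<open>h\<close> and \<open>Y\<close> has degree \<open>k - h\<close>, then on \<open>n = k + 1\<close> arguments only \<open>m = k - h + 1\<close> contributes,
  since \<open>X\<close> and \<open>Y\<close> vanish on lists of any other length than their arity.
\<close>

definition box ::
  "(bit \<Rightarrow> 'v::ab_group_add set) \<Rightarrow> ('v list \<Rightarrow> 'v) \<Rightarrow> ('v list \<Rightarrow> 'v) \<Rightarrow> 'v list \<Rightarrow> 'v" where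
  "box V X Y = multilin_ext V (\<lambda>ps vs. let n = length vs in
     \<Sum>m\<le>n. \<Sum>\<sigma>\<in>shuffle_perms m n.
       sgn_pow (interchanges ps \<sigma>)
         (X (Y (map (\<lambda>i. vs ! \<sigma> i) [0..<m]) # map (\<lambda>i. vs ! \<sigma> i) [m..<n])))"

definition W_bracket ::
  "('f::field_char_0 \<Rightarrow> 'v::ab_group_add \<Rightarrow> 'v) \<Rightarrow> (bit \<Rightarrow> 'v set)
    \<Rightarrow> ('v list \<Rightarrow> 'v) \<Rightarrow> ('v list \<Rightarrow> 'v) \<Rightarrow> 'v list \<Rightarrow> 'v" where
  "W_bracket scale V X Y =
     (\<Sum>p\<in>{0, 1}. \<Sum>q\<in>{0, 1}.
        let Xp = hcomp (W_parity scale V) p X; Yq = hcomp (W_parity scale V) q Y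
        in box V Xp Yq - sgn_pow (p * q) (box V Yq Xp))"


section \<open>The full prolongation of the derivations, and the Gerstenhaber structure\<close>

text \<open>Throughout, \<open>A\<close> carries the parity \<open>p\<close> of the algebra, and \<open>parity_shift A\<close> is \<open>\<Pi>A\<close>.\<close>

definition der ::
  "('f::field_char_0 \<Rightarrow> 'a::ab_group_add \<Rightarrow> 'a) \<Rightarrow> (bit \<Rightarrow> 'a set) \<Rightarrow> ('a \<Rightarrow> 'a \<Rightarrow> 'a)
    \<Rightarrow> ('a list \<Rightarrow> 'a) set" where
  "der scale A prd = {X \<in> hom_sym scale (parity_shift A) 1.
     \<forall>p q. \<forall>a\<in>A p. \<forall>b\<in>A q. X [prd a b] = prd (X [a]) b + sgn_pow (p * q) (prd (X [b]) a)}"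

text \<open>\<open>W_as scale A prd n\<close> is the piece of degree \<open>n - 1\<close> of the prolongation.\<close>

fun W_as ::
  "('f::field_char_0 \<Rightarrow> 'a::ab_group_add \<Rightarrow> 'a) \<Rightarrow> (bit \<Rightarrow> 'a set) \<Rightarrow> ('a \<Rightarrow> 'a \<Rightarrow> 'a)
    \<Rightarrow> nat \<Rightarrow> ('a list \<Rightarrow> 'a) set" where
  "W_as scale A prd 0 = hom_sym scale (parity_shift A) 0"
| "W_as scale A prd (Suc 0) = der scale A prd"
| "W_as scale A prd (Suc (Suc n)) =
     {X \<in> hom_sym scale (parity_shift A) (Suc (Suc n)).
        \<forall>Y \<in> hom_sym scale (parity_shift A) 0.
          W_bracket scale (parity_shift A) X Y \<in> W_as scale A prd (Suc n)}"

definition W_as_parity ::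
  "('f::field_char_0 \<Rightarrow> 'a::ab_group_add \<Rightarrow> 'a) \<Rightarrow> (bit \<Rightarrow> 'a set) \<Rightarrow> ('a \<Rightarrow> 'a \<Rightarrow> 'a)
    \<Rightarrow> bit \<Rightarrow> ('a list \<Rightarrow> 'a) set" where
  "W_as_parity scale A prd q =
     {X \<in> sum_of_family (W_as scale A prd). has_map_parity (parity_shift A) q X}"

definition G_piece ::
  "('f::field_char_0 \<Rightarrow> 'a::ab_group_add \<Rightarrow> 'a) \<Rightarrow> (bit \<Rightarrow> 'a set) \<Rightarrow> ('a \<Rightarrow> 'a \<Rightarrow> 'a)
    \<Rightarrow> nat \<Rightarrow> ('a list \<Rightarrow> 'a) set" where
  "G_piece scale A prd k = W_as scale A prd k"

definition G_parity ::
  "('f::field_char_0 \<Rightarrow> 'a::ab_group_add \<Rightarrow> 'a) \<Rightarrow> (bit \<Rightarrow> 'a set) \<Rightarrow> ('a \<Rightarrow> 'a \<Rightarrow> 'a)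
    \<Rightarrow> bit \<Rightarrow> ('a list \<Rightarrow> 'a) set" where
  "G_parity scale A prd = parity_shift (W_as_parity scale A prd)"

text \<open>
  As for \<open>box\<close>, the sum over \<open>h\<close> is the bilinear extension to elements of mixed degree. In the
  formula, \<open>ps\<close> are the parities of the arguments in \<open>\<Pi>A\<close> and \<open>q\<close> is the parity of \<open>Y\<close> in
  \<open>\<G>(A)\<close>.
\<close>

definition wedge ::
  "('f::field_char_0 \<Rightarrow> 'a::ab_group_add \<Rightarrow> 'a) \<Rightarrow> (bit \<Rightarrow> 'a set) \<Rightarrow> ('a \<Rightarrow> 'a \<Rightarrow> 'a)
    \<Rightarrow> ('a list \<Rightarrow> 'a) \<Rightarrow> ('a list \<Rightarrow> 'a) \<Rightarrow> 'a list \<Rightarrow> 'a" where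
  "wedge scale A prd X Y =
     (\<Sum>q\<in>{0, 1}. let Yq = hcomp (G_parity scale A prd) q Y in
        multilin_ext (parity_shift A) (\<lambda>ps as. let k = length as in
          \<Sum>h\<le>k. \<Sum>\<sigma>\<in>shuffle_perms h k.
            sgn_pow (interchanges ps \<sigma> + q * (\<Sum>i<h. ps ! \<sigma> i))
              (prd (X (map (\<lambda>i. as ! \<sigma> i) [0..<h])) (Yq (map (\<lambda>i. as ! \<sigma> i) [h..<k])))))"

end

theory Submission
  imports Defs
begin

text \<open>
  Contraction with a vector, \<open>(\<iota>\<^sub>v f)(v\<^sub>1, \<dots>, v\<^sub>k) = f(v, v\<^sub>1, \<dots>, v\<^sub>k)\<close>, is a superderivation of both
  the box product and the concatenation product: the shuffles split according to which of the two
  factors receives the first argument. Hence every identity between multilinear maps follows by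
  induction on the number of arguments once it is checked on the empty list of arguments. There the
  Jacobi identity, associativity and commutativity are short computations with values of the maps,
  and the Leibniz rule is the derivation property of the bracketing element. A map lies in the full
  prolongation of the derivations iff it is a derivation in its last argument, so closure
  of the prolongation under both operations has an inductive proof of the same kind.
\<close>

section \<open>Signs\<close>

text \<open>The signs involve parities that contraction changes: \<open>contract v Y\<close> has the
  parity of \<open>Y\<close> plus that of \<open>v\<close>. The operations therefore carry parities
  of maps as explicit indices (\<open>wdg q\<close>, \<open>br r q\<close>), and every induction
  generalises over maps and indices together. Arities, by contrast, are forgotten:
  \<open>mlin\<close> admits maps of mixed arity, so contraction never leaves the class and the
  empty list is the only base case; finiteness of the set of arities is imposed separately by
  \<open>fin_arity\<close>. The defining formulas are accessible on homogeneous arguments only,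
  while an iterated operation needs its inner result to be a multilinear supersymmetric map. That
  property is itself obtained by contraction induction, after the reduction to homogeneous arguments
  in \<open>mlinI\<close>. Two parities coexist: multilinear maps are graded by
  \<open>parity_shift U\<close>, the product by \<open>U\<close>. This is the source of the shifts
  by 1 in the signs of the concatenation product.\<close>

lemma bit_simps [simp]: "(p::bit) + p = 0" "p + (p + q) = q" "q + p + p = q" "p * p = p"
  by (cases p; cases q; simp)+

text \<open>These rules would rewrite the ring operations on parities to bit operations.\<close>

declare add_bit_eq_xor [simp del] mult_bit_eq_and [simp del]

lemma sgn_pow_simps [simp]:
  "sgn_pow 0 x = x" "sgn_pow 1 x = - x" "sgn_pow p 0 = 0"
  by (auto simp: sgn_pow_def)

lemma sgn_pow_sgn_pow: "sgn_pow p (sgn_pow q x) = sgn_pow (p + q) x"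
  by (cases p; cases q; simp)

lemma sgn_pow_add: "sgn_pow p (x + y) = sgn_pow p x + sgn_pow p y"
  by (cases p; simp)

lemma sgn_pow_diff: "sgn_pow p (x - y) = sgn_pow p x - sgn_pow p y"
  by (cases p; simp)

lemma sgn_pow_sum: "sgn_pow p (sum f S) = (\<Sum>i\<in>S. sgn_pow p (f i))"
  by (cases p; simp add: sum_negf)

lemma sgn_pow_fun: "sgn_pow p f x = sgn_pow p (f x)"
  by (cases p; simp)

lemma of_nat_card_bit:
  assumes "finite S" shows "of_nat (card {x \<in> S. P x}) = (\<Sum>x\<in>S. if P x then 1 else (0::bit))"
  using assms by (simp add: sum.If_cases Int_def)

section \<open>Shuffles\<close>

text \<open>The sign exponent of the shuffle that lists \<open>S\<close> before its complement: its
  inversions are the pairs whose larger index lies in \<open>S\<close> and whose smaller one does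
  not. It depends on a set alone, so no permutation has to be manipulated afterwards.\<close>

definition cross :: "bit list \<Rightarrow> nat set \<Rightarrow> bit" where
  "cross ps S = of_nat (card {(a, b). b < a \<and> a < length ps \<and> a \<in> S \<and> b \<notin> S \<and> ps ! a = 1 \<and> ps ! b = 1})"

abbreviation select :: "nat \<Rightarrow> nat set \<Rightarrow> nat list" where
  "select n S \<equiv> filter (\<lambda>i. i \<in> S) [0..<n]"

text \<open>\<open>nths\<close> recurses along the argument list, as the contraction step requires,
  whereas shuffles produce lists of indices; this passes from one form to the other.\<close>

lemma nths_eq_map_select: "nths vs S = map ((!) vs) (select (length vs) S)"
proof (induction vs arbitrary: S)
  case (Cons v vs)
  have "select (Suc n) S = (if 0 \<in> S then [0] else []) @ map Suc (select n {j. Suc j \<in> S})" for n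
    by (simp add: upt_conv_Cons map_Suc_upt[symmetric] filter_map comp_def del: upt_Suc)
  then show ?case by (simp add: nths_Cons Cons)
qed simp

text \<open>Membership of 0 decides which factor takes the leading argument; the two sums become the
  two terms of the superderivation rule.\<close>

lemma sum_Pow_lessThan_Suc:
  "(\<Sum>S\<in>Pow {..<Suc n}. g S) = (\<Sum>T\<in>Pow {..<n}. g (insert 0 (Suc ` T))) + (\<Sum>T\<in>Pow {..<n}. g (Suc ` T))"
proof -
  have "{..<Suc n} = insert 0 (Suc ` {..<n})"
    by (rule lessThan_Suc_eq_insert_0)
  then have eq: "Pow {..<Suc n} = (\<lambda>T. insert 0 (Suc ` T)) ` Pow {..<n} \<union> (\<lambda>T. Suc ` T) ` Pow {..<n}"
    by (simp add: Pow_insert image_Pow_surj[OF refl, symmetric] image_image Un_commute)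
  have inj: "inj_on (\<lambda>T. Suc ` T) B" "inj_on (\<lambda>T. insert 0 (Suc ` T)) B" for B
    by (auto simp: inj_on_def)
  show ?thesis unfolding eq
    by (subst sum.union_disjoint) (auto simp: sum.reindex inj)
qed

text \<open>Nothing lies below 0, and a member of the set is never the lower index of a counted
  pair, so 0 takes part in no crossing.\<close>

lemma cross_insert_0: "cross (p # ps) (insert 0 (Suc ` T)) = cross ps T"
proof -
  have "{(a, b). b < a \<and> a < length (p # ps) \<and> a \<in> insert 0 (Suc ` T) \<and> b \<notin> insert 0 (Suc ` T)
      \<and> (p # ps) ! a = 1 \<and> (p # ps) ! b = 1}
    = map_prod Suc Suc ` {(a, b). b < a \<and> a < length ps \<and> a \<in> T \<and> b \<notin> T \<and> ps ! a = 1 \<and> ps ! b = 1}"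
    (is "?L = _ ` ?R")
  proof (intro equalityI subsetI)
    fix x assume "x \<in> ?L"
    then obtain a b where x: "x = (a, b)" and ab: "(a, b) \<in> ?L" by (cases x) auto
    moreover from ab have "b \<noteq> 0" "a \<noteq> 0" by auto
    ultimately obtain a' b' where "a = Suc a'" "b = Suc b'" by (metis not0_implies_Suc)
    with ab have "(a', b') \<in> ?R" by auto
    then show "x \<in> map_prod Suc Suc ` ?R" using x \<open>a = Suc a'\<close> \<open>b = Suc b'\<close> by force
  qed auto
  moreover have "card (map_prod Suc Suc ` ?R) = card ?R" by (rule card_image) (auto simp: inj_on_def)
  ultimately show ?thesis unfolding cross_def by metis
qed

text \<open>Here 0 is outside the set and below every selected index, so an odd leading argument is
  crossed once by each odd selected one; modulo 2 the number of these is the sum of the selected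
  parities.\<close>

lemma cross_Suc: "cross (p # ps) (Suc ` T) = cross ps T + p * sum_list (nths ps T)"
proof -
  define R where "R = {(a, b). b < a \<and> a < length ps \<and> a \<in> T \<and> b \<notin> T \<and> ps ! a = 1 \<and> ps ! b = 1}"
  define Q where "Q = {a \<in> {..<length ps}. a \<in> T \<and> ps ! a = 1 \<and> p = 1}"
  have "{(a, b). b < a \<and> a < length (p # ps) \<and> a \<in> Suc ` T \<and> b \<notin> Suc ` T
      \<and> (p # ps) ! a = 1 \<and> (p # ps) ! b = 1}
    = map_prod Suc Suc ` R \<union> (\<lambda>a. (Suc a, 0)) ` Q" (is "?L = _")
  proof (intro equalityI subsetI)
    fix x assume "x \<in> ?L"
    then obtain a b where x: "x = (Suc a, b)" and ab: "(Suc a, b) \<in> ?L" by (cases x) auto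
    show "x \<in> map_prod Suc Suc ` R \<union> (\<lambda>a. (Suc a, 0)) ` Q"
    proof (cases b)
      case 0 then show ?thesis using x ab by (auto simp: Q_def)
    next
      case (Suc c)
      then have "(a, c) \<in> R" using x ab by (auto simp: R_def)
      then show ?thesis using x Suc by force
    qed
  qed (auto simp: R_def Q_def)
  moreover have "finite R"
    by (rule finite_subset[of _ "{..<length ps} \<times> {..<length ps}"]) (auto simp: R_def)
  moreover have "card (map_prod Suc Suc ` R \<union> (\<lambda>a. (Suc a, 0)) ` Q) = card R + card Q" if "finite R"
  proof -
    have "card (map_prod Suc Suc ` R) = card R" "card ((\<lambda>a. (Suc a, 0::nat)) ` Q) = card Q"
      by (auto intro!: card_image simp: inj_on_def)
    moreover have "finite Q" "map_prod Suc Suc ` R \<inter> (\<lambda>a. (Suc a, 0)) ` Q = {}" by (auto simp: Q_def)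
    ultimately show ?thesis using that by (simp add: card_Un_disjoint)
  qed
  ultimately have "cross (p # ps) (Suc ` T) = of_nat (card R + card Q)"
    unfolding cross_def by metis
  moreover have "of_nat (card Q) = p * sum_list (nths ps T)"
  proof -
    have "sum_list (nths ps T) = (\<Sum>a\<leftarrow>select (length ps) T. ps ! a)"
      by (simp add: nths_eq_map_select)
    also have "\<dots> = (\<Sum>a | a \<in> {..<length ps} \<and> a \<in> T. ps ! a)"
      by (subst sum_list_distinct_conv_sum_set) (auto intro: sum.cong)
    also have "\<dots> = (\<Sum>a\<in>{..<length ps}. if a \<in> T then ps ! a else 0)"
      by (simp add: sum.inter_restrict[symmetric] Collect_conj_eq lessThan_def)
    finally have "sum_list (nths ps T) = (\<Sum>a\<in>{..<length ps}. if a \<in> T then ps ! a else 0)" .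
    moreover have "(if a \<in> T \<and> ps ! a = 1 \<and> p = 1 then 1 else 0) = p * (if a \<in> T then ps ! a else 0)" for a
      by (cases p; cases "ps ! a"; simp)
    ultimately show ?thesis unfolding Q_def
      by (simp only: of_nat_card_bit[OF finite_lessThan] sum_distrib_left)
  qed
  ultimately show ?thesis by (simp add: cross_def R_def)
qed

text \<open>A permutation that increases on both blocks can invert only a position of the first
  block with one of the second. Hence \<open>\<sigma>\<close> carries its inversions bijectively
  onto the pairs counted by \<open>cross\<close>.\<close>

lemma interchanges_eq_cross:
  assumes n: "length ps = n" and \<sigma>: "\<sigma> \<in> shuffle_perms m n" and m: "m \<le> n"
  shows "interchanges ps \<sigma> = cross ps (\<sigma> ` {..<m})"
proof -
  have p: "\<sigma> permutes {..<n}" and s1: "strict_mono_on {..<m} \<sigma>" and s2: "strict_mono_on {m..<n} \<sigma>"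
    using \<sigma> by (auto simp: shuffle_perms_def)
  have inj: "inj \<sigma>" using p by (rule permutes_inj)
  have lt: "\<sigma> i < n \<longleftrightarrow> i < n" for i using permutes_in_image[OF p, of i] by simp
  have split: "i < m \<and> m \<le> j" if "i < j" "j < n" "\<sigma> j < \<sigma> i" for i j
  proof (rule ccontr)
    assume "\<not> (i < m \<and> m \<le> j)"
    then have "\<sigma> i < \<sigma> j"
      using that strict_mono_onD[OF s1, of i j] strict_mono_onD[OF s2, of i j] m by force
    then show False using that by simp
  qed
  let ?L = "{(i, j). i < j \<and> j < length ps \<and> \<sigma> j < \<sigma> i \<and> ps ! \<sigma> i = 1 \<and> ps ! \<sigma> j = 1}"
  let ?R = "{(a, b). b < a \<and> a < length ps \<and> a \<in> \<sigma> ` {..<m} \<and> b \<notin> \<sigma> ` {..<m} \<and> ps ! a = 1 \<and> ps ! b = 1}"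
  have "map_prod \<sigma> \<sigma> ` ?L = ?R"
  proof (intro equalityI subsetI)
    fix x assume "x \<in> map_prod \<sigma> \<sigma> ` ?L"
    then obtain i j where x: "x = (\<sigma> i, \<sigma> j)" and ij: "(i, j) \<in> ?L" by auto
    then have "i < m" "m \<le> j" using split[of i j] n by auto
    then have "\<sigma> j \<notin> \<sigma> ` {..<m}" using inj_image_mem_iff[OF inj] by auto
    with x ij \<open>i < m\<close> n show "x \<in> ?R" by (auto simp: lt)
  next
    fix x assume x: "x \<in> ?R"
    then obtain a b where ab: "x = (a, b)" "(a, b) \<in> ?R" by (cases x) auto
    obtain i where i: "a = \<sigma> i" "i < m" using ab by auto
    obtain j where j: "b = \<sigma> j" using permutes_surj[OF p] by (metis surjD)
    have "j < n" using ab j n lt[of j] by auto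
    moreover have "m \<le> j" using ab j by (metis (no_types, lifting) case_prodD image_eqI lessThan_iff mem_Collect_eq not_le)
    ultimately have "(i, j) \<in> ?L" using ab i j n by simp
    moreover have "x = map_prod \<sigma> \<sigma> (i, j)" using ab(1) i(1) j by simp
    ultimately show "x \<in> map_prod \<sigma> \<sigma> ` ?L" by (rule rev_image_eqI)
  qed
  moreover have "card (map_prod \<sigma> \<sigma> ` ?L) = card ?L"
    by (rule card_image[OF inj_on_subset[OF prod.inj_map[OF inj inj] subset_UNIV]])
  ultimately show ?thesis unfolding interchanges_def cross_def by metis
qed

text \<open>Each block lists its image in increasing order, and a sorted list without repetitions is
  determined by its set; so a shuffle is determined by the image of its first block.\<close>

lemma map_shuffle_eq_select:
  assumes \<sigma>: "\<sigma> \<in> shuffle_perms m n" and m: "m \<le> n"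
  shows "map \<sigma> [0..<m] = select n (\<sigma> ` {..<m})" "map \<sigma> [m..<n] = select n (- \<sigma> ` {..<m})"
proof -
  have p: "\<sigma> permutes {..<n}" and s1: "strict_mono_on {..<m} \<sigma>" and s2: "strict_mono_on {m..<n} \<sigma>"
    using \<sigma> by (auto simp: shuffle_perms_def)
  have inj: "inj \<sigma>" using p by (rule permutes_inj)
  have lt: "\<sigma> i < n \<longleftrightarrow> i < n" for i using permutes_in_image[OF p, of i] by simp
  have sorted: "sorted (map \<sigma> [a..<b])" if "strict_mono_on {a..<b} \<sigma>" for a b
    using strict_mono_on_leD[OF that] by (auto simp: sorted_iff_nth_mono)
  have dist: "distinct (map \<sigma> [a..<b])" for a b
    using inj by (auto simp: distinct_map inj_on_def)
  have set2: "\<sigma> ` {m..<n} = {..<n} - \<sigma> ` {..<m}"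
  proof -
    have "{m..<n} = {..<n} - {..<m}" by auto
    then show ?thesis by (simp only: image_set_diff[OF inj] permutes_image[OF p])
  qed
  show "map \<sigma> [0..<m] = select n (\<sigma> ` {..<m})"
    by (rule sorted_distinct_set_unique) (use sorted[of 0 m] s1 dist lt m in \<open>auto simp: atLeast0LessThan sorted_wrt_filter\<close>)
  show "map \<sigma> [m..<n] = select n (- \<sigma> ` {..<m})"
    by (rule sorted_distinct_set_unique) (use sorted s2 dist set2 in \<open>auto simp: sorted_wrt_filter\<close>)
qed

text \<open>Reindexes by the bijection that sends a shuffle to the image of its first block. The
  summand is kept abstract as \<open>\<Psi>\<close> so that both the box product and the
  concatenation product are instances.\<close>

lemma sum_shuffles:
  fixes \<Psi> :: "bit \<Rightarrow> nat list \<Rightarrow> nat list \<Rightarrow> 'v::ab_group_add"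
  assumes n: "length ps = n"
  shows "(\<Sum>m\<le>n. \<Sum>\<sigma>\<in>shuffle_perms m n. \<Psi> (interchanges ps \<sigma>) (map \<sigma> [0..<m]) (map \<sigma> [m..<n]))
    = (\<Sum>S\<in>Pow {..<n}. \<Psi> (cross ps S) (select n S) (select n (- S)))"
proof -
  define l where "l S = select n S @ select n (- S)" for S
  \<comment> \<open>The inverse of the bijection: the permutation that enumerates \<open>S\<close>
    and after it the complement, continued by the identity beyond \<open>n\<close> because
    \<open>permutes\<close> demands it.\<close>
  define w where "w S i = (if i < n then l S ! i else i)" for S i
  have fin: "finite (shuffle_perms m n)" for m
    by (rule finite_subset[OF _ finite_permutations[of "{..<n}"]]) (auto simp: shuffle_perms_def)
  have len1: "length (select n S) = card S" if "S \<subseteq> {..<n}" for S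
  proof -
    have "length (select n S) = card (set (select n S))" by (rule distinct_card[symmetric]) simp
    also have "set (select n S) = S" using that by auto
    finally show ?thesis .
  qed
  have len: "length (l S) = n" for S
    using sum_length_filter_compl[of "\<lambda>i. i \<in> S" "[0..<n]"] by (simp add: l_def)
  have setl: "set (l S) = {..<n}" for S by (auto simp: l_def)
  have distl: "distinct (l S)" for S by (auto simp: l_def)
  have mapw: "map (w S) [0..<n] = l S" for S
    by (rule nth_equalityI) (auto simp: len w_def)
  have take_drop: "map (w S) [0..<card S] = select n S" "map (w S) [card S..<n] = select n (- S)"
    if "S \<subseteq> {..<n}" for S
  proof -
    have c: "card S \<le> n" using card_mono[OF _ that] by simp
    have "map (w S) [0..<card S] = take (card S) (l S)"
      by (simp add: mapw[symmetric] take_map c)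
    then show "map (w S) [0..<card S] = select n S" by (simp add: l_def len1[OF that])
    have "map (w S) [card S..<n] = drop (card S) (l S)"
      by (simp add: mapw[symmetric] drop_map)
    then show "map (w S) [card S..<n] = select n (- S)" by (simp add: l_def len1[OF that])
  qed
  have mono: "strict_mono_on {a..<b} f" if "sorted (map f [a..<b])" "distinct (map f [a..<b])"
    for f :: "nat \<Rightarrow> nat" and a b
  proof (rule strict_mono_onI)
    fix r s assume rs: "r \<in> {a..<b}" "s \<in> {a..<b}" "r < s"
    then have "map f [a..<b] ! (r - a) < map f [a..<b] ! (s - a)"
      using that by (intro sorted_wrt_nth_less[of "(<)"]) (auto simp: strict_sorted_iff)
    then show "f r < f s" using rs by simp
  qed
  have shuf: "w S \<in> shuffle_perms (card S) n" if S: "S \<subseteq> {..<n}" for S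
  proof -
    have "bij_betw (\<lambda>i. l S ! i) {..<n} {..<n}"
      using bij_betw_nth[OF distl] len setl by metis
    then have "bij_betw (w S) {..<n} {..<n}"
      by (rule bij_betw_cong[THEN iffD1, rotated]) (simp add: w_def)
    then have "w S permutes {..<n}" by (rule bij_imp_permutes) (simp add: w_def)
    then show ?thesis
      using mono[where f = "w S" and a = 0 and b = "card S"] mono[where f = "w S" and a = "card S" and b = n] take_drop[OF S]
      by (simp add: shuffle_perms_def sorted_wrt_filter atLeast0LessThan)
  qed
  have "(\<Sum>m\<le>n. \<Sum>\<sigma>\<in>shuffle_perms m n. \<Psi> (interchanges ps \<sigma>) (map \<sigma> [0..<m]) (map \<sigma> [m..<n]))
    = (\<Sum>(m, \<sigma>)\<in>Sigma {..n} (\<lambda>m. shuffle_perms m n). \<Psi> (interchanges ps \<sigma>) (map \<sigma> [0..<m]) (map \<sigma> [m..<n]))"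
    by (rule sum.Sigma) (auto simp: fin)
  also have "\<dots> = (\<Sum>S\<in>Pow {..<n}. \<Psi> (cross ps S) (select n S) (select n (- S)))"
  proof (rule sum.reindex_bij_witness[where i = "\<lambda>S. (card S, w S)" and j = "\<lambda>(m, \<sigma>). \<sigma> ` {..<m}"])
    fix x assume "x \<in> Sigma {..n} (\<lambda>m. shuffle_perms m n)"
    then obtain m \<sigma> where x: "x = (m, \<sigma>)" and m: "m \<le> n" and \<sigma>: "\<sigma> \<in> shuffle_perms m n" by auto
    then have p: "\<sigma> permutes {..<n}" by (simp add: shuffle_perms_def)
    have c: "card (\<sigma> ` {..<m}) = m"
      using permutes_inj[OF p] by (subst card_image) (auto simp: inj_on_def)
    have "[0..<n] = [0..<m] @ [m..<n]" using m by (metis le_add_diff_inverse upt_add_eq_append zero_le)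
    then have "map \<sigma> [0..<n] = l (\<sigma> ` {..<m})"
      unfolding l_def by (simp only: map_append map_shuffle_eq_select[OF \<sigma> m])
    then have "w (\<sigma> ` {..<m}) i = \<sigma> i" for i
      using permutes_not_in[OF p, of i] by (auto simp: w_def) (metis add_0 diff_zero length_upt nth_map nth_upt)
    then show "(\<lambda>S. (card S, w S)) ((\<lambda>(m, \<sigma>). \<sigma> ` {..<m}) x) = x"
      by (simp add: x c fun_eq_iff)
    show "(\<lambda>(m, \<sigma>). \<sigma> ` {..<m}) x \<in> Pow {..<n}"
      using permutes_image[OF p] m by (auto simp: x)
    show "\<Psi> (cross ps ((\<lambda>(m, \<sigma>). \<sigma> ` {..<m}) x)) (select n ((\<lambda>(m, \<sigma>). \<sigma> ` {..<m}) x)) (select n (- (\<lambda>(m, \<sigma>). \<sigma> ` {..<m}) x))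
       = (case x of (m, \<sigma>) \<Rightarrow> \<Psi> (interchanges ps \<sigma>) (map \<sigma> [0..<m]) (map \<sigma> [m..<n]))"
      by (simp add: x interchanges_eq_cross[OF n \<sigma> m] map_shuffle_eq_select[OF \<sigma> m])
  next
    fix S assume "S \<in> Pow {..<n}"
    then have S: "S \<subseteq> {..<n}" by simp
    have "w S ` {..<card S} = set (select n S)" by (simp add: take_drop[OF S, symmetric] atLeast0LessThan)
    then show "(\<lambda>(m, \<sigma>). \<sigma> ` {..<m}) (card S, w S) = S" using S by auto
    show "(card S, w S) \<in> Sigma {..n} (\<lambda>m. shuffle_perms m n)"
      using shuf[OF S] card_mono[OF _ S] by simp
  qed
  finally show ?thesis .
qed

section \<open>Multilinear maps of mixed arity\<close>

definition contract :: "'v \<Rightarrow> ('v list \<Rightarrow> 'v) \<Rightarrow> 'v list \<Rightarrow> 'v" where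
  "contract v f vs = f (v # vs)"

text \<open>A set of arities rather than a single one, since elements of the direct sum mix
  several.\<close>

definition arity_in :: "nat set \<Rightarrow> ('v list \<Rightarrow> 'v::zero) \<Rightarrow> bool" where
  "arity_in K f \<longleftrightarrow> (\<forall>vs. f vs \<noteq> 0 \<longrightarrow> length vs \<in> K)"

lemma arity_in_mono: "arity_in K f \<Longrightarrow> K \<subseteq> L \<Longrightarrow> arity_in L f"
  unfolding arity_in_def by blast

lemma sgn_pow_contract: "contract v (sgn_pow p f) = sgn_pow p (contract v f)"
  by (cases p; simp add: contract_def fun_eq_iff)

lemma contract_simps [simp]:
  "contract v (f + g) = contract v f + contract v g"
  "contract v (f - g) = contract v f - contract v g"
  "contract v (- f) = - contract v f"
  "contract v 0 = 0"
  by (simp_all add: contract_def fun_eq_iff)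

abbreviation even_part :: "(bit \<Rightarrow> 'v::ab_group_add set) \<Rightarrow> 'v \<Rightarrow> 'v" where
  "even_part U \<equiv> hcomp U 0"

abbreviation odd_part :: "(bit \<Rightarrow> 'v::ab_group_add set) \<Rightarrow> 'v \<Rightarrow> 'v" where
  "odd_part U \<equiv> hcomp U 1"

section \<open>Parity components in a superspace\<close>

context superspace
begin

lemma zero_mem [simp, intro]: "0 \<in> U p"
  using subspace_parity subspace_0 by blast

lemma add_mem: "x \<in> U p \<Longrightarrow> y \<in> U p \<Longrightarrow> x + y \<in> U p"
  using subspace_parity subspace_add by blast

lemma diff_mem: "x \<in> U p \<Longrightarrow> y \<in> U p \<Longrightarrow> x - y \<in> U p"
  using subspace_parity subspace_diff by blast

lemma minus_mem: "x \<in> U p \<Longrightarrow> - x \<in> U p"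
  using subspace_parity subspace_neg by blast

lemma scale_mem: "x \<in> U p \<Longrightarrow> scale r x \<in> U p"
  using subspace_parity subspace_scale by blast

lemma sgn_pow_mem: "x \<in> U p \<Longrightarrow> sgn_pow q x \<in> U p"
  by (cases q) (auto intro: minus_mem)

lemma sgn_pow_scale: "sgn_pow p (scale r x) = scale r (sgn_pow p x)"
  by (cases p; simp)

lemma subspace_carrier: "subspace (carrier_of U)"
proof -
  have "carrier_of U = {x + y | x y. x \<in> U 0 \<and> y \<in> U 1}" by (rule carrier_of_def)
  then show ?thesis
    using subspace_sums[OF subspace_parity[of 0] subspace_parity[of 1]] by simp
qed

lemmas carrier_zero [simp, intro] = subspace_0[OF subspace_carrier]
  and carrier_add = subspace_add[OF subspace_carrier]
  and carrier_diff = subspace_diff[OF subspace_carrier]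
  and carrier_minus = subspace_neg[OF subspace_carrier]
  and carrier_scale = subspace_scale[OF subspace_carrier]

lemma carrier_sgn_pow: "x \<in> carrier_of U \<Longrightarrow> sgn_pow p x \<in> carrier_of U"
  by (cases p) (auto intro: carrier_minus)

lemma carrierI: "x \<in> U p \<Longrightarrow> x \<in> carrier_of U"
proof -
  have "x = x + 0" "x = 0 + x" by auto
  then show "x \<in> U p \<Longrightarrow> x \<in> carrier_of U"
    unfolding carrier_of_def by (cases p) blast+
qed

lemma parity_inter: "x \<in> U p \<Longrightarrow> x \<in> U (p + 1) \<Longrightarrow> x = 0"
  using parity_disjoint by (cases p) auto

lemma hcomp_eqI:
  assumes "x \<in> U p" "u - x \<in> U (p + 1)" shows "hcomp U p u = x"
  unfolding hcomp_def
proof (rule the_equality)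
  fix y assume y: "y \<in> U p \<and> u - y \<in> U (p + 1)"
  have "x - y \<in> U p" using assms y by (auto intro: diff_mem)
  moreover have "x - y = (u - y) - (u - x)" by simp
  then have "x - y \<in> U (p + 1)" using assms y by (metis diff_mem)
  ultimately show "y = x" using parity_inter[of "x - y" p] by simp
qed (use assms in simp)

lemma hcomp_sum_eq:
  assumes "x \<in> U 0" "y \<in> U 1" shows "even_part U (x + y) = x" "odd_part U (x + y) = y"
  using assms by (auto intro!: hcomp_eqI)

lemma hcomp_mem: "u \<in> carrier_of U \<Longrightarrow> hcomp U p u \<in> U p"
  unfolding carrier_of_def by (cases p) (auto simp: hcomp_sum_eq)

lemma hcomp_carrier: "u \<in> carrier_of U \<Longrightarrow> hcomp U p u \<in> carrier_of U"
  by (rule carrierI[OF hcomp_mem])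

lemma hcomp_decomp: "u \<in> carrier_of U \<Longrightarrow> even_part U u + odd_part U u = u"
  unfolding carrier_of_def by (auto simp: hcomp_sum_eq)

lemma hcomp_compl:
  assumes "u \<in> carrier_of U" shows "u - hcomp U p u = hcomp U (p + 1) u"
  using hcomp_decomp[OF assms] by (cases p) (auto simp: algebra_simps)

lemma hcomp_zero [simp]: "hcomp U p 0 = 0"
  using hcomp_homogeneous[OF zero_mem[of p], of p] by simp

lemma hcomp_add:
  assumes "u \<in> carrier_of U" "v \<in> carrier_of U"
  shows "hcomp U p (u + v) = hcomp U p u + hcomp U p v"
proof (rule hcomp_eqI)
  have "u + v - (hcomp U p u + hcomp U p v) = hcomp U (p + 1) u + hcomp U (p + 1) v"
    using assms by (simp only: hcomp_compl[symmetric]) (simp add: algebra_simps)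
  then show "u + v - (hcomp U p u + hcomp U p v) \<in> U (p + 1)"
    using assms by (simp add: add_mem hcomp_mem)
qed (use assms in \<open>auto intro: add_mem hcomp_mem\<close>)

lemma hcomp_scale:
  assumes "u \<in> carrier_of U"
  shows "hcomp U p (scale r u) = scale r (hcomp U p u)"
proof (rule hcomp_eqI)
  have "scale r u - scale r (hcomp U p u) = scale r (hcomp U (p + 1) u)"
    using assms by (simp only: hcomp_compl[symmetric] scale_right_diff_distrib)
  then show "scale r u - scale r (hcomp U p u) \<in> U (p + 1)"
    using assms by (simp add: scale_mem hcomp_mem)
qed (use assms in \<open>auto intro: scale_mem hcomp_mem\<close>)

lemma hcomp_sgn_pow:
  assumes "u \<in> carrier_of U" shows "hcomp U p (sgn_pow q u) = sgn_pow q (hcomp U p u)"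
  using hcomp_scale[OF assms, of p "-1"] by (cases q) auto

lemma carrier_induct [consumes 1, case_names homogeneous add]:
  assumes "u \<in> carrier_of U" "\<And>p x. x \<in> U p \<Longrightarrow> P x"
    "\<And>x y. x \<in> carrier_of U \<Longrightarrow> y \<in> carrier_of U \<Longrightarrow> P x \<Longrightarrow> P y \<Longrightarrow> P (x + y)"
  shows "P u"
proof -
  obtain x y where "u = x + y" "x \<in> U 0" "y \<in> U 1"
    using assms(1) by (auto simp: carrier_of_def)
  then show ?thesis using assms(2,3) carrierI by metis
qed

section \<open>Reduction to homogeneous arguments\<close>

abbreviation hom_list :: "'v list \<Rightarrow> bit list \<Rightarrow> bool" where
  "hom_list vs ps \<equiv> list_all2 (\<lambda>v p. v \<in> U p) vs ps"

lemma hom_list_carrier: "hom_list vs ps \<Longrightarrow> set vs \<subseteq> carrier_of U"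
  by (induction rule: list_all2_induct) (auto intro: carrierI)

text \<open>A fragment of additivity that every \<open>multilin_ext\<close> of a formula vanishing
  at zero arguments has by construction. It already reduces identities to homogeneous arguments at a
  stage where multilinearity is still to be proved.\<close>

definition splits :: "('v list \<Rightarrow> 'v) \<Rightarrow> bool" where
  "splits f \<longleftrightarrow> (\<forall>xs v ys. set xs \<union> {v} \<union> set ys \<subseteq> carrier_of U \<longrightarrow>
     f (xs @ v # ys) = f (xs @ even_part U v # ys) + f (xs @ odd_part U v # ys))"

lemma splitsD:
  "splits f \<Longrightarrow> set xs \<subseteq> carrier_of U \<Longrightarrow> v \<in> carrier_of U \<Longrightarrow> set ys \<subseteq> carrier_of U \<Longrightarrow>
   f (xs @ v # ys) = f (xs @ even_part U v # ys) + f (xs @ odd_part U v # ys)"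
  unfolding splits_def by blast

lemma splits_zero:
  assumes f: "splits f" and 0: "\<And>vs ps. hom_list vs ps \<Longrightarrow> f vs = 0"
    and vs: "set vs \<subseteq> carrier_of U"
  shows "f vs = 0"
proof -
  \<comment> \<open>The prefix \<open>xs\<close> is already homogeneous; the induction decomposes
    the tail one argument at a time.\<close>
  have "hom_list xs ps \<Longrightarrow> set ys \<subseteq> carrier_of U \<Longrightarrow> f (xs @ ys) = 0" for xs ps ys
  proof (induction ys arbitrary: xs ps)
    case Nil then show ?case using 0 by simp
  next
    case (Cons v ys)
    have "f (xs @ hcomp U p v # ys) = 0" for p
      using Cons.IH[of "xs @ [hcomp U p v]" "ps @ [p]"] Cons.prems
      by (simp add: list_all2_appendI hcomp_mem)
    then show ?case using splitsD[OF f hom_list_carrier[OF Cons.prems(1)], of v ys] Cons.prems by simp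
  qed
  from this[of "[]" "[]" vs] vs show ?thesis by simp
qed

lemma splits_ext:
  assumes "splits f" "splits g" "\<And>vs ps. hom_list vs ps \<Longrightarrow> f vs = g vs"
    and "\<And>vs. \<not> set vs \<subseteq> carrier_of U \<Longrightarrow> f vs = 0" "\<And>vs. \<not> set vs \<subseteq> carrier_of U \<Longrightarrow> g vs = 0"
  shows "f = g"
proof
  fix vs
  have "splits (\<lambda>vs. f vs - g vs)" unfolding splits_def
    using assms(1,2) by (auto simp: splitsD)
  from splits_zero[OF this, of vs] show "f vs = g vs"
    using assms(3-5) by (cases "set vs \<subseteq> carrier_of U") auto
qed

text \<open>The conditions of \<open>hom_sym\<close> without the restriction on the length of the
  list. Contraction lowers arities, so a class that ignores them is stable under it, and no
  induction has to keep track of degrees.\<close>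

definition mlin :: "('v list \<Rightarrow> 'v) set" where
  "mlin = {f.
     (\<forall>vs. set vs \<subseteq> carrier_of U \<longrightarrow> f vs \<in> carrier_of U) \<and>
     (\<forall>vs. \<not> set vs \<subseteq> carrier_of U \<longrightarrow> f vs = 0) \<and>
     (\<forall>xs u v ys. set xs \<union> {u, v} \<union> set ys \<subseteq> carrier_of U \<longrightarrow>
        f (xs @ (u + v) # ys) = f (xs @ u # ys) + f (xs @ v # ys)) \<and>
     (\<forall>xs u ys r. set xs \<union> {u} \<union> set ys \<subseteq> carrier_of U \<longrightarrow>
        f (xs @ scale r u # ys) = scale r (f (xs @ u # ys))) \<and>
     (\<forall>xs u v ys p q. set xs \<union> set ys \<subseteq> carrier_of U \<and> u \<in> U p \<and> v \<in> U q \<longrightarrow>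
        f (xs @ u # v # ys) = sgn_pow (p * q) (f (xs @ v # u # ys)))}"

lemma mlin_carrier: assumes "f \<in> mlin" shows "f vs \<in> carrier_of U"
  using assms[unfolded mlin_def mem_Collect_eq, THEN conjunct1, rule_format, of vs]
    assms[unfolded mlin_def mem_Collect_eq, THEN conjunct2, THEN conjunct1, rule_format, of vs]
  by (cases "set vs \<subseteq> carrier_of U") simp_all

lemma mlin_outside: assumes "f \<in> mlin" shows "\<not> set vs \<subseteq> carrier_of U \<Longrightarrow> f vs = 0"
  using assms[unfolded mlin_def mem_Collect_eq, THEN conjunct2, THEN conjunct1, rule_format, of vs] .

lemma mlin_add:
  assumes f: "f \<in> mlin" and u: "u \<in> carrier_of U" "v \<in> carrier_of U"
  shows "f (xs @ (u + v) # ys) = f (xs @ u # ys) + f (xs @ v # ys)"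
proof (cases "set (xs @ ys) \<subseteq> carrier_of U")
  case True
  then show ?thesis
    using u by (intro f[unfolded mlin_def mem_Collect_eq, THEN conjunct2, THEN conjunct2, THEN conjunct1, rule_format]) auto
next
  case False
  then have "\<not> set (xs @ w # ys) \<subseteq> carrier_of U" for w by auto
  then show ?thesis using mlin_outside[OF f] by simp
qed

lemma mlin_scale:
  assumes f: "f \<in> mlin" and u: "u \<in> carrier_of U"
  shows "f (xs @ scale r u # ys) = scale r (f (xs @ u # ys))"
proof (cases "set (xs @ ys) \<subseteq> carrier_of U")
  case True
  then show ?thesis
    using u by (intro f[unfolded mlin_def mem_Collect_eq, THEN conjunct2, THEN conjunct2, THEN conjunct2, THEN conjunct1, rule_format]) auto
next
  case False
  then have "\<not> set (xs @ w # ys) \<subseteq> carrier_of U" for w by auto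
  then show ?thesis using mlin_outside[OF f] by simp
qed

lemma mlin_swap:
  assumes f: "f \<in> mlin" and u: "u \<in> U p" "v \<in> U q"
  shows "f (xs @ u # v # ys) = sgn_pow (p * q) (f (xs @ v # u # ys))"
proof (cases "set (xs @ ys) \<subseteq> carrier_of U")
  case True
  then show ?thesis
    using u by (intro f[unfolded mlin_def mem_Collect_eq, THEN conjunct2, THEN conjunct2, THEN conjunct2, THEN conjunct2, rule_format]) auto
next
  case False
  then have "\<not> set (xs @ w # z # ys) \<subseteq> carrier_of U" for w z by auto
  then show ?thesis using mlin_outside[OF f] by simp
qed

lemma mlin_zero_arg:
  assumes "f \<in> mlin" "0 \<in> set vs" shows "f vs = 0"
proof -
  obtain xs ys where "vs = xs @ 0 # ys" using assms(2) by (meson split_list)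
  then show ?thesis using mlin_add[OF assms(1), of 0 0 xs ys] by simp
qed

lemma mlin_splits: "f \<in> mlin \<Longrightarrow> splits f"
  unfolding splits_def by (auto simp: mlin_add[symmetric] hcomp_carrier hcomp_decomp)

text \<open>The defect of each axiom, as a function of the arguments to the left and to the right of
  the slot concerned, splits in both; it vanishes as soon as it vanishes on homogeneous
  lists.\<close>

lemma mlinI:
  assumes out: "\<And>vs. \<not> set vs \<subseteq> carrier_of U \<Longrightarrow> f vs = 0"
    and split: "splits f"
    and car: "\<And>vs ps. hom_list vs ps \<Longrightarrow> f vs \<in> carrier_of U"
    and add: "\<And>xs ps u v p ys qs. hom_list xs ps \<Longrightarrow> u \<in> U p \<Longrightarrow> v \<in> U p \<Longrightarrow> hom_list ys qs \<Longrightarrow>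
      f (xs @ (u + v) # ys) = f (xs @ u # ys) + f (xs @ v # ys)"
    and scale: "\<And>xs ps u p ys qs r. hom_list xs ps \<Longrightarrow> u \<in> U p \<Longrightarrow> hom_list ys qs \<Longrightarrow>
      f (xs @ scale r u # ys) = scale r (f (xs @ u # ys))"
    and swap: "\<And>xs ps u p v q ys qs. hom_list xs ps \<Longrightarrow> u \<in> U p \<Longrightarrow> v \<in> U q \<Longrightarrow> hom_list ys qs \<Longrightarrow>
      f (xs @ u # v # ys) = sgn_pow (p * q) (f (xs @ v # u # ys))"
  shows "f \<in> mlin"
proof -
  \<comment> \<open>\<open>splits_zero\<close> is applied twice, to the left list and to the right
    list separately, because the entry between them is held fixed.\<close>
  have two: "h xs ys = 0"
    if left: "\<And>ys. set ys \<subseteq> carrier_of U \<Longrightarrow> splits (\<lambda>xs. h xs ys)"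
      and right: "\<And>xs. set xs \<subseteq> carrier_of U \<Longrightarrow> splits (h xs)"
      and hom: "\<And>xs ps ys qs. hom_list xs ps \<Longrightarrow> hom_list ys qs \<Longrightarrow> h xs ys = 0"
      and "set xs \<subseteq> carrier_of U" "set ys \<subseteq> carrier_of U" for h xs ys
  proof (rule splits_zero[of "\<lambda>xs. h xs ys", OF left])
    fix vs ps assume vs: "hom_list vs ps"
    show "h vs ys = 0"
      by (rule splits_zero[OF right[OF hom_list_carrier[OF vs]]]) (use hom vs that in auto)
  qed (use that in auto)
  have spl: "splits (\<lambda>xs. f (xs @ zs))" "splits (\<lambda>xs. f (zs @ xs))"
    if "set zs \<subseteq> carrier_of U" for zs
    unfolding splits_def using that splitsD[OF split] splitsD[OF split, of "zs @ _", simplified]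
    by auto
  have spl_diff: "splits (\<lambda>xs. g xs - h xs)" if "splits g" "splits h" for g h
    using that by (auto simp: splits_def)
  have spl_sgn: "splits (\<lambda>xs. sgn_pow p (h xs))" and spl_scale: "splits (\<lambda>xs. scale r (h xs))"
    if "splits h" for h p r
    using that by (auto simp: splits_def sgn_pow_add scale_right_distrib)
  note spl_comb = spl_diff spl_sgn spl_scale
  have spl_Cons: "splits (\<lambda>xs. f (zs @ u # xs))" "splits (\<lambda>xs. f (zs @ u # v # xs))"
    if "set zs \<subseteq> carrier_of U" "u \<in> carrier_of U" "v \<in> carrier_of U" for zs u v
    using spl(2)[of "zs @ [u]"] spl(2)[of "zs @ [u, v]"] that by simp_all
  have add1: "f (xs @ (u + v) # ys) - f (xs @ u # ys) - f (xs @ v # ys) = 0"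
    if "set xs \<subseteq> carrier_of U" "u \<in> U p" "v \<in> U p" "set ys \<subseteq> carrier_of U" for xs u v p ys
  proof (rule two[where h = "\<lambda>xs ys. f (xs @ (u + v) # ys) - f (xs @ u # ys) - f (xs @ v # ys)" and xs = xs and ys = ys])
    fix zs assume zs: "set zs \<subseteq> carrier_of U"
    have c: "u \<in> carrier_of U" "v \<in> carrier_of U" "u + v \<in> carrier_of U"
      using that carrierI carrier_add by blast+
    show "splits (\<lambda>xs. f (xs @ (u + v) # zs) - f (xs @ u # zs) - f (xs @ v # zs))"
      by (intro spl_comb spl(1)) (use c zs in auto)
    show "splits (\<lambda>ys. f (zs @ (u + v) # ys) - f (zs @ u # ys) - f (zs @ v # ys))"
      by (intro spl_comb spl_Cons) (use c zs in auto)
  qed (use that add in auto)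
  have scale1: "f (xs @ scale r u # ys) - scale r (f (xs @ u # ys)) = 0"
    if "set xs \<subseteq> carrier_of U" "u \<in> U p" "set ys \<subseteq> carrier_of U" for xs u p ys r
  proof (rule two[where h = "\<lambda>xs ys. f (xs @ scale r u # ys) - scale r (f (xs @ u # ys))" and xs = xs and ys = ys])
    fix zs assume zs: "set zs \<subseteq> carrier_of U"
    have c: "u \<in> carrier_of U" "scale r u \<in> carrier_of U"
      using that carrierI carrier_scale by blast+
    show "splits (\<lambda>xs. f (xs @ scale r u # zs) - scale r (f (xs @ u # zs)))"
      by (intro spl_comb spl(1)) (use c zs in auto)
    show "splits (\<lambda>ys. f (zs @ scale r u # ys) - scale r (f (zs @ u # ys)))"
      by (intro spl_comb spl_Cons) (use c zs in auto)
  qed (use that scale in auto)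
  have swap1: "f (xs @ u # v # ys) - sgn_pow (p * q) (f (xs @ v # u # ys)) = 0"
    if "set xs \<subseteq> carrier_of U" "u \<in> U p" "v \<in> U q" "set ys \<subseteq> carrier_of U" for xs u p v q ys
  proof (rule two[where h = "\<lambda>xs ys. f (xs @ u # v # ys) - sgn_pow (p * q) (f (xs @ v # u # ys))" and xs = xs and ys = ys])
    fix zs assume zs: "set zs \<subseteq> carrier_of U"
    have c: "u \<in> carrier_of U" "v \<in> carrier_of U"
      using that carrierI by blast+
    show "splits (\<lambda>xs. f (xs @ u # v # zs) - sgn_pow (p * q) (f (xs @ v # u # zs)))"
      by (intro spl_comb spl(1)) (use c zs in auto)
    show "splits (\<lambda>ys. f (zs @ u # v # ys) - sgn_pow (p * q) (f (zs @ v # u # ys)))"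
      by (intro spl_comb spl_Cons) (use c zs in auto)
  qed (use that in \<open>simp_all add: swap[OF _ that(2,3)]\<close>)
  show ?thesis unfolding mlin_def
  proof (intro CollectI conjI allI impI)
    show "f vs \<in> carrier_of U" if "set vs \<subseteq> carrier_of U" for vs
    proof -
      have "hom_list xs ps \<Longrightarrow> set ys \<subseteq> carrier_of U \<Longrightarrow> f (xs @ ys) \<in> carrier_of U" for xs ps ys
      proof (induction ys arbitrary: xs ps)
        case Nil then show ?case using car by simp
      next
        case (Cons v ys)
        have "f (xs @ hcomp U p v # ys) \<in> carrier_of U" for p
          using Cons.IH[of "xs @ [hcomp U p v]" "ps @ [p]"] Cons.prems
          by (simp add: list_all2_appendI hcomp_mem)
        then show ?case
          using splitsD[OF split hom_list_carrier[OF Cons.prems(1)], of v ys] Cons.prems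
          by (simp add: carrier_add)
      qed
      from this[of "[]" "[]" vs] that show ?thesis by simp
    qed
    show "f vs = 0" if "\<not> set vs \<subseteq> carrier_of U" for vs using out that .
    show "f (xs @ (u + v) # ys) = f (xs @ u # ys) + f (xs @ v # ys)"
      if "set xs \<union> {u, v} \<union> set ys \<subseteq> carrier_of U" for xs u v ys
    proof -
      have m: "set xs \<subseteq> carrier_of U" "u \<in> carrier_of U" "v \<in> carrier_of U" "set ys \<subseteq> carrier_of U"
        using that by auto
      \<comment> \<open>The hypothesis \<open>add\<close> covers two vectors of equal parity only,
        so additivity is checked in each parity component of \<open>u + v\<close> and reassembled by
        \<open>split\<close>.\<close>
      have "f (xs @ hcomp U p (u + v) # ys) = f (xs @ hcomp U p u # ys) + f (xs @ hcomp U p v # ys)" for p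
        using add1[of xs "hcomp U p u" p "hcomp U p v" ys] m
        by (simp add: hcomp_add hcomp_mem algebra_simps)
      then show ?thesis
        using m by (simp add: splitsD[OF split, of xs _ ys] carrier_add)
    qed
    show "f (xs @ scale r u # ys) = scale r (f (xs @ u # ys))"
      if "set xs \<union> {u} \<union> set ys \<subseteq> carrier_of U" for xs u ys r
    proof -
      have m: "set xs \<subseteq> carrier_of U" "u \<in> carrier_of U" "set ys \<subseteq> carrier_of U"
        using that by auto
      have "f (xs @ hcomp U p (scale r u) # ys) = scale r (f (xs @ hcomp U p u # ys))" for p
        using scale1[of xs "hcomp U p u" p ys r] m
        by (simp add: hcomp_scale hcomp_mem)
      then show ?thesis
        using m by (simp add: splitsD[OF split, of xs _ ys] carrier_scale scale_right_distrib)
    qed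
    show "f (xs @ u # v # ys) = sgn_pow (p * q) (f (xs @ v # u # ys))"
      if "set xs \<union> set ys \<subseteq> carrier_of U \<and> u \<in> U p \<and> v \<in> U q" for xs u v ys p q
      using swap1[of xs u p v q ys] that by simp
  qed
qed

section \<open>Homogeneous maps and their contractions\<close>

definition mpar :: "bit \<Rightarrow> ('v list \<Rightarrow> 'v) set" where
  "mpar q = {f \<in> mlin. has_map_parity U q f}"

lemma mpar_mlin: "f \<in> mpar q \<Longrightarrow> f \<in> mlin"
  by (simp add: mpar_def)

lemma mpar_mem: "f \<in> mpar q \<Longrightarrow> hom_list vs ps \<Longrightarrow> f vs \<in> U (q + sum_list ps)"
  by (simp add: mpar_def has_map_parity_def)

lemma mpar_Nil: "f \<in> mpar q \<Longrightarrow> f [] \<in> U q"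
  using mpar_mem[of f q "[]" "[]"] by simp

lemma mpar_Cons: "f \<in> mpar q \<Longrightarrow> v \<in> U p \<Longrightarrow> f [v] \<in> U (q + p)"
  using mpar_mem[of f q "[v]" "[p]"] by simp

lemma mlin_ext:
  assumes "f \<in> mlin" "g \<in> mlin" "\<And>vs ps. hom_list vs ps \<Longrightarrow> f vs = g vs"
  shows "f = g"
  using assms by (intro splits_ext) (auto intro: mlin_splits mlin_outside)

lemma fun_module: "vector_space (fscale scale :: 'f \<Rightarrow> ('b \<Rightarrow> 'v) \<Rightarrow> ('b \<Rightarrow> 'v))"
  by unfold_locales (auto simp: fscale_def fun_eq_iff scale_right_distrib scale_left_distrib)

lemma mlin_0 [simp]: "0 \<in> mlin"
  by (simp add: mlin_def)

lemma mlin_plus: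
  assumes f: "f \<in> mlin" and g: "g \<in> mlin" shows "f + g \<in> mlin"
proof (rule mlinI)
  show "splits (f + g)"
    using f g by (auto simp: splits_def mlin_splits[THEN splitsD])
  show "(f + g) (xs @ u # v # ys) = sgn_pow (p * q) ((f + g) (xs @ v # u # ys))"
    if "u \<in> U p" "v \<in> U q" for xs u p v q ys
    using mlin_swap[OF f that, of xs ys] mlin_swap[OF g that, of xs ys] by (simp add: sgn_pow_add)
qed (use f g in \<open>auto simp: mlin_outside mlin_add mlin_scale carrierI scale_right_distrib algebra_simps
    intro: carrier_add mlin_carrier\<close>)

lemma mlin_fscale:
  assumes f: "f \<in> mlin" shows "fscale scale r f \<in> mlin"
proof (rule mlinI)
  show "splits (fscale scale r f)"
    using f by (auto simp: splits_def mlin_splits[THEN splitsD] fscale_def scale_right_distrib)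
  show "fscale scale r f (xs @ u # v # ys) = sgn_pow (p * q) (fscale scale r f (xs @ v # u # ys))"
    if "u \<in> U p" "v \<in> U q" for xs u p v q ys
    using mlin_swap[OF f that, of xs ys] by (simp add: fscale_def sgn_pow_scale)
qed (use f in \<open>auto simp: mlin_outside mlin_add mlin_scale carrierI fscale_def scale_right_distrib mult.commute
    intro: carrier_scale mlin_carrier\<close>)

lemma fscale_minus_1: "fscale scale (- 1) f = - f"
  by (simp add: fscale_def fun_eq_iff)

lemma mlin_minus: "f \<in> mlin \<Longrightarrow> - f \<in> mlin"
  using mlin_fscale[of f "- 1"] by (simp add: fscale_minus_1)

lemma mpar_0 [simp]: "0 \<in> mpar q"
  by (simp add: mpar_def has_map_parity_def)

lemma mpar_plus: "f \<in> mpar q \<Longrightarrow> g \<in> mpar q \<Longrightarrow> f + g \<in> mpar q"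
  by (auto simp: mpar_def has_map_parity_def intro: mlin_plus add_mem)

lemma mpar_fscale: "f \<in> mpar q \<Longrightarrow> fscale scale r f \<in> mpar q"
  unfolding mpar_def has_map_parity_def using mlin_fscale scale_mem by (fastforce simp: fscale_def)

lemma mpar_minus: "f \<in> mpar q \<Longrightarrow> - f \<in> mpar q"
  using mpar_fscale[of f q "- 1"] by (simp add: fscale_minus_1)

lemma mpar_diff: "f \<in> mpar q \<Longrightarrow> g \<in> mpar q \<Longrightarrow> f - g \<in> mpar q"
  using mpar_plus[of f q "- g"] mpar_minus by simp

lemma mpar_sgn_pow: "f \<in> mpar q \<Longrightarrow> sgn_pow p f \<in> mpar q"
  by (cases p) (auto intro: mpar_minus)

lemma mpar_inter: "f \<in> mpar p \<Longrightarrow> f \<in> mpar (p + 1) \<Longrightarrow> f = 0"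
  by (rule mlin_ext) (auto intro: mpar_mlin parity_inter[OF mpar_mem mpar_mem[where q = "p + 1", unfolded add.assoc add.commute[of 1], folded add.assoc]])

lemma contract_mlin:
  assumes f: "f \<in> mlin" and v: "v \<in> carrier_of U" shows "contract v f \<in> mlin"
proof (rule mlinI)
  show "splits (contract v f)"
    using splitsD[OF mlin_splits[OF f], of "v # _"] v by (simp add: splits_def contract_def)
  show "contract v f (xs @ x # y # ys) = sgn_pow (p * q) (contract v f (xs @ y # x # ys))"
    if "x \<in> U p" "y \<in> U q" for xs x p y q ys
    using mlin_swap[OF f that, of "v # xs" ys] by (simp add: contract_def)
qed (use f v in \<open>auto simp: contract_def mlin_outside carrierI mlin_carrier
    mlin_add[where xs = "_ # _", simplified] mlin_scale[where xs = "_ # _", simplified]\<close>)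

lemma contract_mpar:
  assumes "f \<in> mpar q" "v \<in> U p" shows "contract v f \<in> mpar (q + p)"
  unfolding mpar_def has_map_parity_def
  using assms contract_mlin[OF mpar_mlin carrierI] mpar_mem[OF assms(1), of "v # _" "p # _"]
  by (auto simp: contract_def algebra_simps)

lemma contract_add: "f \<in> mlin \<Longrightarrow> u \<in> carrier_of U \<Longrightarrow> v \<in> carrier_of U \<Longrightarrow>
  contract (u + v) f = contract u f + contract v f"
  using mlin_add[of f u v "[]"] by (simp add: contract_def fun_eq_iff)

lemma contract_scale: "f \<in> mlin \<Longrightarrow> u \<in> carrier_of U \<Longrightarrow>
  contract (scale r u) f = fscale scale r (contract u f)"
  using mlin_scale[of f u "[]"] by (simp add: contract_def fscale_def fun_eq_iff)

lemma contract_swap: "f \<in> mlin \<Longrightarrow> u \<in> U p \<Longrightarrow> v \<in> U q \<Longrightarrow>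
  contract u (contract v f) = sgn_pow (p * q) (contract v (contract u f))"
  using mlin_swap[of f v q u p "[]"] by (simp add: contract_def fun_eq_iff sgn_pow_fun mult.commute)

text \<open>In every axiom the lists on both sides have the same length, so at lengths other than
  \<open>n\<close> the axiom reads 0 = 0 and the version for all lengths imposes nothing
  new.\<close>

lemma hom_sym_iff: "f \<in> hom_sym scale U n \<longleftrightarrow> f \<in> mlin \<and> arity_in {n} f"
proof
  assume f: "f \<in> hom_sym scale U n"
  have car: "\<forall>vs. length vs = n \<and> set vs \<subseteq> carrier_of U \<longrightarrow> f vs \<in> carrier_of U"
    using f unfolding hom_sym_def mem_Collect_eq by (rule conjunct1)
  have "\<forall>vs. \<not> (length vs = n \<and> set vs \<subseteq> carrier_of U) \<longrightarrow> f vs = 0"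
    using f unfolding hom_sym_def mem_Collect_eq by (rule conjunct2[THEN conjunct1])
  then have out: "f vs = 0" if "length vs \<noteq> n \<or> \<not> set vs \<subseteq> carrier_of U" for vs
    using that by blast
  then have ar: "arity_in {n} f" by (auto simp: arity_in_def)
  have "f \<in> mlin" unfolding mlin_def
  proof (intro CollectI conjI allI impI)
    show "f vs \<in> carrier_of U" for vs
      using car out[of vs] by (cases "length vs = n \<and> set vs \<subseteq> carrier_of U") auto
    show "f (xs @ (u + v) # ys) = f (xs @ u # ys) + f (xs @ v # ys)"
      if "set xs \<union> {u, v} \<union> set ys \<subseteq> carrier_of U" for xs u v ys
    proof (cases "length xs + length ys + 1 = n")
      case True then show ?thesis using f that unfolding hom_sym_def by blast
    qed (simp add: out)
    show "f (xs @ scale r u # ys) = scale r (f (xs @ u # ys))"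
      if "set xs \<union> {u} \<union> set ys \<subseteq> carrier_of U" for xs u ys r
    proof (cases "length xs + length ys + 1 = n")
      case True then show ?thesis using f that unfolding hom_sym_def by blast
    qed (simp add: out)
    show "f (xs @ u # v # ys) = sgn_pow (p * q) (f (xs @ v # u # ys))"
      if "set xs \<union> set ys \<subseteq> carrier_of U \<and> u \<in> U p \<and> v \<in> U q" for xs u v ys p q
    proof (cases "length xs + length ys + 2 = n")
      case True then show ?thesis using f that unfolding hom_sym_def by blast
    qed (simp add: out)
  qed (use out in auto)
  with ar show "f \<in> mlin \<and> arity_in {n} f" by simp
next
  assume f: "f \<in> mlin \<and> arity_in {n} f"
  show "f \<in> hom_sym scale U n" unfolding hom_sym_def
  proof (intro CollectI conjI allI impI)
    show "f vs = 0" if "\<not> (length vs = n \<and> set vs \<subseteq> carrier_of U)" for vs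
      using f that mlin_outside[of f vs] by (auto simp: arity_in_def)
  qed (use f in \<open>auto intro: mlin_carrier mlin_add mlin_scale mlin_swap\<close>)
qed

end

section \<open>The universal Lie superalgebra\<close>

text \<open>The defining sum of \<open>box\<close> with a shuffle encoded by the set
  \<open>S\<close> of arguments that \<open>Y\<close> receives.\<close>

definition box_form :: "('v list \<Rightarrow> 'v::ab_group_add) \<Rightarrow> ('v list \<Rightarrow> 'v) \<Rightarrow> bit list \<Rightarrow> 'v list \<Rightarrow> 'v" where
  "box_form X Y ps vs = (\<Sum>S\<in>Pow {..<length vs}.
     sgn_pow (cross ps S) (X (Y (nths vs S) # nths vs (- S))))"

lemma multilin_ext_cong:
  assumes "\<And>ps ws. length ps = length vs \<Longrightarrow> length ws = length vs \<Longrightarrow> F ps ws = G ps ws"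
  shows "multilin_ext V F vs = multilin_ext V G vs"
  using assms by (auto simp: multilin_ext_def intro!: sum.cong)

lemma multilin_ext_add:
  "multilin_ext V (\<lambda>ps ws. F ps ws + G ps ws) = multilin_ext V F + multilin_ext V G"
  by (simp add: multilin_ext_def fun_eq_iff sum.distrib)

lemma multilin_ext_outside: "\<not> set vs \<subseteq> carrier_of V \<Longrightarrow> multilin_ext V F vs = 0"
  by (simp add: multilin_ext_def)

lemma box_eq: "box V X Y = multilin_ext V (box_form X Y)"
proof
  fix vs :: "'a list"
  show "box V X Y vs = multilin_ext V (box_form X Y) vs"
    unfolding box_def
  proof (rule multilin_ext_cong)
    fix ps :: "bit list" and ws :: "'a list"
    assume len: "length ps = length vs" "length ws = length vs"
    have "(\<Sum>m\<le>length ws. \<Sum>\<sigma>\<in>shuffle_perms m (length ws). sgn_pow (interchanges ps \<sigma>)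
        (X (Y (map (\<lambda>i. ws ! \<sigma> i) [0..<m]) # map (\<lambda>i. ws ! \<sigma> i) [m..<length ws])))
      = (\<Sum>S\<in>Pow {..<length ws}. sgn_pow (cross ps S)
          (X (Y (map ((!) ws) (select (length ws) S)) # map ((!) ws) (select (length ws) (- S)))))"
      using sum_shuffles[of ps "length ws" "\<lambda>e I J. sgn_pow e (X (Y (map ((!) ws) I) # map ((!) ws) J))"] len
      by (simp add: comp_def)
    then show "(let n = length ws in \<Sum>m\<le>n. \<Sum>\<sigma>\<in>shuffle_perms m n. sgn_pow (interchanges ps \<sigma>)
        (X (Y (map (\<lambda>i. ws ! \<sigma> i) [0..<m]) # map (\<lambda>i. ws ! \<sigma> i) [m..<n]))) = box_form X Y ps ws"
      by (simp add: Let_def box_form_def nths_eq_map_select)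
  qed
qed

lemma nths_Cons_insert [simp]:
  "nths (v # vs) (insert 0 (Suc ` T)) = v # nths vs T"
  "nths (v # vs) (- insert 0 (Suc ` T)) = nths vs (- T)"
  "nths (v # vs) (Suc ` T) = nths vs T"
  "nths (v # vs) (- (Suc ` T)) = v # nths vs (- T)"
proof -
  have "{j. Suc j \<in> insert 0 (Suc ` T)} = T" "{j. Suc j \<in> - insert 0 (Suc ` T)} = - T"
    "{j. Suc j \<in> Suc ` T} = T" "{j. Suc j \<in> - (Suc ` T)} = - T" by auto
  then show "nths (v # vs) (insert 0 (Suc ` T)) = v # nths vs T"
    "nths (v # vs) (- insert 0 (Suc ` T)) = nths vs (- T)"
    "nths (v # vs) (Suc ` T) = nths vs T"
    "nths (v # vs) (- (Suc ` T)) = v # nths vs (- T)"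
    by (simp_all add: nths_Cons)
qed

lemma mem_nths_or_compl: "x \<in> set vs \<Longrightarrow> x \<in> set (nths vs S) \<or> x \<in> set (nths vs (- S))"
  by (auto simp: set_nths in_set_conv_nth)

lemma length_nths_compl: "length (nths vs S) + length (nths vs (- S)) = length vs"
  using sum_length_filter_compl[of "\<lambda>i. i \<in> S" "[0..<length vs]"]
  by (simp add: nths_eq_map_select)

lemma list_all2_nths: "list_all2 P vs ps \<Longrightarrow> list_all2 P (nths vs S) (nths ps S)"
  by (induction vs ps arbitrary: S rule: list_all2_induct) (auto simp: nths_Cons)

section \<open>The box product under contraction\<close>

context superspace
begin

text \<open>In the term for \<open>ps\<close>, the slot of \<open>v\<close> sees only the component
  of the parity prescribed there. Replacing \<open>v\<close> by that component leaves the term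
  unchanged; replacing it by the other one puts a 0 into the slot and kills the term.\<close>

lemma multilin_ext_splits:
  assumes F0: "\<And>qs ws. length qs = length ws \<Longrightarrow> 0 \<in> set ws \<Longrightarrow> F qs ws = 0"
  shows "splits (multilin_ext U F)"
  unfolding splits_def
proof (intro allI impI)
  fix xs v ys assume "set xs \<union> {v} \<union> set ys \<subseteq> carrier_of U"
  then have c: "set (xs @ v # ys) \<subseteq> carrier_of U" "set (xs @ hcomp U p v # ys) \<subseteq> carrier_of U"
    and v: "v \<in> carrier_of U" for p by (auto intro: hcomp_carrier)
  let ?G = "\<lambda>u ps. F ps (map2 (hcomp U) ps (xs @ u # ys))"
  have "?G v ps = ?G (even_part U v) ps + ?G (odd_part U v) ps"
    if len: "length ps = Suc (length xs + length ys)" for ps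
  proof -
    define p where "p = ps ! length xs"
    define a where "a = take (length xs) ps"
    define b where "b = drop (Suc (length xs)) ps"
    have ps: "ps = a @ p # b" "length a = length xs" "length b = length ys"
      using len by (simp_all add: a_def b_def p_def id_take_nth_drop)
    have hh: "hcomp U r (hcomp U s v) = (if r = s then hcomp U s v else 0)" for r s
      using v by (simp add: hcomp_homogeneous[OF hcomp_mem])
    have m: "map2 (hcomp U) ps (xs @ u # ys) = map2 (hcomp U) a xs @ hcomp U p u # map2 (hcomp U) b ys" for u
      using ps by simp
    have "?G v ps = ?G (hcomp U p v) ps" by (simp add: m hh)
    moreover have "?G (hcomp U (p + 1) v) ps = 0"
      by (rule F0) (use len in \<open>auto simp: m hh ps\<close>)
    ultimately show ?thesis by (cases p) auto
  qed
  then show "multilin_ext U F (xs @ v # ys)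
      = multilin_ext U F (xs @ even_part U v # ys) + multilin_ext U F (xs @ odd_part U v # ys)"
    unfolding multilin_ext_def using c by (simp add: sum.distrib[symmetric])
qed

lemma box_form_zero_arg:
  assumes "X \<in> mlin" "Y \<in> mlin" "0 \<in> set vs" shows "box_form X Y ps vs = 0"
  unfolding box_form_def
proof (rule sum.neutral, rule ballI)
  fix S
  have "0 \<in> set (Y (nths vs S) # nths vs (- S))"
    using mem_nths_or_compl[OF assms(3), of S] mlin_zero_arg[OF assms(2)] by fastforce
  then show "sgn_pow (cross ps S) (X (Y (nths vs S) # nths vs (- S))) = 0"
    using mlin_zero_arg[OF assms(1)] by simp
qed

lemma box_hom:
  assumes "X \<in> mlin" "Y \<in> mlin" "hom_list vs ps" shows "box U X Y vs = box_form X Y ps vs"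
  unfolding box_eq using assms box_form_zero_arg by (intro multilin_ext_homogeneous) auto

lemma box_splits: "X \<in> mlin \<Longrightarrow> Y \<in> mlin \<Longrightarrow> splits (box U X Y)"
  unfolding box_eq using box_form_zero_arg by (intro multilin_ext_splits)

lemma box_outside: "\<not> set vs \<subseteq> carrier_of U \<Longrightarrow> box U X Y vs = 0"
  by (simp add: box_eq multilin_ext_outside)

lemma box_Nil: "X \<in> mlin \<Longrightarrow> Y \<in> mlin \<Longrightarrow> box U X Y [] = X [Y []]"
  using box_hom[of X Y "[]" "[]"] by (simp add: box_form_def cross_def)

text \<open>If the leading argument does not go to \<open>Y\<close>, then \<open>X\<close> receives
  \<open>v\<close> directly after the value of \<open>Y\<close>. Exchanging the two costs
  \<open>p\<close> times the parity of that value; the part of it due to the arguments of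
  \<open>Y\<close> cancels the extra term of \<open>cross_Suc\<close>, and \<open>p * q\<close> is
  left.\<close>

lemma box_Cons:
  assumes X: "X \<in> mlin" and Y: "Y \<in> mpar q" and v: "v \<in> U p" and vs: "hom_list vs ps"
  shows "box U X Y (v # vs) = box U X (contract v Y) vs + sgn_pow (p * q) (box U (contract v X) Y vs)"
proof -
  note Y' = mpar_mlin[OF Y] and v' = carrierI[OF v]
  have "box U X Y (v # vs) = box_form X Y (p # ps) (v # vs)"
    using X Y' v vs by (intro box_hom) auto
  also have "\<dots> = (\<Sum>T\<in>Pow {..<length vs}. sgn_pow (cross ps T) (X (Y (v # nths vs T) # nths vs (- T))))
    + (\<Sum>T\<in>Pow {..<length vs}. sgn_pow (cross ps T + p * sum_list (nths ps T))
        (X (Y (nths vs T) # v # nths vs (- T))))"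
    unfolding box_form_def by (simp add: sum_Pow_lessThan_Suc cross_insert_0 cross_Suc)
  also have "(\<Sum>T\<in>Pow {..<length vs}. sgn_pow (cross ps T) (X (Y (v # nths vs T) # nths vs (- T))))
    = box_form X (contract v Y) ps vs"
    by (simp add: box_form_def contract_def)
  also have "(\<Sum>T\<in>Pow {..<length vs}. sgn_pow (cross ps T + p * sum_list (nths ps T))
        (X (Y (nths vs T) # v # nths vs (- T)))) = sgn_pow (p * q) (box_form (contract v X) Y ps vs)"
    unfolding box_form_def sgn_pow_sum
  proof (rule sum.cong[OF refl])
    fix T
    have "Y (nths vs T) \<in> U (q + sum_list (nths ps T))"
      by (rule mpar_mem[OF Y list_all2_nths[OF vs]])
    from mlin_swap[OF X this v, of "[]"]
    show "sgn_pow (cross ps T + p * sum_list (nths ps T)) (X (Y (nths vs T) # v # nths vs (- T)))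
      = sgn_pow (p * q) (sgn_pow (cross ps T) (contract v X (Y (nths vs T) # nths vs (- T))))"
      by (simp add: contract_def sgn_pow_sgn_pow algebra_simps)
  qed
  finally show ?thesis
    using X Y' v' vs by (simp add: box_hom[where ps = ps] contract_mlin)
qed

lemma box_add_left: "box U (X + X') Y = box U X Y + box U X' Y"
  unfolding box_eq multilin_ext_add[symmetric]
  by (rule arg_cong[where f = "multilin_ext U"])
    (simp add: fun_eq_iff box_form_def sgn_pow_add sum.distrib)

lemma box_add_right:
  assumes "X \<in> mlin" "Y \<in> mlin" "Y' \<in> mlin"
  shows "box U X (Y + Y') = box U X Y + box U X Y'"
  unfolding box_eq multilin_ext_add[symmetric]
  by (rule arg_cong[where f = "multilin_ext U"])
    (simp add: fun_eq_iff box_form_def sgn_pow_add sum.distrib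
      mlin_add[OF assms(1) mlin_carrier[OF assms(2)] mlin_carrier[OF assms(3)], of "[]", simplified])

lemma multilin_ext_scale:
  "multilin_ext U (\<lambda>ps ws. scale r (F ps ws)) = fscale scale r (multilin_ext U F)"
  by (simp add: multilin_ext_def fun_eq_iff fscale_def scale_sum_right)

lemma box_scale_left: "box U (fscale scale r X) Y = fscale scale r (box U X Y)"
  unfolding box_eq multilin_ext_scale[symmetric]
  by (rule arg_cong[where f = "multilin_ext U"])
    (simp add: fun_eq_iff box_form_def sgn_pow_scale scale_sum_right fscale_def)

lemma box_scale_right:
  assumes "X \<in> mlin" "Y \<in> mlin"
  shows "box U X (fscale scale r Y) = fscale scale r (box U X Y)"
  unfolding box_eq multilin_ext_scale[symmetric]
  by (rule arg_cong[where f = "multilin_ext U"])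
    (simp add: fun_eq_iff box_form_def sgn_pow_scale scale_sum_right fscale_def
      mlin_scale[OF assms(1) mlin_carrier[OF assms(2)], of "[]", simplified])

text \<open>The value of \<open>Y\<close> fills one slot of \<open>X\<close>, whence the shift by
  one. A nonzero term needs a nonzero value of \<open>Y\<close>, as \<open>X\<close> vanishes on
  lists containing 0.\<close>

lemma box_arity:
  assumes X: "X \<in> mlin" "arity_in H X" and Y: "arity_in K Y"
  shows "arity_in {n. \<exists>h\<in>H. \<exists>k\<in>K. h + k = n + 1} (box U X Y)"
  unfolding arity_in_def
proof (intro allI impI)
  fix vs assume "box U X Y vs \<noteq> 0"
  then obtain ps where "length ps = length vs" "box_form X Y ps (map2 (hcomp U) ps vs) \<noteq> 0"
    unfolding box_eq multilin_ext_def by (auto split: if_splits elim!: sum.not_neutral_contains_not_neutral)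
  moreover define ws where "ws = map2 (hcomp U) ps vs"
  ultimately have len: "length ws = length vs" and "box_form X Y ps ws \<noteq> 0" by simp_all
  then obtain S where "sgn_pow (cross ps S) (X (Y (nths ws S) # nths ws (- S))) \<noteq> 0"
    unfolding box_form_def by (elim sum.not_neutral_contains_not_neutral)
  then have ne: "X (Y (nths ws S) # nths ws (- S)) \<noteq> 0" by auto
  have "Y (nths ws S) \<noteq> 0"
    using ne mlin_zero_arg[OF X(1), of "Y (nths ws S) # nths ws (- S)"] by auto
  then have "length (nths ws S) \<in> K" "Suc (length (nths ws (- S))) \<in> H"
    using ne X(2) Y by (auto simp: arity_in_def dest: spec[of _ "Y (nths ws S) # nths ws (- S)"])
  moreover have "Suc (length (nths ws (- S))) + length (nths ws S) = length vs + 1"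
    using length_nths_compl[of ws S] len by simp
  ultimately show "length vs \<in> {n. \<exists>h\<in>H. \<exists>k\<in>K. h + k = n + 1}" by blast
qed

end

text \<open>
  A family of bilinear operations along which contraction with a vector acts as a superderivation;
  the index \<open>q\<close> is the parity of the second argument, and \<open>c\<close> is the parity of the operation.
\<close>

locale contraction_op = superspace scale U
  for scale :: "'f::field_char_0 \<Rightarrow> 'v::ab_group_add \<Rightarrow> 'v" and U +
  fixes c :: bit and B :: "bit \<Rightarrow> ('v list \<Rightarrow> 'v) \<Rightarrow> ('v list \<Rightarrow> 'v) \<Rightarrow> 'v list \<Rightarrow> 'v"
  assumes outside: "\<not> set vs \<subseteq> carrier_of U \<Longrightarrow> B q X Y vs = 0"
    and split: "X \<in> mlin \<Longrightarrow> Y \<in> mlin \<Longrightarrow> splits (B q X Y)"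
    and Nil_mem: "X \<in> mpar r \<Longrightarrow> Y \<in> mpar q \<Longrightarrow> B q X Y [] \<in> U (r + q + c)"
    and add_left: "X \<in> mlin \<Longrightarrow> X' \<in> mlin \<Longrightarrow> Y \<in> mlin \<Longrightarrow> B q (X + X') Y = B q X Y + B q X' Y"
    and add_right: "X \<in> mlin \<Longrightarrow> Y \<in> mlin \<Longrightarrow> Y' \<in> mlin \<Longrightarrow> B q X (Y + Y') = B q X Y + B q X Y'"
    and scale_left: "X \<in> mlin \<Longrightarrow> Y \<in> mlin \<Longrightarrow> B q (fscale scale t X) Y = fscale scale t (B q X Y)"
    and scale_right: "X \<in> mlin \<Longrightarrow> Y \<in> mlin \<Longrightarrow> B q X (fscale scale t Y) = fscale scale t (B q X Y)"
    and op_Cons: "X \<in> mpar r \<Longrightarrow> Y \<in> mpar q \<Longrightarrow> v \<in> U p \<Longrightarrow> hom_list vs ps \<Longrightarrow>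
      B q X Y (v # vs) = B (q + p) X (contract v Y) vs + sgn_pow (p * (q + c)) (B q (contract v X) Y vs)"
begin

lemma sgn_left: "X \<in> mlin \<Longrightarrow> Y \<in> mlin \<Longrightarrow> B q (sgn_pow e X) Y = sgn_pow e (B q X Y)"
  using scale_left[of X Y q "- 1"] by (cases e) (simp_all add: fscale_minus_1)

lemma sgn_right: "X \<in> mlin \<Longrightarrow> Y \<in> mlin \<Longrightarrow> B q X (sgn_pow e Y) = sgn_pow e (B q X Y)"
  using scale_right[of X Y q "- 1"] by (cases e) (simp_all add: fscale_minus_1)

lemma hom_mem:
  "X \<in> mpar r \<Longrightarrow> Y \<in> mpar q \<Longrightarrow> hom_list vs ps \<Longrightarrow> B q X Y vs \<in> U (r + q + c + sum_list ps)"
proof (induction vs arbitrary: X Y r q ps)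
  case Nil then show ?case using Nil_mem by simp
next
  case (Cons v vs)
  obtain p ps' where ps: "ps = p # ps'" "v \<in> U p" "hom_list vs ps'"
    using Cons.prems(3) by (auto simp: list_all2_Cons1)
  have "B (q + p) X (contract v Y) vs \<in> U (r + (q + p) + c + sum_list ps')"
    by (rule Cons.IH[OF Cons.prems(1) contract_mpar[OF Cons.prems(2) ps(2)] ps(3)])
  moreover have "B q (contract v X) Y vs \<in> U (r + p + q + c + sum_list ps')"
    by (rule Cons.IH[OF contract_mpar[OF Cons.prems(1) ps(2)] Cons.prems(2) ps(3)])
  ultimately show ?case
    using op_Cons[OF Cons.prems(1,2) ps(2,3)] ps(1)
    by (simp add: add_mem sgn_pow_mem ac_simps)
qed

text \<open>\<open>op_Cons\<close> peels off the arguments before the slot. Once the slot is in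
  front, the claim is additivity of \<open>contract\<close> in its vector together with biadditivity
  of \<open>B\<close>.\<close>

lemma hom_add:
  assumes "u \<in> U p" "v \<in> U p" "hom_list ys qs"
  shows "X \<in> mpar r \<Longrightarrow> Y \<in> mpar q \<Longrightarrow> hom_list xs ps \<Longrightarrow>
    B q X Y (xs @ (u + v) # ys) = B q X Y (xs @ u # ys) + B q X Y (xs @ v # ys)"
proof (induction xs arbitrary: X Y r q ps)
  case Nil
  note c = assms(1,2)[THEN carrierI] and m = Nil(1,2)[THEN mpar_mlin]
  show ?case
    using assms c m Nil contract_mlin[OF m(1)] contract_mlin[OF m(2)]
    by (simp add: op_Cons[OF Nil(1,2) assms(1) assms(3)] op_Cons[OF Nil(1,2) assms(2) assms(3)]
        op_Cons[OF Nil(1,2) add_mem[OF assms(1,2)] assms(3)] contract_add add_left add_right sgn_pow_add)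
next
  case (Cons x xs)
  obtain p' ps' where ps: "x \<in> U p'" "hom_list xs ps'"
    using Cons.prems(3) by (auto simp: list_all2_Cons1)
  have h: "hom_list (xs @ w # ys) (ps' @ p # qs)" if "w \<in> U p" for w
    using ps that assms by (simp add: list_all2_appendI)
  show ?case
    using assms Cons.IH[OF Cons.prems(1) contract_mpar[OF Cons.prems(2) ps(1)] ps(2)]
      Cons.IH[OF contract_mpar[OF Cons.prems(1) ps(1)] Cons.prems(2) ps(2)]
    by (simp add: op_Cons[OF Cons.prems(1,2) ps(1) h] add_mem sgn_pow_add)
qed

lemma hom_scale:
  assumes "u \<in> U p" "hom_list ys qs"
  shows "X \<in> mpar r \<Longrightarrow> Y \<in> mpar q \<Longrightarrow> hom_list xs ps \<Longrightarrow>
    B q X Y (xs @ scale t u # ys) = scale t (B q X Y (xs @ u # ys))"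
proof (induction xs arbitrary: X Y r q ps)
  case Nil
  note c = assms(1)[THEN carrierI] and m = Nil(1,2)[THEN mpar_mlin]
  show ?case
    using assms c m Nil contract_mlin[OF m(1)] contract_mlin[OF m(2)]
    by (simp add: op_Cons[OF Nil(1,2) assms(1) assms(2)] op_Cons[OF Nil(1,2) scale_mem[OF assms(1)] assms(2)]
        contract_scale scale_left scale_right)
      (simp add: fscale_def sgn_pow_scale scale_right_distrib)
next
  case (Cons x xs)
  obtain p' ps' where ps: "x \<in> U p'" "hom_list xs ps'"
    using Cons.prems(3) by (auto simp: list_all2_Cons1)
  have h: "hom_list (xs @ w # ys) (ps' @ p # qs)" if "w \<in> U p" for w
    using ps that assms by (simp add: list_all2_appendI)
  show ?case
    using assms Cons.IH[OF Cons.prems(1) contract_mpar[OF Cons.prems(2) ps(1)] ps(2)]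
      Cons.IH[OF contract_mpar[OF Cons.prems(1) ps(1)] Cons.prems(2) ps(2)]
    by (simp add: op_Cons[OF Cons.prems(1,2) ps(1) h] scale_mem sgn_pow_scale scale_right_distrib)
qed

text \<open>Contracting twice gives four terms. When \<open>u\<close> and \<open>v\<close> are
  exchanged, the two terms with one contraction on each factor trade places, while the terms with
  both contractions on one factor change by supersymmetry of that factor.\<close>

lemma hom_swap:
  assumes u: "u \<in> U p" and v: "v \<in> U s" and ys: "hom_list ys qs"
  shows "X \<in> mpar r \<Longrightarrow> Y \<in> mpar q \<Longrightarrow> hom_list xs ps \<Longrightarrow>
    B q X Y (xs @ u # v # ys) = sgn_pow (p * s) (B q X Y (xs @ v # u # ys))"
proof (induction xs arbitrary: X Y r q ps)
  case Nil
  note m = Nil(1,2)[THEN mpar_mlin]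
  have two: "B q X Y (u # v # ys) =
      B (q + p + s) X (contract v (contract u Y)) ys
      + sgn_pow (s * (q + p + c)) (B (q + p) (contract v X) (contract u Y) ys)
      + sgn_pow (p * (q + c)) (B (q + s) (contract u X) (contract v Y) ys
        + sgn_pow (s * (q + c)) (B q (contract v (contract u X)) Y ys))"
    if "u \<in> U p" "v \<in> U s" for u v p s
    using that ys Nil contract_mpar
    by (subst op_Cons[OF Nil(1,2) that(1), of _ "s # qs"])
      (simp_all add: op_Cons[OF Nil(1) contract_mpar[OF Nil(2) that(1)] that(2) ys]
        op_Cons[OF contract_mpar[OF Nil(1) that(1)] Nil(2) that(2) ys])
  have cm: "contract u X \<in> mlin" "contract v X \<in> mlin" "contract u Y \<in> mlin" "contract v Y \<in> mlin"
    using m u v contract_mlin carrierI by blast+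
  have "contract v (contract u X) \<in> mlin" "contract v (contract u Y) \<in> mlin"
    using cm v contract_mlin carrierI by blast+
  then have "B q' (contract u (contract v X)) Y ys = sgn_pow (p * s) (B q' (contract v (contract u X)) Y ys)"
    "B q' X (contract u (contract v Y)) ys = sgn_pow (p * s) (B q' X (contract v (contract u Y)) ys)" for q'
    using m by (simp_all add: contract_swap[OF _ u v] sgn_left sgn_right sgn_pow_fun)
  then show ?case
    by (simp add: two[OF u v] two[OF v u])
      (cases p; cases s; cases q; cases c; simp)
next
  case (Cons x xs)
  obtain p' ps' where ps: "x \<in> U p'" "hom_list xs ps'"
    using Cons.prems(3) by (auto simp: list_all2_Cons1)
  have h: "hom_list (xs @ u # v # ys) (ps' @ p # s # qs)" "hom_list (xs @ v # u # ys) (ps' @ s # p # qs)"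
    using ps u v ys by (simp_all add: list_all2_appendI)
  show ?case
    using Cons.IH[OF Cons.prems(1) contract_mpar[OF Cons.prems(2) ps(1)] ps(2)]
      Cons.IH[OF contract_mpar[OF Cons.prems(1) ps(1)] Cons.prems(2) ps(2)]
    by (simp add: op_Cons[OF Cons.prems(1,2) ps(1) h(1)] op_Cons[OF Cons.prems(1,2) ps(1) h(2)]
        sgn_pow_add sgn_pow_sgn_pow ac_simps)
qed

lemma op_mpar:
  assumes X: "X \<in> mpar r" and Y: "Y \<in> mpar q" shows "B q X Y \<in> mpar (r + q + c)"
proof -
  have "B q X Y \<in> mlin"
  proof (rule mlinI)
    show "splits (B q X Y)" by (rule split[OF mpar_mlin[OF X] mpar_mlin[OF Y]])
    show "B q X Y vs \<in> carrier_of U" if "hom_list vs ps" for vs ps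
      using hom_mem[OF X Y that] by (rule carrierI)
    show "B q X Y (xs @ (u + v) # ys) = B q X Y (xs @ u # ys) + B q X Y (xs @ v # ys)"
      if "hom_list xs ps" "u \<in> U p" "v \<in> U p" "hom_list ys qs" for xs ps u v p ys qs
      by (rule hom_add[OF that(2-4) X Y that(1)])
    show "B q X Y (xs @ scale t u # ys) = scale t (B q X Y (xs @ u # ys))"
      if "hom_list xs ps" "u \<in> U p" "hom_list ys qs" for xs ps u p ys qs t
      by (rule hom_scale[OF that(2,3) X Y that(1)])
    show "B q X Y (xs @ u # v # ys) = sgn_pow (p * s) (B q X Y (xs @ v # u # ys))"
      if "hom_list xs ps" "u \<in> U p" "v \<in> U s" "hom_list ys qs" for xs ps u p v s ys qs
      by (rule hom_swap[OF that(2-4) X Y that(1)])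
  qed (rule outside)
  then show ?thesis
    using hom_mem[OF X Y] by (simp add: mpar_def has_map_parity_def)
qed

text \<open>With both sides now known to be in \<open>mlin\<close>, the rule \<open>op_Cons\<close>
  for homogeneous lists becomes an equality of maps, which can be substituted inside a further
  operation.\<close>

lemma contract_op:
  assumes X: "X \<in> mpar r" and Y: "Y \<in> mpar q" and v: "v \<in> U p"
  shows "contract v (B q X Y)
    = B (q + p) X (contract v Y) + sgn_pow (p * (q + c)) (B q (contract v X) Y)"
proof (rule mlin_ext)
  show "contract v (B q X Y) \<in> mlin"
    using op_mpar[OF X Y] v by (intro contract_mlin) (auto intro: mpar_mlin carrierI)
  show "B (q + p) X (contract v Y) + sgn_pow (p * (q + c)) (B q (contract v X) Y) \<in> mlin"
    using op_mpar[OF X contract_mpar[OF Y v]] op_mpar[OF contract_mpar[OF X v] Y]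
      mpar_sgn_pow by (intro mlin_plus) (auto intro: mpar_mlin)
qed (simp add: op_Cons[OF X Y v] contract_def[of v "B q X Y"] sgn_pow_fun)

end

section \<open>The Lie bracket and the Jacobi identity\<close>

context superspace
begin

text \<open>The box product adds parities, hence operation parity 0, and it is the same for every
  parity index.\<close>

sublocale box: contraction_op scale U 0 "\<lambda>q. box U"
proof unfold_locales
  show "box U X Y [] \<in> U (r + q + 0)" if "X \<in> mpar r" "Y \<in> mpar q" for X Y r q
    using mpar_Cons[OF that(1) mpar_Nil[OF that(2)]] that by (simp add: box_Nil mpar_mlin)
qed (simp_all add: box_outside box_splits box_add_left box_add_right box_scale_left box_scale_right
    box_Cons mpar_mlin)

text \<open>The bracket formula with the parities of its arguments supplied from outside, so that
  its recursion under contraction can update them; \<open>W_bracket\<close> instead extracts them by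
  decomposing the arguments.\<close>

definition br :: "bit \<Rightarrow> bit \<Rightarrow> ('v list \<Rightarrow> 'v) \<Rightarrow> ('v list \<Rightarrow> 'v) \<Rightarrow> 'v list \<Rightarrow> 'v" where
  "br r q X Y = box U X Y - sgn_pow (r * q) (box U Y X)"

lemma br_mpar: "X \<in> mpar r \<Longrightarrow> Y \<in> mpar q \<Longrightarrow> br r q X Y \<in> mpar (r + q)"
  unfolding br_def using box.op_mpar[of X r Y q] box.op_mpar[of Y q X r]
  by (intro mpar_diff mpar_sgn_pow) (simp_all add: add.commute)

text \<open>Contraction with \<open>v\<close> is the bracket with the constant map \<open>v\<close>
  (see \<open>br_arity_0\<close>), so this is the Jacobi identity with one entry of degree
  -1.\<close>

lemma contract_br:
  assumes X: "X \<in> mpar r" and Y: "Y \<in> mpar q" and v: "v \<in> U p"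
  shows "contract v (br r q X Y)
    = br r (q + p) X (contract v Y) + sgn_pow (p * q) (br (r + p) q (contract v X) Y)"
  unfolding br_def
  by (simp add: sgn_pow_contract box.contract_op[OF X Y v] box.contract_op[OF Y X v])
    (cases p; cases q; cases r; simp)

lemma br_Nil: "X \<in> mlin \<Longrightarrow> Y \<in> mlin \<Longrightarrow> br r q X Y [] = X [Y []] - sgn_pow (r * q) (Y [X []])"
  by (simp add: br_def box_Nil sgn_pow_fun)

text \<open>At the empty list a nested bracket evaluates its inner bracket on one argument, so the
  base cases require this value.\<close>

lemma br_single:
  assumes X: "X \<in> mpar r" and Y: "Y \<in> mpar q" and v: "v \<in> U p"
  shows "br r q X Y [v] = X [Y [v]] - sgn_pow (r * (q + p)) (Y [v, X []])
    + sgn_pow (p * q) (X [v, Y []] - sgn_pow ((r + p) * q) (Y [X [v]]))"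
proof -
  have "br r q X Y [v] = contract v (br r q X Y) []" by (simp add: contract_def)
  also have "\<dots> = br r (q + p) X (contract v Y) [] + sgn_pow (p * q) (br (r + p) q (contract v X) Y [])"
    by (simp add: contract_br[OF X Y v] sgn_pow_fun)
  finally show ?thesis
    using X Y v by (simp add: br_Nil mpar_mlin contract_mlin carrierI) (simp add: contract_def)
qed

lemma br_skew: "br r q X Y = - sgn_pow (r * q) (br q r Y X)"
  by (cases r; cases q; simp add: br_def)

lemma br_add_left:
  "X \<in> mlin \<Longrightarrow> X' \<in> mlin \<Longrightarrow> Y \<in> mlin \<Longrightarrow> br r q (X + X') Y = br r q X Y + br r q X' Y"
  by (simp add: br_def box_add_left box_add_right sgn_pow_add)

lemma br_add_right:
  "X \<in> mlin \<Longrightarrow> Y \<in> mlin \<Longrightarrow> Y' \<in> mlin \<Longrightarrow> br r q X (Y + Y') = br r q X Y + br r q X Y'"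
  by (simp add: br_def box_add_left box_add_right sgn_pow_add)

lemma br_sgn_left: "X \<in> mlin \<Longrightarrow> Y \<in> mlin \<Longrightarrow> br r q (sgn_pow e X) Y = sgn_pow e (br r q X Y)"
  by (simp add: br_def box.sgn_left box.sgn_right sgn_pow_diff sgn_pow_sgn_pow add.commute)

lemma br_sgn_right: "X \<in> mlin \<Longrightarrow> Y \<in> mlin \<Longrightarrow> br r q X (sgn_pow e Y) = sgn_pow e (br r q X Y)"
  by (simp add: br_def box.sgn_left box.sgn_right sgn_pow_diff sgn_pow_sgn_pow add.commute)

lemma mlin_sgn_arg:
  "f \<in> mlin \<Longrightarrow> v \<in> carrier_of U \<Longrightarrow> f (xs @ sgn_pow p v # ys) = sgn_pow p (f (xs @ v # ys))"
  using mlin_scale[of f v xs "- 1" ys] by (cases p) simp_all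

lemma mlin_diff_arg:
  "f \<in> mlin \<Longrightarrow> u \<in> carrier_of U \<Longrightarrow> v \<in> carrier_of U \<Longrightarrow> f (xs @ (u - v) # ys) = f (xs @ u # ys) - f (xs @ v # ys)"
  using mlin_add[of f u "- v" xs ys] mlin_sgn_arg[of f v xs 1 ys] by (simp add: carrier_minus)

text \<open>Contraction turns each nested bracket into three, with \<open>v\<close> absorbed by one
  of the three maps. Collected by the map that absorbs it, the identity splits into three instances
  of the induction hypothesis.\<close>

lemma br_jacobi_hom:
  "X \<in> mpar a \<Longrightarrow> Y \<in> mpar b \<Longrightarrow> Z \<in> mpar c \<Longrightarrow> hom_list vs ps \<Longrightarrow>
    br a (b + c) X (br b c Y Z) vs
    = br (a + b) c (br a b X Y) Z vs + sgn_pow (a * b) (br b (a + c) Y (br a c X Z) vs)"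
proof (induction vs arbitrary: X Y Z a b c ps)
  case Nil
  note X = Nil(1) and Y = Nil(2) and Z = Nil(3)
  note m = X[THEN mpar_mlin] Y[THEN mpar_mlin] Z[THEN mpar_mlin]
  note n = X[THEN mpar_Nil] Y[THEN mpar_Nil] Z[THEN mpar_Nil]
  have mb: "br r q P Q \<in> mlin" if "P \<in> mpar r" "Q \<in> mpar q" for P Q r q
    using br_mpar[OF that] by (rule mpar_mlin)
  have arg: "P [Q - sgn_pow e R] = P [Q] - sgn_pow e (P [R])"
    if "P \<in> mlin" "Q \<in> carrier_of U" "R \<in> carrier_of U" for P Q R e
    using mlin_diff_arg[OF that(1,2) carrier_sgn_pow[OF that(3)], of "[]" _ "[]"] mlin_sgn_arg[OF that(1,3), of "[]" e "[]"]
    by simp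
  \<comment> \<open>Apart from nested values, each map also occurs applied to the constant values of
    the other two, in both orders; supersymmetry brings these to one order so that they
    cancel.\<close>
  have swap: "P [v, w] = sgn_pow (p * q) (P [w, v])" if "P \<in> mlin" "v \<in> U p" "w \<in> U q" for P v w p q
    using mlin_swap[OF that, of "[]" "[]"] by simp
  show ?case
    using X Y Z m
    by (simp add: br_Nil mb br_single[OF _ _ n(1)] br_single[OF _ _ n(2)] br_single[OF _ _ n(3)] arg mlin_carrier
        swap[OF m(1) n(3) n(2)] swap[OF m(2) n(3) n(1)] swap[OF m(3) n(2) n(1)])
      (cases a; cases b; cases c; simp add: algebra_simps)
next
  case (Cons v vs)
  obtain p ps' where v: "v \<in> U p" and vs: "hom_list vs ps'"
    using Cons.prems(4) by (auto simp: list_all2_Cons1)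
  note X = Cons.prems(1) and Y = Cons.prems(2) and Z = Cons.prems(3)
  note Xv = contract_mpar[OF X v] and Yv = contract_mpar[OF Y v] and Zv = contract_mpar[OF Z v]
  have mb: "br r q P Q \<in> mlin" if "P \<in> mpar r" "Q \<in> mpar q" for P Q r q
    using br_mpar[OF that] by (rule mpar_mlin)
  have msg: "sgn_pow e P \<in> mlin" if "P \<in> mlin" for P e
    using that by (cases e) (auto intro: mlin_minus)
  \<comment> \<open>The two shapes of nested bracket are expanded separately: inner bracket on the
    right here, on the left in \<open>triple'\<close>.\<close>
  have triple: "br r (q + s) P (br q s Q R) (v # vs) =
      br r (q + (s + p)) P (br q (s + p) Q (contract v R)) vs
    + sgn_pow (p * s) (br r (q + p + s) P (br (q + p) s (contract v Q) R) vs)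
    + sgn_pow (p * (q + s)) (br (r + p) (q + s) (contract v P) (br q s Q R) vs)"
    if P: "P \<in> mpar r" and Q: "Q \<in> mpar q" and R: "R \<in> mpar s" for P Q R r q s
  proof -
    note Pv = contract_mpar[OF P v] and Qv = contract_mpar[OF Q v] and Rv = contract_mpar[OF R v]
    have "br r (q + s) P (br q s Q R) (v # vs) = contract v (br r (q + s) P (br q s Q R)) vs"
      by (simp add: contract_def)
    also have "contract v (br r (q + s) P (br q s Q R)) =
      br r (q + s + p) P (br q (s + p) Q (contract v R) + sgn_pow (p * s) (br (q + p) s (contract v Q) R))
      + sgn_pow (p * (q + s)) (br (r + p) (q + s) (contract v P) (br q s Q R))"
      by (simp only: contract_br[OF P br_mpar[OF Q R] v] contract_br[OF Q R v])
    also have "br r (q + s + p) P (br q (s + p) Q (contract v R) + sgn_pow (p * s) (br (q + p) s (contract v Q) R))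
      = br r (q + s + p) P (br q (s + p) Q (contract v R)) + sgn_pow (p * s) (br r (q + s + p) P (br (q + p) s (contract v Q) R))"
      using mb[OF Q Rv] mb[OF Qv R] P[THEN mpar_mlin] by (simp add: br_add_right br_sgn_right msg)
    finally show ?thesis by (simp add: sgn_pow_fun ac_simps)
  qed
  have triple': "br (q + s) r (br q s Q R) P (v # vs) =
      br (q + s) (r + p) (br q s Q R) (contract v P) vs
    + sgn_pow (p * r) (br (q + (s + p)) r (br q (s + p) Q (contract v R)) P vs)
    + sgn_pow (p * (r + s)) (br (q + p + s) r (br (q + p) s (contract v Q) R) P vs)"
    if P: "P \<in> mpar r" and Q: "Q \<in> mpar q" and R: "R \<in> mpar s" for P Q R r q s
  proof -
    note Pv = contract_mpar[OF P v] and Qv = contract_mpar[OF Q v] and Rv = contract_mpar[OF R v]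
    have "br (q + s) r (br q s Q R) P (v # vs) = contract v (br (q + s) r (br q s Q R) P) vs"
      by (simp add: contract_def)
    also have "contract v (br (q + s) r (br q s Q R) P) = br (q + s) (r + p) (br q s Q R) (contract v P)
      + sgn_pow (p * r) (br (q + s + p) r (br q (s + p) Q (contract v R) + sgn_pow (p * s) (br (q + p) s (contract v Q) R)) P)"
      by (simp only: contract_br[OF br_mpar[OF Q R] P v] contract_br[OF Q R v])
    also have "br (q + s + p) r (br q (s + p) Q (contract v R) + sgn_pow (p * s) (br (q + p) s (contract v Q) R)) P
      = br (q + s + p) r (br q (s + p) Q (contract v R)) P + sgn_pow (p * s) (br (q + s + p) r (br (q + p) s (contract v Q) R) P)"
      using mb[OF Q Rv] mb[OF Qv R] P[THEN mpar_mlin] by (simp add: br_add_left br_sgn_left msg)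
    finally show ?thesis by (simp add: sgn_pow_fun sgn_pow_add sgn_pow_sgn_pow algebra_simps)
  qed
  \<comment> \<open>With values replaced by arbitrary vectors, combining the three instances is a
    check of signs over sixteen parity patterns.\<close>
  have signs: "L1 + sgn_pow (p * c) L2 + sgn_pow (p * (b + c)) L3
      = R1 + sgn_pow (p * c) R2 + sgn_pow (p * (c + b)) R3
        + sgn_pow (a * b) (T1 + sgn_pow (p * c) T3 + sgn_pow (p * (a + c)) T2)"
    if "L1 = R1 + sgn_pow (a * b) T1" "L2 = R2 + sgn_pow (a * (b + p)) T2" "L3 = R3 + sgn_pow ((a + p) * b) T3"
    for L1 L2 L3 R1 R2 R3 T1 T2 T3 :: 'v
    unfolding that by (cases a; cases b; cases c; cases p; simp)
  note IH = Cons.IH[OF X Y Zv vs] Cons.IH[OF X Yv Z vs] Cons.IH[OF Xv Y Z vs]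
  show ?case
    unfolding triple[OF X Y Z] triple[OF Y X Z] triple'[OF Z X Y]
    by (rule signs[OF IH])
qed

lemma br_jacobi:
  assumes X: "X \<in> mpar a" and Y: "Y \<in> mpar b" and Z: "Z \<in> mpar c"
  shows "br a (b + c) X (br b c Y Z) = br (a + b) c (br a b X Y) Z + sgn_pow (a * b) (br b (a + c) Y (br a c X Z))"
  using X Y Z br_jacobi_hom[OF X Y Z]
  by (intro mlin_ext) (auto intro!: mlin_plus mpar_sgn_pow br_mpar mpar_mlin[OF br_mpar] mpar_mlin[OF mpar_sgn_pow[OF br_mpar]]
    simp: sgn_pow_fun)

end

section \<open>Arity and parity components of maps\<close>

definition fin_arity :: "('v list \<Rightarrow> 'v::zero) \<Rightarrow> bool" where
  "fin_arity f \<longleftrightarrow> (\<exists>K. finite K \<and> arity_in K f)"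

definition restrict_arity :: "nat \<Rightarrow> ('v list \<Rightarrow> 'v::zero) \<Rightarrow> 'v list \<Rightarrow> 'v" where
  "restrict_arity k f vs = (if length vs = k then f vs else 0)"

lemma arity_in_0 [simp]: "arity_in K 0"
  by (simp add: arity_in_def)

lemma arity_in_add:
  fixes f g :: "'v list \<Rightarrow> 'v::ab_group_add"
  shows "arity_in K f \<Longrightarrow> arity_in L g \<Longrightarrow> arity_in (K \<union> L) (f + g)"
  unfolding arity_in_def by (auto, metis add.left_neutral)

lemma arity_in_minus:
  fixes f :: "'v list \<Rightarrow> 'v::ab_group_add"
  shows "arity_in K f \<Longrightarrow> arity_in K (- f)"
  unfolding arity_in_def by auto

lemma fin_arity_single: "arity_in {n} f \<Longrightarrow> fin_arity f"
  unfolding fin_arity_def by (intro exI[of _ "{n}"]) simp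

lemma fin_arity_0 [simp]: "fin_arity 0"
  unfolding fin_arity_def by (rule exI[of _ "{}"]) simp

lemma fin_arity_add:
  fixes f g :: "'v list \<Rightarrow> 'v::ab_group_add"
  shows "fin_arity f \<Longrightarrow> fin_arity g \<Longrightarrow> fin_arity (f + g)"
  unfolding fin_arity_def by (meson arity_in_add finite_UnI)

lemma fin_arity_minus:
  fixes f :: "'v list \<Rightarrow> 'v::ab_group_add"
  shows "fin_arity f \<Longrightarrow> fin_arity (- f)"
  unfolding fin_arity_def using arity_in_minus by blast

lemma sum_apply: "(\<Sum>i\<in>I. f i) x = (\<Sum>i\<in>I. f i x)"
  by (induction I rule: infinite_finite_induct) auto

lemma arity_in_sum:
  fixes f :: "'i \<Rightarrow> 'v list \<Rightarrow> 'v::ab_group_add"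
  shows "(\<And>i. i \<in> I \<Longrightarrow> arity_in K (f i)) \<Longrightarrow> arity_in K (\<Sum>i\<in>I. f i)"
  unfolding arity_in_def sum_apply using sum.not_neutral_contains_not_neutral by metis

text \<open>A map with finitely many arities is the sum of its truncations, so stability of
  \<open>P\<close> under truncation identifies the internal sum of the pieces. It serves both for
  all supersymmetric maps and for the multiderivations.\<close>

lemma sum_of_family_arity:
  fixes P :: "('v list \<Rightarrow> 'v::ab_group_add) set"
  assumes add: "\<And>f g. f \<in> P \<Longrightarrow> g \<in> P \<Longrightarrow> f + g \<in> P" and zero: "0 \<in> P"
    and res: "\<And>f k. f \<in> P \<Longrightarrow> restrict_arity k f \<in> P"
  shows "sum_of_family (\<lambda>k. {f \<in> P. arity_in {k} f}) = {f \<in> P. fin_arity f}"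
proof (intro equalityI subsetI)
  fix f assume "f \<in> sum_of_family (\<lambda>k. {f \<in> P. arity_in {k} f})"
  then obtain K x where "finite K" and x: "\<forall>k\<in>K. x k \<in> P \<and> arity_in {k} (x k)" and f: "f = (\<Sum>k\<in>K. x k)"
    by (auto simp: sum_of_family_def)
  from \<open>finite K\<close> x have "(\<Sum>k\<in>K. x k) \<in> P \<and> fin_arity (\<Sum>k\<in>K. x k)"
  proof (induction K)
    case (insert k K)
    have "fin_arity (x k)" using insert.prems by (auto simp: fin_arity_def)
    with insert have "x k + sum x K \<in> P" "fin_arity (x k + sum x K)"
      by (auto intro: add fin_arity_add)
    then show ?case by (simp only: sum.insert[OF insert.hyps])
  qed (use zero in \<open>auto simp: zero_fun_def[symmetric]\<close>)
  then show "f \<in> {f \<in> P. fin_arity f}" using f by simp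
next
  fix f assume "f \<in> {f \<in> P. fin_arity f}"
  then obtain K where f: "f \<in> P" and K: "finite K" "arity_in K f" by (auto simp: fin_arity_def)
  have "f vs = (\<Sum>k\<in>K. restrict_arity k f) vs" for vs
  proof -
    have "(\<Sum>k\<in>K. restrict_arity k f vs) = (\<Sum>k\<in>K. if length vs = k then f vs else 0)"
      by (simp add: restrict_arity_def)
    also have "\<dots> = (if length vs \<in> K then f vs else 0)"
      using K(1) by simp
    also have "\<dots> = f vs" using K(2) by (auto simp: arity_in_def)
    finally show ?thesis by (simp add: sum_apply)
  qed
  then have "f = (\<Sum>k\<in>K. restrict_arity k f)" by blast
  moreover have "arity_in {k} (restrict_arity k f)" for k
    by (simp add: arity_in_def restrict_arity_def)
  ultimately show "f \<in> sum_of_family (\<lambda>k. {f \<in> P. arity_in {k} f})"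
    unfolding sum_of_family_def using K(1) res[OF f] by blast
qed

context superspace
begin

lemma superspace_shift: "superspace scale (parity_shift U)"
  by unfold_locales (auto simp: parity_shift_def subspace_parity parity_disjoint[unfolded Int_commute[of "U 0"]])

lemma carrier_of_parity_shift: "carrier_of (parity_shift U) = carrier_of U"
  unfolding carrier_of_def parity_shift_def by (auto; metis add.commute)

lemma restrict_mlin:
  assumes f: "f \<in> mlin" shows "restrict_arity k f \<in> mlin"
proof (rule mlinI)
  show "splits (restrict_arity k f)"
    using splitsD[OF mlin_splits[OF f]] by (simp add: splits_def restrict_arity_def)
  show "restrict_arity k f (xs @ x # y # ys) = sgn_pow (p * q) (restrict_arity k f (xs @ y # x # ys))"
    if "x \<in> U p" "y \<in> U q" for xs x p y q ys
    using mlin_swap[OF f that, of "xs" ys] by (simp add: restrict_arity_def)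
qed (use f in \<open>auto simp: restrict_arity_def mlin_outside carrierI mlin_carrier mlin_add mlin_scale\<close>)

lemma fin_arity_fscale: "fin_arity f \<Longrightarrow> fin_arity (fscale scale r f)"
  unfolding fin_arity_def arity_in_def fscale_def by (metis scale_zero_right)

lemma W_parity_eq: "W_parity scale U q = {f \<in> mpar q. fin_arity f}"
proof -
  have "hom_sym scale U = (\<lambda>k. {f \<in> mlin. arity_in {k} f})"
    by (auto simp: hom_sym_iff)
  then have "sum_of_family (hom_sym scale U) = {f \<in> mlin. fin_arity f}"
    using sum_of_family_arity[of mlin] mlin_plus restrict_mlin by simp
  then show ?thesis by (auto simp: W_parity_def mpar_def)
qed

text \<open>The component of parity \<open>q\<close> of a map, obtained by projecting its values.
  The required parity of a value is known only for homogeneous arguments, hence the use of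
  \<open>multilin_ext\<close>.\<close>

definition parity_part :: "bit \<Rightarrow> ('v list \<Rightarrow> 'v) \<Rightarrow> 'v list \<Rightarrow> 'v" where
  "parity_part q f = multilin_ext U (\<lambda>ps vs. hcomp U (q + sum_list ps) (f vs))"

lemma parity_part_splits: "f \<in> mlin \<Longrightarrow> splits (parity_part q f)"
  unfolding parity_part_def by (rule multilin_ext_splits) (simp add: mlin_zero_arg)

lemma parity_part_hom: "f \<in> mlin \<Longrightarrow> hom_list vs ps \<Longrightarrow> parity_part q f vs = hcomp U (q + sum_list ps) (f vs)"
  unfolding parity_part_def by (rule multilin_ext_homogeneous) (simp_all add: mlin_zero_arg)

lemma parity_part_mlin:
  assumes f: "f \<in> mlin" shows "parity_part q f \<in> mlin"
proof (rule mlinI)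
  show "parity_part q f vs = 0" if "\<not> set vs \<subseteq> carrier_of U" for vs
    using that by (simp add: parity_part_def multilin_ext_outside)
  show "parity_part q f (xs @ (u + v) # ys) = parity_part q f (xs @ u # ys) + parity_part q f (xs @ v # ys)"
    if "hom_list xs ps" "u \<in> U p" "v \<in> U p" "hom_list ys qs" for xs ps u v p ys qs
  proof -
    have "hom_list (xs @ w # ys) (ps @ p # qs)" if "w \<in> U p" for w
      using \<open>hom_list xs ps\<close> \<open>hom_list ys qs\<close> that by (simp add: list_all2_appendI)
    from this[OF that(2)] this[OF that(3)] this[OF add_mem[OF that(2,3)]] show ?thesis
      using that f by (simp add: parity_part_hom mlin_add carrierI hcomp_add mlin_carrier)
  qed
  show "parity_part q f (xs @ scale t u # ys) = scale t (parity_part q f (xs @ u # ys))"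
    if "hom_list xs ps" "u \<in> U p" "hom_list ys qs" for xs ps u p ys qs t
  proof -
    have "hom_list (xs @ w # ys) (ps @ p # qs)" if "w \<in> U p" for w
      using \<open>hom_list xs ps\<close> \<open>hom_list ys qs\<close> that by (simp add: list_all2_appendI)
    from this[OF that(2)] this[OF scale_mem[OF that(2), of t]] show ?thesis
      using that f by (simp add: parity_part_hom mlin_scale carrierI hcomp_scale mlin_carrier)
  qed
  show "parity_part q f (xs @ u # v # ys) = sgn_pow (p * s) (parity_part q f (xs @ v # u # ys))"
    if "hom_list xs ps" "u \<in> U p" "v \<in> U s" "hom_list ys qs" for xs ps u p v s ys qs
  proof -
    have "hom_list (xs @ u # v # ys) (ps @ p # s # qs)" "hom_list (xs @ v # u # ys) (ps @ s # p # qs)"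
      using that by (simp_all add: list_all2_appendI)
    then have "parity_part q f (xs @ u # v # ys) = hcomp U (q + sum_list (ps @ p # s # qs)) (f (xs @ u # v # ys))"
      "parity_part q f (xs @ v # u # ys) = hcomp U (q + sum_list (ps @ p # s # qs)) (f (xs @ v # u # ys))"
      using f by (simp_all add: parity_part_hom ac_simps)
    then show ?thesis
      by (simp only: mlin_swap[OF f that(2,3)] hcomp_sgn_pow mlin_carrier[OF f])
  qed
qed (use f in \<open>auto simp: parity_part_hom parity_part_splits hcomp_carrier mlin_carrier\<close>)

lemma parity_part_mpar: "f \<in> mlin \<Longrightarrow> parity_part q f \<in> mpar q"
  by (simp add: mpar_def has_map_parity_def parity_part_mlin parity_part_hom hcomp_mem mlin_carrier)

lemma parity_part_decomp: "f \<in> mlin \<Longrightarrow> parity_part 0 f + parity_part 1 f = f"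
proof (rule mlin_ext)
  fix vs ps assume "f \<in> mlin" "hom_list vs ps"
  then show "(parity_part 0 f + parity_part 1 f) vs = f vs"
    using hcomp_decomp[OF mlin_carrier, of f vs]
    by (cases "sum_list ps") (simp_all add: parity_part_hom add.commute)
qed (auto intro: mlin_plus parity_part_mlin)

lemma parity_part_arity: "arity_in K f \<Longrightarrow> arity_in K (parity_part q f)"
  unfolding arity_in_def
proof (intro allI impI, rule ccontr)
  fix vs assume f: "\<forall>vs. f vs \<noteq> 0 \<longrightarrow> length vs \<in> K" and "parity_part q f vs \<noteq> 0" and vs: "length vs \<notin> K"
  have "f (map2 (hcomp U) ps vs) = 0" if "length ps = length vs" for ps
    using f vs that by (metis length_map length_zip min.idem)
  then have "parity_part q f vs = 0" unfolding parity_part_def multilin_ext_def by simp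
  then show False using \<open>parity_part q f vs \<noteq> 0\<close> by simp
qed

lemma parity_part_fin_arity: "fin_arity f \<Longrightarrow> fin_arity (parity_part q f)"
  unfolding fin_arity_def using parity_part_arity by blast

text \<open>The predicate \<open>P\<close> is a parameter so that the universal Lie superalgebra and
  the prolongation are two instances.\<close>

lemma superspace_mpar:
  assumes P: "\<And>f g. f \<in> P \<Longrightarrow> g \<in> P \<Longrightarrow> f + g \<in> P" "\<And>f r. f \<in> P \<Longrightarrow> fscale scale r f \<in> P" "0 \<in> P"
  shows "superspace (fscale scale) (\<lambda>q. {f \<in> mpar q. f \<in> P \<and> fin_arity f})"
proof -
  interpret F: vector_space "fscale scale :: 'f \<Rightarrow> ('v list \<Rightarrow> 'v) \<Rightarrow> ('v list \<Rightarrow> 'v)" by (rule fun_module)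
  show ?thesis
  proof
    show "F.subspace {f \<in> mpar q. f \<in> P \<and> fin_arity f}" for q
      by (rule F.subspaceI) (auto simp: P mpar_plus mpar_fscale fin_arity_add fin_arity_fscale)
    show "{f \<in> mpar 0. f \<in> P \<and> fin_arity f} \<inter> {f \<in> mpar 1. f \<in> P \<and> fin_arity f} = {0}"
      using mpar_inter[of _ 0] P(3) by auto
  qed
qed

lemma superspace_W: "superspace (fscale scale) (W_parity scale U)"
proof -
  have "W_parity scale U = (\<lambda>q. {f \<in> mpar q. f \<in> UNIV \<and> fin_arity f})"
    by (simp add: fun_eq_iff W_parity_eq)
  then show ?thesis using superspace_mpar[of UNIV] by simp
qed

interpretation W: superspace "fscale scale" "W_parity scale U"
  by (rule superspace_W)

text \<open>Replaces the definite description in \<open>hcomp\<close> by the explicit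
  \<open>parity_part\<close>, which is visibly compatible with arities and with the derivation
  property.\<close>

lemma hcomp_W:
  assumes "f \<in> mlin" "fin_arity f" shows "hcomp (W_parity scale U) q f = parity_part q f"
proof (rule W.hcomp_eqI)
  have "f - parity_part q f = parity_part (q + 1) f"
    using parity_part_decomp[OF assms(1)] by (cases q) (auto simp: algebra_simps)
  then show "f - parity_part q f \<in> W_parity scale U (q + 1)"
    using assms by (simp add: W_parity_eq parity_part_mpar parity_part_fin_arity)
qed (use assms in \<open>simp add: W_parity_eq parity_part_mpar parity_part_fin_arity\<close>)

lemma W_bracket_eq:
  "W_bracket scale U X Y =
    (\<Sum>p\<in>{0, 1}. \<Sum>q\<in>{0, 1}. br p q (hcomp (W_parity scale U) p X) (hcomp (W_parity scale U) q Y))"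
  by (simp add: W_bracket_def br_def Let_def)

lemma box_0 [simp]: "box U 0 Y = 0" "X \<in> mlin \<Longrightarrow> box U X 0 = 0"
  using box_add_left[of 0 0 Y] box_add_right[of X 0 0] by simp_all

lemma br_0 [simp]: "Y \<in> mlin \<Longrightarrow> br p q 0 Y = 0" "X \<in> mlin \<Longrightarrow> br p q X 0 = 0"
  by (simp_all add: br_def)

text \<open>Of the four pairs of parity components, three contain a zero component.\<close>

lemma W_bracket_hom:
  assumes X: "X \<in> W_parity scale U p" and Y: "Y \<in> W_parity scale U q"
  shows "W_bracket scale U X Y = br p q X Y"
proof -
  have "X \<in> mlin" "Y \<in> mlin" using X Y by (auto simp: W_parity_eq mpar_mlin)
  then show ?thesis
    unfolding W_bracket_eq W.hcomp_homogeneous[OF X] W.hcomp_homogeneous[OF Y]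
    by (cases p; cases q; simp)
qed

lemma W_carrier_mlin: "X \<in> carrier_of (W_parity scale U) \<Longrightarrow> X \<in> mlin"
  by (auto simp: carrier_of_def W_parity_eq intro: mlin_plus mpar_mlin)

lemma W_hcomp_mlin: "X \<in> carrier_of (W_parity scale U) \<Longrightarrow> hcomp (W_parity scale U) p X \<in> mlin"
  using W.hcomp_carrier W_carrier_mlin by blast

lemma W_bracket_add_left:
  assumes "X \<in> carrier_of (W_parity scale U)" "X' \<in> carrier_of (W_parity scale U)" "Y \<in> carrier_of (W_parity scale U)"
  shows "W_bracket scale U (X + X') Y = W_bracket scale U X Y + W_bracket scale U X' Y"
  unfolding W_bracket_eq using assms
  by (simp add: W.hcomp_add br_add_left W_hcomp_mlin sum.distrib)

lemma W_bracket_add_right: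
  assumes "X \<in> carrier_of (W_parity scale U)" "Y \<in> carrier_of (W_parity scale U)" "Y' \<in> carrier_of (W_parity scale U)"
  shows "W_bracket scale U X (Y + Y') = W_bracket scale U X Y + W_bracket scale U X Y'"
  unfolding W_bracket_eq using assms
  by (simp add: W.hcomp_add br_add_right W_hcomp_mlin sum.distrib)

lemma fscale_sgn_pow: "fscale scale r (sgn_pow p f) = sgn_pow p (fscale scale r f)"
  by (cases p) (simp_all add: fscale_def fun_eq_iff)

lemma fscale_diff: "fscale scale r (f - g) = fscale scale r f - fscale scale r g"
  by (simp add: fscale_def fun_eq_iff scale_right_diff_distrib)

lemma br_scale:
  assumes "X \<in> mlin" "Y \<in> mlin"
  shows "br p q (fscale scale r X) Y = fscale scale r (br p q X Y)"
    "br p q X (fscale scale r Y) = fscale scale r (br p q X Y)"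
  using assms by (simp_all add: br_def box_scale_left box_scale_right fscale_diff fscale_sgn_pow)

lemma W_bracket_scale:
  assumes "X \<in> carrier_of (W_parity scale U)" "Y \<in> carrier_of (W_parity scale U)"
  shows "W_bracket scale U (fscale scale r X) Y = fscale scale r (W_bracket scale U X Y)"
    "W_bracket scale U X (fscale scale r Y) = fscale scale r (W_bracket scale U X Y)"
  unfolding W_bracket_eq using assms
  by (simp_all add: W.hcomp_scale br_scale W_hcomp_mlin W.scale_right_distrib)

text \<open>Every contraction of a constant map is 0, so one term of \<open>box_Cons\<close>
  disappears at each step. What remains carries the sign for moving \<open>v\<close> past
  \<open>Y []\<close>, which supersymmetry of \<open>X\<close> cancels.\<close>

lemma box_arity_0:
  assumes "X \<in> mpar r" "Y \<in> mpar q" "arity_in {0} Y" "hom_list vs ps"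
  shows "box U X Y vs = X (Y [] # vs) \<and> box U Y X vs = 0"
  using assms
proof (induction vs arbitrary: X r ps)
  case Nil
  then have "Y [X []] = 0" by (auto simp: arity_in_def)
  then show ?case using Nil by (simp add: box_Nil mpar_mlin)
next
  case (Cons v vs)
  obtain p ps' where v: "v \<in> U p" and vs: "hom_list vs ps'"
    using Cons.prems(4) by (auto simp: list_all2_Cons1)
  have Yv: "contract v Y = 0"
    using Cons.prems(3) by (auto simp: contract_def arity_in_def fun_eq_iff)
  have "X (v # Y [] # vs) = sgn_pow (p * q) (X (Y [] # v # vs))"
    using mlin_swap[OF mpar_mlin[OF Cons.prems(1)] v mpar_Nil[OF Cons.prems(2)], of "[]"] by simp
  moreover have "contract v X (Y [] # vs) = X (v # Y [] # vs)"
    by (simp only: contract_def)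
  moreover have "box U X Y (v # vs) = sgn_pow (p * q) (box U (contract v X) Y vs)"
    "box U Y X (v # vs) = box U Y (contract v X) vs"
    using Cons.prems box_Cons[OF _ Cons.prems(2) v vs, of X] box_Cons[OF _ Cons.prems(1) v vs, of Y]
    by (simp_all add: mpar_mlin Yv)
  ultimately show ?case
    using Cons.IH[OF contract_mpar[OF Cons.prems(1) v] Cons.prems(2,3) vs]
    by (simp add: sgn_pow_sgn_pow)
qed

lemma br_arity_0:
  assumes X: "X \<in> mpar r" and Y: "Y \<in> mpar q" "arity_in {0} Y"
  shows "br r q X Y = contract (Y []) X"
proof (rule mlin_ext)
  show "br r q X Y \<in> mlin" using br_mpar[OF X Y(1)] by (rule mpar_mlin)
  show "contract (Y []) X \<in> mlin"
    by (rule contract_mlin[OF mpar_mlin[OF X] mlin_carrier[OF mpar_mlin[OF Y(1)]]])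
  show "br r q X Y vs = contract (Y []) X vs" if "hom_list vs ps" for vs ps
    using box_arity_0[OF X Y that] by (simp add: br_def sgn_pow_fun contract_def[of "Y []" X vs])
qed

text \<open>Turns the condition defining the prolongation, a bracket with elements of degree -1,
  into a condition on contractions.\<close>

lemma W_bracket_arity_0:
  assumes X: "X \<in> mlin" "fin_arity X" and Y: "Y \<in> mlin" "arity_in {0} Y"
  shows "W_bracket scale U X Y = contract (Y []) X"
proof -
  have fY: "fin_arity Y" unfolding fin_arity_def using Y(2) by (intro exI[of _ "{0}"]) simp
  have Yq: "parity_part q Y [] = hcomp U q (Y [])" for q
    using parity_part_hom[OF Y(1), of "[]" "[]"] by simp
  have "br p q (parity_part p X) (parity_part q Y) = contract (parity_part q Y []) (parity_part p X)" for p q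
    by (rule br_arity_0[OF parity_part_mpar[OF X(1)] parity_part_mpar[OF Y(1)] parity_part_arity[OF Y(2)]])
  then have "W_bracket scale U X Y = (\<Sum>p\<in>{0, 1}. \<Sum>q\<in>{0, 1}. contract (parity_part q Y []) (parity_part p X))"
    unfolding W_bracket_eq hcomp_W[OF X] hcomp_W[OF Y(1) fY] by simp
  also have "\<dots> = (\<Sum>p\<in>{0, 1}. contract (even_part U (Y []) + odd_part U (Y [])) (parity_part p X))"
    using X Y by (simp add: Yq contract_add parity_part_mlin hcomp_carrier mlin_carrier)
  also have "\<dots> = contract (Y []) (parity_part 0 X + parity_part 1 X)"
    using Y by (simp add: hcomp_decomp mlin_carrier)
  finally show ?thesis by (simp add: parity_part_decomp X)
qed

end

section \<open>Multiderivations and the concatenation product\<close>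

context superalgebra
begin

lemma prd_zero:
  "a \<in> carrier_of U \<Longrightarrow> prd 0 a = 0" "a \<in> carrier_of U \<Longrightarrow> prd a 0 = 0"
  using prd_add_left[of 0 0 a] prd_add_right[of a 0 0] by simp_all

lemma prd_carrier: "a \<in> carrier_of U \<Longrightarrow> b \<in> carrier_of U \<Longrightarrow> prd a b \<in> carrier_of U"
proof -
  assume a: "a \<in> carrier_of U" and b: "b \<in> carrier_of U"
  note h = hcomp_mem[OF a] hcomp_mem[OF b]
  have "prd (hcomp U p a) (hcomp U q b) \<in> carrier_of U" for p q
    by (rule carrierI[OF prd_parity[OF h]])
  moreover have "prd (even_part U a + odd_part U a) (even_part U b + odd_part U b)
    = prd (even_part U a) (even_part U b) + prd (even_part U a) (odd_part U b)
    + (prd (odd_part U a) (even_part U b) + prd (odd_part U a) (odd_part U b))"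
    using a b by (simp add: prd_add_left prd_add_right hcomp_carrier carrier_add)
  ultimately show "prd a b \<in> carrier_of U"
    using a b by (simp add: hcomp_decomp carrier_add)
qed

end

section \<open>The product under contraction, and multiderivations\<close>

context comm_assoc_superalgebra
begin

declare prd_zero [simp]

text \<open>Arguments and values of the maps are graded by the shifted parity, the product by the
  original one; the prefix \<open>sh\<close> marks notions that refer to the shifted
  superspace.\<close>

sublocale sh: superspace scale "parity_shift U"
  by (rule superspace_shift)

lemma carrier_shift [simp]: "carrier_of (parity_shift U) = carrier_of U"
  by (rule carrier_of_parity_shift)

lemma mem_shift: "x \<in> parity_shift U p \<longleftrightarrow> x \<in> U (p + 1)"
  by (simp add: parity_shift_def)

lemma mem_shift': "x \<in> U p \<longleftrightarrow> x \<in> parity_shift U (p + 1)"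
  by (simp add: parity_shift_def)

lemma prd_minus:
  assumes "a \<in> carrier_of U" "b \<in> carrier_of U"
  shows "prd (- a) b = - prd a b" "prd a (- b) = - prd a b"
  using prd_scale_left[OF assms, of "- 1"] prd_scale_right[OF assms, of "- 1"] by simp_all

lemma prd_sgn_pow:
  assumes "a \<in> carrier_of U" "b \<in> carrier_of U"
  shows "prd (sgn_pow p a) b = sgn_pow p (prd a b)" "prd a (sgn_pow p b) = sgn_pow p (prd a b)"
  using assms by (cases p; simp add: prd_minus)+

lemma prd_diff:
  assumes "a \<in> carrier_of U" "b \<in> carrier_of U" "c \<in> carrier_of U"
  shows "prd (a - b) c = prd a c - prd b c" "prd c (a - b) = prd c a - prd c b"
  using prd_add_left[of a "- b" c] prd_add_right[of c a "- b"] assms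
  by (simp_all add: prd_minus carrier_minus)

text \<open>Here \<open>q\<close> is the parity of \<open>Y\<close> as a map on the shifted
  superspace, so \<open>q + 1\<close> is its parity in the Gerstenhaber superalgebra, the one in the
  product formula.\<close>

definition wdg_form :: "bit \<Rightarrow> ('b list \<Rightarrow> 'b) \<Rightarrow> ('b list \<Rightarrow> 'b) \<Rightarrow> bit list \<Rightarrow> 'b list \<Rightarrow> 'b" where
  "wdg_form q X Y ps vs = (\<Sum>S\<in>Pow {..<length vs}.
     sgn_pow (cross ps S + (q + 1) * sum_list (nths ps S)) (prd (X (nths vs S)) (Y (nths vs (- S)))))"

definition wdg :: "bit \<Rightarrow> ('b list \<Rightarrow> 'b) \<Rightarrow> ('b list \<Rightarrow> 'b) \<Rightarrow> 'b list \<Rightarrow> 'b" where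
  "wdg q X Y = multilin_ext (parity_shift U) (wdg_form q X Y)"

lemma wdg_form_zero_arg:
  assumes "X \<in> sh.mlin" "Y \<in> sh.mlin" "0 \<in> set vs" shows "wdg_form q X Y ps vs = 0"
  unfolding wdg_form_def
proof (rule sum.neutral, rule ballI)
  fix S
  have "X (nths vs S) = 0 \<or> Y (nths vs (- S)) = 0"
    using mem_nths_or_compl[OF assms(3), of S] sh.mlin_zero_arg[OF assms(1)] sh.mlin_zero_arg[OF assms(2)] by blast
  moreover have "X (nths vs S) \<in> carrier_of U" "Y (nths vs (- S)) \<in> carrier_of U"
    using sh.mlin_carrier[OF assms(1)] sh.mlin_carrier[OF assms(2)] by simp_all
  ultimately show "sgn_pow (cross ps S + (q + 1) * sum_list (nths ps S)) (prd (X (nths vs S)) (Y (nths vs (- S)))) = 0"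
    by auto
qed

lemma wdg_hom:
  assumes "X \<in> sh.mlin" "Y \<in> sh.mlin" "sh.hom_list vs ps"
  shows "wdg q X Y vs = wdg_form q X Y ps vs"
  unfolding wdg_def using assms wdg_form_zero_arg by (intro sh.multilin_ext_homogeneous) auto

lemma wdg_Nil: "X \<in> sh.mlin \<Longrightarrow> Y \<in> sh.mlin \<Longrightarrow> wdg q X Y [] = prd (X []) (Y [])"
  using wdg_hom[of X Y "[]" "[]"] by (simp add: wdg_form_def cross_def)

text \<open>If \<open>X\<close> takes \<open>v\<close>, the parity-dependent sign contributes
  \<open>p * (q + 1)\<close>. If \<open>Y\<close> takes it, the extra term of
  \<open>cross_Suc\<close> changes the factor \<open>q + 1\<close> of the selected parities into
  \<open>q + p + 1\<close>, exactly the factor belonging to \<open>contract v Y\<close>. This is why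
  the index \<open>q\<close> has to vary.\<close>

lemma wdg_Cons:
  assumes X: "X \<in> sh.mlin" and Y: "Y \<in> sh.mlin" and v: "v \<in> parity_shift U p" and vs: "sh.hom_list vs ps"
  shows "wdg q X Y (v # vs)
    = wdg (q + p) X (contract v Y) vs + sgn_pow (p * (q + 1)) (wdg q (contract v X) Y vs)"
proof -
  have m: "contract v X \<in> sh.mlin" "contract v Y \<in> sh.mlin"
    using X Y sh.carrierI[OF v] by (simp_all add: sh.contract_mlin)
  have "wdg q X Y (v # vs) = wdg_form q X Y (p # ps) (v # vs)"
    using X Y v vs by (intro wdg_hom) auto
  also have "\<dots> = sgn_pow (p * (q + 1)) (wdg_form q (contract v X) Y ps vs) + wdg_form (q + p) X (contract v Y) ps vs"
    unfolding wdg_form_def sgn_pow_sum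
    by (simp add: sum_Pow_lessThan_Suc cross_insert_0 cross_Suc contract_def sgn_pow_sgn_pow algebra_simps)
  finally show ?thesis
    using X Y m vs by (simp add: wdg_hom[where ps = ps])
qed

lemma wdg_add_left:
  assumes "X \<in> sh.mlin" "X' \<in> sh.mlin" "Y \<in> sh.mlin"
  shows "wdg q (X + X') Y = wdg q X Y + wdg q X' Y"
  unfolding wdg_def multilin_ext_add[symmetric]
  by (rule arg_cong[where f = "multilin_ext (parity_shift U)"])
    (use assms[THEN sh.mlin_carrier] in \<open>simp add: fun_eq_iff wdg_form_def sgn_pow_add sum.distrib prd_add_left\<close>)

lemma wdg_add_right:
  assumes "X \<in> sh.mlin" "Y \<in> sh.mlin" "Y' \<in> sh.mlin"
  shows "wdg q X (Y + Y') = wdg q X Y + wdg q X Y'"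
  unfolding wdg_def multilin_ext_add[symmetric]
  by (rule arg_cong[where f = "multilin_ext (parity_shift U)"])
    (use assms[THEN sh.mlin_carrier] in \<open>simp add: fun_eq_iff wdg_form_def sgn_pow_add sum.distrib prd_add_right\<close>)

lemma wdg_scale:
  assumes "X \<in> sh.mlin" "Y \<in> sh.mlin"
  shows "wdg q (fscale scale r X) Y = fscale scale r (wdg q X Y)"
    and "wdg q X (fscale scale r Y) = fscale scale r (wdg q X Y)"
  unfolding wdg_def sh.multilin_ext_scale[symmetric]
  by (rule arg_cong[where f = "multilin_ext (parity_shift U)"],
      use assms[THEN sh.mlin_carrier] in \<open>simp add: fun_eq_iff wdg_form_def sgn_pow_scale scale_sum_right
        fscale_def prd_scale_left prd_scale_right\<close>)+

text \<open>The product adds unshifted parities: \<open>(r + 1) + (q + 1)\<close> is the unshifted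
  form of \<open>r + q + 1\<close>, hence operation parity 1.\<close>

sublocale wdg: contraction_op scale "parity_shift U" 1 wdg
proof unfold_locales
  show "wdg q X Y vs = 0" if "\<not> set vs \<subseteq> carrier_of (parity_shift U)" for q X Y vs
    using that unfolding wdg_def by (rule multilin_ext_outside)
  show "sh.splits (wdg q X Y)" if "X \<in> sh.mlin" "Y \<in> sh.mlin" for q X Y
    unfolding wdg_def using wdg_form_zero_arg[OF that] by (intro sh.multilin_ext_splits)
  show "wdg q X Y [] \<in> parity_shift U (r + q + 1)" if "X \<in> sh.mpar r" "Y \<in> sh.mpar q" for X Y r q
    using prd_parity[of "X []" "r + 1" "Y []" "q + 1"] sh.mpar_Nil[OF that(1)] sh.mpar_Nil[OF that(2)] that
    by (simp add: wdg_Nil sh.mpar_mlin mem_shift ac_simps)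
qed (simp_all add: wdg_add_left wdg_add_right wdg_scale wdg_Cons sh.mpar_mlin)

lemma wdg_arity:
  assumes X: "X \<in> sh.mlin" "arity_in H X" and Y: "Y \<in> sh.mlin" "arity_in K Y"
  shows "arity_in {n. \<exists>h\<in>H. \<exists>k\<in>K. n = h + k} (wdg q X Y)"
  unfolding arity_in_def
proof (intro allI impI)
  fix vs assume "wdg q X Y vs \<noteq> 0"
  then obtain ps where "length ps = length vs" "wdg_form q X Y ps (map2 (hcomp (parity_shift U)) ps vs) \<noteq> 0"
    unfolding wdg_def multilin_ext_def by (auto split: if_splits elim!: sum.not_neutral_contains_not_neutral)
  moreover define ws where "ws = map2 (hcomp (parity_shift U)) ps vs"
  ultimately have len: "length ws = length vs" and "wdg_form q X Y ps ws \<noteq> 0" by simp_all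
  then obtain S where "sgn_pow (cross ps S + (q + 1) * sum_list (nths ps S)) (prd (X (nths ws S)) (Y (nths ws (- S)))) \<noteq> 0"
    unfolding wdg_form_def by (elim sum.not_neutral_contains_not_neutral)
  then have "prd (X (nths ws S)) (Y (nths ws (- S))) \<noteq> 0" by auto
  moreover have "X (nths ws S) \<in> carrier_of U" "Y (nths ws (- S)) \<in> carrier_of U"
    using sh.mlin_carrier[OF X(1)] sh.mlin_carrier[OF Y(1)] by simp_all
  ultimately have "X (nths ws S) \<noteq> 0" "Y (nths ws (- S)) \<noteq> 0" by auto
  then have "length (nths ws S) \<in> H" "length (nths ws (- S)) \<in> K"
    using X(2) Y(2) by (auto simp: arity_in_def)
  moreover have "length vs = length (nths ws S) + length (nths ws (- S))"
    using length_nths_compl[of ws S] len by simp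
  ultimately show "length vs \<in> {n. \<exists>h\<in>H. \<exists>k\<in>K. n = h + k}" by blast
qed

lemma wdg_single:
  assumes X: "X \<in> sh.mpar r" and Y: "Y \<in> sh.mpar q" and v: "v \<in> parity_shift U p"
  shows "wdg q X Y [v] = prd (X []) (Y [v]) + sgn_pow (p * (q + 1)) (prd (X [v]) (Y []))"
  using assms sh.carrierI[OF v]
  by (simp add: wdg_Cons[where ps = "[]"] wdg_Nil sh.mpar_mlin sh.contract_mlin)
    (simp add: contract_def)

text \<open>
  By supersymmetry, these maps are derivations in each argument.
\<close>

definition mder :: "('b list \<Rightarrow> 'b) set" where
  "mder = {f. \<forall>xs ps a p b q. sh.hom_list xs ps \<and> a \<in> U p \<and> b \<in> U q \<longrightarrow>
     f (xs @ [prd a b]) = prd (f (xs @ [a])) b + sgn_pow (p * q) (prd (f (xs @ [b])) a)}"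

lemma mderD:
  "f \<in> mder \<Longrightarrow> sh.hom_list xs ps \<Longrightarrow> a \<in> U p \<Longrightarrow> b \<in> U q \<Longrightarrow>
   f (xs @ [prd a b]) = prd (f (xs @ [a])) b + sgn_pow (p * q) (prd (f (xs @ [b])) a)"
  unfolding mder_def by blast

lemma contract_mder:
  assumes f: "f \<in> mder" and v: "v \<in> parity_shift U p" shows "contract v f \<in> mder"
  unfolding mder_def
proof (intro CollectI allI impI)
  fix xs ps a p' b q assume "sh.hom_list xs ps \<and> a \<in> U p' \<and> b \<in> U q"
  then show "contract v f (xs @ [prd a b]) = prd (contract v f (xs @ [a])) b + sgn_pow (p' * q) (prd (contract v f (xs @ [b])) a)"
    using mderD[OF f, of "v # xs" "p # ps" a p' b q] v by (simp add: contract_def)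
qed

text \<open>If a class of maps is stable under contraction up to signed sums of two members, only
  the identity for a single argument has to be verified. It is applied to the class of all products,
  and of all brackets, of homogeneous multiderivations.\<close>

lemma mderI_induct:
  assumes "P f"
    and Nil: "\<And>f a p b q. P f \<Longrightarrow> a \<in> U p \<Longrightarrow> b \<in> U q \<Longrightarrow>
      f [prd a b] = prd (f [a]) b + sgn_pow (p * q) (prd (f [b]) a)"
    and Cons: "\<And>f v p. P f \<Longrightarrow> v \<in> parity_shift U p \<Longrightarrow>
      \<exists>g h e. P g \<and> P h \<and> g \<in> sh.mlin \<and> h \<in> sh.mlin \<and> contract v f = g + sgn_pow e h"
  shows "f \<in> mder"
proof -
  have "sh.hom_list xs ps \<Longrightarrow> a \<in> U p \<Longrightarrow> b \<in> U q \<Longrightarrow> P f \<Longrightarrow>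
     f (xs @ [prd a b]) = prd (f (xs @ [a])) b + sgn_pow (p * q) (prd (f (xs @ [b])) a)" for xs ps a p b q f
  proof (induction xs arbitrary: ps f)
    case Nil then show ?case using assms(2) by simp
  next
    case (Cons v vs)
    obtain p' ps' where v: "v \<in> parity_shift U p'" and vs: "sh.hom_list vs ps'"
      using Cons.prems(1) by (auto simp: list_all2_Cons1)
    obtain g h e where gh: "P g" "P h" "g \<in> sh.mlin" "h \<in> sh.mlin" and f: "contract v f = g + sgn_pow e h"
      using assms(3)[OF Cons.prems(4) v] by blast
    have f': "f (v # zs) = g zs + sgn_pow e (h zs)" for zs
      using fun_cong[OF f, of zs] by (simp add: contract_def sgn_pow_fun)
    have c: "g zs \<in> carrier_of U" "h zs \<in> carrier_of U" "a \<in> carrier_of U" "b \<in> carrier_of U" for zs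
      using sh.mlin_carrier[OF gh(3)] sh.mlin_carrier[OF gh(4)] Cons.prems carrierI by simp_all
    show ?case
      using Cons.IH[OF vs Cons.prems(2,3) gh(1)] Cons.IH[OF vs Cons.prems(2,3) gh(2)] c
      by (simp add: f' prd_add_left prd_sgn_pow carrier_sgn_pow sgn_pow_add sgn_pow_sgn_pow ac_simps)
  qed
  then show ?thesis using assms(1) unfolding mder_def by blast
qed

definition mdpar :: "bit \<Rightarrow> ('b list \<Rightarrow> 'b) set" where
  "mdpar q = sh.mpar q \<inter> mder"

lemma mdpar_mpar: "X \<in> mdpar q \<Longrightarrow> X \<in> sh.mpar q"
  and mdpar_mder: "X \<in> mdpar q \<Longrightarrow> X \<in> mder"
  and mdpar_mlin: "X \<in> mdpar q \<Longrightarrow> X \<in> sh.mlin"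
  by (auto simp: mdpar_def sh.mpar_mlin)

lemma contract_mdpar: "X \<in> mdpar q \<Longrightarrow> v \<in> parity_shift U p \<Longrightarrow> contract v X \<in> mdpar (q + p)"
  by (auto simp: mdpar_def intro: contract_mder sh.contract_mpar)

lemma mder_Nil: "f \<in> mder \<Longrightarrow> a \<in> U p \<Longrightarrow> b \<in> U q \<Longrightarrow>
   f [prd a b] = prd (f [a]) b + sgn_pow (p * q) (prd (f [b]) a)"
  using mderD[of f "[]" "[]"] by simp

text \<open>In one argument, the derivation rules of \<open>X\<close> and \<open>Y\<close> give the
  claim after \<open>Y []\<close> has been moved past \<open>a\<close> or \<open>b\<close>.\<close>

lemma wdg_mdpar:
  assumes X: "X \<in> mdpar r" and Y: "Y \<in> mdpar q" shows "wdg q X Y \<in> mdpar (r + q + 1)"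
proof -
  have "wdg q X Y \<in> mder"
  proof (rule mderI_induct[where P = "\<lambda>f. \<exists>X Y r q. X \<in> mdpar r \<and> Y \<in> mdpar q \<and> f = wdg q X Y"])
    fix f v p assume "\<exists>X Y r q. X \<in> mdpar r \<and> Y \<in> mdpar q \<and> f = wdg q X Y" and v: "v \<in> parity_shift U p"
    then obtain X Y r q where X: "X \<in> mdpar r" and Y: "Y \<in> mdpar q" and f: "f = wdg q X Y" by blast
    note Xv = contract_mdpar[OF X v] and Yv = contract_mdpar[OF Y v]
    have "contract v f = wdg (q + p) X (contract v Y) + sgn_pow (p * (q + 1)) (wdg q (contract v X) Y)"
      unfolding f by (rule wdg.contract_op[OF mdpar_mpar[OF X] mdpar_mpar[OF Y] v])
    moreover have "wdg (q + p) X (contract v Y) \<in> sh.mlin" "wdg q (contract v X) Y \<in> sh.mlin"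
      using wdg.op_mpar[OF mdpar_mpar[OF X] mdpar_mpar[OF Yv]] wdg.op_mpar[OF mdpar_mpar[OF Xv] mdpar_mpar[OF Y]]
      by (simp_all add: sh.mpar_mlin)
    ultimately show "\<exists>g h e. (\<exists>X Y r q. X \<in> mdpar r \<and> Y \<in> mdpar q \<and> g = wdg q X Y) \<and>
        (\<exists>X Y r q. X \<in> mdpar r \<and> Y \<in> mdpar q \<and> h = wdg q X Y) \<and>
        g \<in> sh.mlin \<and> h \<in> sh.mlin \<and> contract v f = g + sgn_pow e h"
      using X Y Xv Yv by blast
  next
    fix f a p b s assume "\<exists>X Y r q. X \<in> mdpar r \<and> Y \<in> mdpar q \<and> f = wdg q X Y"
      and a: "a \<in> U p" and b: "b \<in> U s"
    then obtain X Y r q where X: "X \<in> mdpar r" and Y: "Y \<in> mdpar q" and f: "f = wdg q X Y" by blast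
    note X' = mdpar_mpar[OF X] and Y' = mdpar_mpar[OF Y]
    have ab: "a \<in> parity_shift U (p + 1)" "b \<in> parity_shift U (s + 1)" "prd a b \<in> parity_shift U (p + s + 1)"
      using a b prd_parity[OF a b] by (simp_all add: mem_shift)
    have c: "X zs \<in> carrier_of U" "Y zs \<in> carrier_of U" "a \<in> carrier_of U" "b \<in> carrier_of U" for zs
      using sh.mlin_carrier[OF mdpar_mlin[OF X]] sh.mlin_carrier[OF mdpar_mlin[OF Y]] a b carrierI by simp_all
    have Y0: "Y [] \<in> U (q + 1)" using sh.mpar_Nil[OF Y'] by (simp add: mem_shift)
    show "f [prd a b] = prd (f [a]) b + sgn_pow (p * s) (prd (f [b]) a)"
      unfolding f wdg_single[OF X' Y' ab(1)] wdg_single[OF X' Y' ab(2)] wdg_single[OF X' Y' ab(3)]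
        mder_Nil[OF mdpar_mder[OF X] a b] mder_Nil[OF mdpar_mder[OF Y] a b]
      using c by (simp add: prd_add_left prd_add_right prd_sgn_pow prd_assoc prd_carrier carrier_sgn_pow
          prd_comm[OF Y0 a] prd_comm[OF Y0 b])
        (cases p; cases s; cases q; simp)
  qed (use X Y in blast)
  then show ?thesis
    using wdg.op_mpar[OF mdpar_mpar[OF X] mdpar_mpar[OF Y]] by (simp add: mdpar_def)
qed

text \<open>In one argument, this is closure of derivations under the supercommutator, plus the
  terms with two arguments, each of which is a derivation by itself.\<close>

lemma br_mdpar:
  assumes X: "X \<in> mdpar r" and Y: "Y \<in> mdpar q" shows "sh.br r q X Y \<in> mdpar (r + q)"
proof -
  have "sh.br r q X Y \<in> mder"
  proof (rule mderI_induct[where P = "\<lambda>f. \<exists>X Y r q. X \<in> mdpar r \<and> Y \<in> mdpar q \<and> f = sh.br r q X Y"])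
    fix f v p assume "\<exists>X Y r q. X \<in> mdpar r \<and> Y \<in> mdpar q \<and> f = sh.br r q X Y" and v: "v \<in> parity_shift U p"
    then obtain X Y r q where X: "X \<in> mdpar r" and Y: "Y \<in> mdpar q" and f: "f = sh.br r q X Y" by blast
    note Xv = contract_mdpar[OF X v] and Yv = contract_mdpar[OF Y v]
    have "contract v f = sh.br r (q + p) X (contract v Y) + sgn_pow (p * q) (sh.br (r + p) q (contract v X) Y)"
      unfolding f by (rule sh.contract_br[OF mdpar_mpar[OF X] mdpar_mpar[OF Y] v])
    moreover have "sh.br r (q + p) X (contract v Y) \<in> sh.mlin" "sh.br (r + p) q (contract v X) Y \<in> sh.mlin"
      using sh.br_mpar[OF mdpar_mpar[OF X] mdpar_mpar[OF Yv]] sh.br_mpar[OF mdpar_mpar[OF Xv] mdpar_mpar[OF Y]]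
      by (simp_all add: sh.mpar_mlin)
    ultimately show "\<exists>g h e. (\<exists>X Y r q. X \<in> mdpar r \<and> Y \<in> mdpar q \<and> g = sh.br r q X Y) \<and>
        (\<exists>X Y r q. X \<in> mdpar r \<and> Y \<in> mdpar q \<and> h = sh.br r q X Y) \<and>
        g \<in> sh.mlin \<and> h \<in> sh.mlin \<and> contract v f = g + sgn_pow e h"
      using X Y Xv Yv by blast
  next
    fix f a p b s assume "\<exists>X Y r q. X \<in> mdpar r \<and> Y \<in> mdpar q \<and> f = sh.br r q X Y"
      and a: "a \<in> U p" and b: "b \<in> U s"
    then obtain X Y r q where X: "X \<in> mdpar r" and Y: "Y \<in> mdpar q" and f: "f = sh.br r q X Y" by blast
    note X' = mdpar_mpar[OF X] and Y' = mdpar_mpar[OF Y]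
    note m = mdpar_mlin[OF X] mdpar_mlin[OF Y]
    have ab: "a \<in> parity_shift U (p + 1)" "b \<in> parity_shift U (s + 1)" "prd a b \<in> parity_shift U (p + s + 1)"
      using a b prd_parity[OF a b] by (simp_all add: mem_shift)
    have c: "X zs \<in> carrier_of U" "Y zs \<in> carrier_of U" "a \<in> carrier_of U" "b \<in> carrier_of U" for zs
      using sh.mlin_carrier[OF m(1)] sh.mlin_carrier[OF m(2)] a b carrierI by simp_all
    \<comment> \<open>The mixed products of a value of \<open>P\<close> with a value of
      \<open>Q\<close> are what keeps a composite from being a derivation. They cancel against those
      of the opposite composite once the factors are commuted, with the parities recorded in
      \<open>par\<close>.\<close>
    have expand: "P [Q [prd a b]] = prd (P [Q [a]]) b + sgn_pow ((t + p) * s) (prd (P [b]) (Q [a]))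
        + sgn_pow (p * s) (prd (P [Q [b]]) a + sgn_pow ((t + s) * p) (prd (P [a]) (Q [b])))"
      if P: "P \<in> mdpar u" and Q: "Q \<in> mdpar t" for P Q u t
    proof -
      have Qa: "Q [a] \<in> U (t + p)" "Q [b] \<in> U (t + s)"
        using sh.mpar_Cons[OF mdpar_mpar[OF Q] ab(1)] sh.mpar_Cons[OF mdpar_mpar[OF Q] ab(2)]
        by (simp_all add: mem_shift ac_simps)
      note Qc = carrierI[OF Qa(1)] carrierI[OF Qa(2)]
      have "P [Q [prd a b]] = P [prd (Q [a]) b + sgn_pow (p * s) (prd (Q [b]) a)]"
        by (simp add: mder_Nil[OF mdpar_mder[OF Q] a b])
      also have "\<dots> = P [prd (Q [a]) b] + sgn_pow (p * s) (P [prd (Q [b]) a])"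
        using sh.mlin_add[OF mdpar_mlin[OF P], of "prd (Q [a]) b" "sgn_pow (p * s) (prd (Q [b]) a)" "[]" "[]"]
          sh.mlin_sgn_arg[OF mdpar_mlin[OF P], of "prd (Q [b]) a" "[]" "p * s" "[]"] Qc c
        by (simp add: prd_carrier carrier_sgn_pow)
      finally show ?thesis
        by (simp add: mder_Nil[OF mdpar_mder[OF P] Qa(1) b] mder_Nil[OF mdpar_mder[OF P] Qa(2) a])
    qed
    \<comment> \<open>\<open>mder\<close> is a condition on the last argument, so the product is
      moved behind \<open>w\<close>, differentiated there, and the order is kept on the
      right.\<close>
    have two: "P [prd a b, w] = sgn_pow ((p + s + 1) * e) (prd (sgn_pow ((p + 1) * e) (P [a, w])) b
        + sgn_pow (p * s) (prd (sgn_pow ((s + 1) * e) (P [b, w])) a))"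
      if P: "P \<in> mdpar u" and w: "w \<in> parity_shift U e" for P u w e
      using mderD[OF mdpar_mder[OF P], of "[w]" "[e]", OF _ a b] w
        sh.mlin_swap[OF mdpar_mlin[OF P] ab(1) w, of "[]" "[]"] sh.mlin_swap[OF mdpar_mlin[OF P] ab(2) w, of "[]" "[]"]
        sh.mlin_swap[OF mdpar_mlin[OF P] ab(3) w, of "[]" "[]"]
      by (simp add: sgn_pow_sgn_pow)
    have par: "X [a] \<in> U (r + p)" "X [b] \<in> U (r + s)" "Y [a] \<in> U (q + p)" "Y [b] \<in> U (q + s)"
      using sh.mpar_Cons[OF X' ab(1)] sh.mpar_Cons[OF X' ab(2)] sh.mpar_Cons[OF Y' ab(1)] sh.mpar_Cons[OF Y' ab(2)]
      by (simp_all add: mem_shift ac_simps)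
    show "f [prd a b] = prd (f [a]) b + sgn_pow (p * s) (prd (f [b]) a)"
      unfolding f sh.br_single[OF X' Y' ab(1)] sh.br_single[OF X' Y' ab(2)] sh.br_single[OF X' Y' ab(3)]
        expand[OF X Y] expand[OF Y X] two[OF X sh.mpar_Nil[OF Y']] two[OF Y sh.mpar_Nil[OF X']]
      using c by (simp add: prd_add_left prd_add_right prd_diff prd_sgn_pow prd_carrier carrier_sgn_pow carrier_diff carrier_add
          prd_comm[OF par(1) par(4)] prd_comm[OF par(2) par(3)])
        (cases p; cases s; cases q; cases r; simp add: algebra_simps)
  qed (use X Y in blast)
  then show ?thesis
    using sh.br_mpar[OF mdpar_mpar[OF X] mdpar_mpar[OF Y]] by (simp add: mdpar_def)
qed

end

section \<open>The Gerstenhaber superalgebra\<close>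

context comm_assoc_superalgebra
begin

lemma wdg_mlin: "X \<in> sh.mpar r \<Longrightarrow> Y \<in> sh.mpar q \<Longrightarrow> wdg q X Y \<in> sh.mlin"
  using wdg.op_mpar sh.mpar_mlin by blast

lemma br_mlin: "X \<in> sh.mpar r \<Longrightarrow> Y \<in> sh.mpar q \<Longrightarrow> sh.br r q X Y \<in> sh.mlin"
  using sh.br_mpar sh.mpar_mlin by blast

lemma sgn_pow_mlin: "X \<in> sh.mlin \<Longrightarrow> sgn_pow e X \<in> sh.mlin"
  by (cases e) (auto intro: sh.mlin_minus)

lemma eval_Cons_eq_contract: "f (v # vs) = contract v f vs"
  by (simp add: contract_def)

text \<open>The exponent is the product of the parities in \<open>G_parity\<close>, one off from
  \<open>a\<close> and \<open>b\<close>. In the induction step the two terms of the contraction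
  trade roles.\<close>

lemma wdg_comm_hom:
  "X \<in> sh.mpar a \<Longrightarrow> Y \<in> sh.mpar b \<Longrightarrow> sh.hom_list vs ps \<Longrightarrow>
    wdg b X Y vs = sgn_pow ((a + 1) * (b + 1)) (wdg a Y X vs)"
proof (induction vs arbitrary: X Y a b ps)
  case Nil
  then show ?case
    using prd_comm[of "X []" "a + 1" "Y []" "b + 1"] sh.mpar_Nil[OF Nil(1)] sh.mpar_Nil[OF Nil(2)]
    by (simp add: wdg_Nil sh.mpar_mlin mem_shift)
next
  case (Cons v vs)
  obtain p ps' where v: "v \<in> parity_shift U p" and vs: "sh.hom_list vs ps'"
    using Cons.prems(3) by (auto simp: list_all2_Cons1)
  note X = Cons.prems(1) and Y = Cons.prems(2)
  note Xv = sh.contract_mpar[OF X v] and Yv = sh.contract_mpar[OF Y v]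
  show ?case
    unfolding wdg.op_Cons[OF X Y v vs] wdg.op_Cons[OF Y X v vs] Cons.IH[OF X Yv vs] Cons.IH[OF Xv Y vs]
    by (cases a; cases b; cases p; simp add: add.commute)
qed

lemma wdg_comm:
  assumes X: "X \<in> sh.mpar a" and Y: "Y \<in> sh.mpar b"
  shows "wdg b X Y = sgn_pow ((a + 1) * (b + 1)) (wdg a Y X)"
  using wdg_comm_hom[OF X Y] wdg_mlin[OF X Y] wdg_mlin[OF Y X]
  by (intro sh.mlin_ext) (auto simp: sgn_pow_fun sgn_pow_mlin)

lemma wdg_triple_left:
  assumes X: "X \<in> sh.mpar a" and Y: "Y \<in> sh.mpar b" and Z: "Z \<in> sh.mpar c"
    and v: "v \<in> parity_shift U p"
  shows "wdg c (wdg b X Y) Z (v # vs) = wdg (c + p) (wdg b X Y) (contract v Z) vs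
    + sgn_pow (p * (c + 1)) (wdg c (wdg (b + p) X (contract v Y)) Z vs)
    + sgn_pow (p * (b + c)) (wdg c (wdg b (contract v X) Y) Z vs)"
proof -
  note Xv = sh.contract_mpar[OF X v] and Yv = sh.contract_mpar[OF Y v]
  have "contract v (wdg c (wdg b X Y) Z) = wdg (c + p) (wdg b X Y) (contract v Z)
    + sgn_pow (p * (c + 1)) (wdg c (wdg (b + p) X (contract v Y) + sgn_pow (p * (b + 1)) (wdg b (contract v X) Y)) Z)"
    by (simp only: wdg.contract_op[OF wdg.op_mpar[OF X Y] Z v] wdg.contract_op[OF X Y v])
  then show ?thesis
    using sh.mpar_mlin[OF Z] wdg_mlin[OF X Yv] wdg_mlin[OF Xv Y]
    by (simp add: eval_Cons_eq_contract wdg.add_left wdg.sgn_left sgn_pow_mlin sgn_pow_fun sgn_pow_add sgn_pow_sgn_pow algebra_simps)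
qed

text \<open>The outer index is the parity of the inner product, \<open>b + c + 1\<close>; it has to
  follow the contraction of \<open>Y\<close> or \<open>Z\<close>.\<close>

lemma wdg_triple_right:
  assumes X: "X \<in> sh.mpar a" and Y: "Y \<in> sh.mpar b" and Z: "Z \<in> sh.mpar c"
    and v: "v \<in> parity_shift U p"
  shows "wdg (b + c + 1) X (wdg c Y Z) (v # vs) = wdg (b + (c + p) + 1) X (wdg (c + p) Y (contract v Z)) vs
    + sgn_pow (p * (c + 1)) (wdg (b + p + c + 1) X (wdg c (contract v Y) Z) vs)
    + sgn_pow (p * (b + c)) (wdg (b + c + 1) (contract v X) (wdg c Y Z) vs)"
proof -
  note Zv = sh.contract_mpar[OF Z v] and Yv = sh.contract_mpar[OF Y v]
  have "contract v (wdg (b + c + 1) X (wdg c Y Z)) =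
    wdg (b + c + 1 + p) X (wdg (c + p) Y (contract v Z) + sgn_pow (p * (c + 1)) (wdg c (contract v Y) Z))
    + sgn_pow (p * (b + c + 1 + 1)) (wdg (b + c + 1) (contract v X) (wdg c Y Z))"
    by (simp only: wdg.contract_op[OF X wdg.op_mpar[OF Y Z] v] wdg.contract_op[OF Y Z v])
  then show ?thesis
    using sh.mpar_mlin[OF X] wdg_mlin[OF Y Zv] wdg_mlin[OF Yv Z]
    by (simp add: eval_Cons_eq_contract wdg.add_right wdg.sgn_right sgn_pow_mlin sgn_pow_fun sgn_pow_add sgn_pow_sgn_pow ac_simps)
qed

lemma wdg_assoc_hom:
  "X \<in> sh.mpar a \<Longrightarrow> Y \<in> sh.mpar b \<Longrightarrow> Z \<in> sh.mpar c \<Longrightarrow> sh.hom_list vs ps \<Longrightarrow>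
    wdg c (wdg b X Y) Z vs = wdg (b + c + 1) X (wdg c Y Z) vs"
proof (induction vs arbitrary: X Y Z a b c ps)
  case Nil
  note m = Nil(1-3)[THEN sh.mpar_mlin]
  have "X [] \<in> carrier_of U" "Y [] \<in> carrier_of U" "Z [] \<in> carrier_of U"
    using m[THEN sh.mlin_carrier] by simp_all
  then show ?case
    using m by (simp add: wdg_Nil wdg_mlin[OF Nil(1,2)] wdg_mlin[OF Nil(2,3)] prd_assoc)
next
  case (Cons v vs)
  obtain p ps' where v: "v \<in> parity_shift U p" and vs: "sh.hom_list vs ps'"
    using Cons.prems(4) by (auto simp: list_all2_Cons1)
  note X = Cons.prems(1) and Y = Cons.prems(2) and Z = Cons.prems(3)
  note Xv = sh.contract_mpar[OF X v] and Yv = sh.contract_mpar[OF Y v] and Zv = sh.contract_mpar[OF Z v]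
  show ?case
    unfolding wdg_triple_left[OF X Y Z v] wdg_triple_right[OF X Y Z v]
    by (simp only: Cons.IH[OF X Y Zv vs] Cons.IH[OF X Yv Z vs] Cons.IH[OF Xv Y Z vs])
qed

lemma wdg_assoc:
  assumes X: "X \<in> sh.mpar a" and Y: "Y \<in> sh.mpar b" and Z: "Z \<in> sh.mpar c"
  shows "wdg c (wdg b X Y) Z = wdg (b + c + 1) X (wdg c Y Z)"
  using wdg_assoc_hom[OF X Y Z] wdg_mlin[OF wdg.op_mpar[OF X Y] Z] wdg_mlin[OF X wdg.op_mpar[OF Y Z]]
  by (intro sh.mlin_ext) auto

text \<open>The derivation property of \<open>X\<close> is spent in the base case, on the product of
  \<open>Y []\<close> and \<open>Z []\<close>. It survives contraction, so \<open>X\<close> stays in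
  \<open>mdpar\<close> throughout the induction.\<close>

lemma leibniz_hom:
  "X \<in> mdpar a \<Longrightarrow> Y \<in> sh.mpar b \<Longrightarrow> Z \<in> sh.mpar c \<Longrightarrow> sh.hom_list vs ps \<Longrightarrow>
    sh.br a (b + c + 1) X (wdg c Y Z) vs
    = wdg c (sh.br a b X Y) Z vs + sgn_pow (a * (b + 1)) (wdg (a + c) Y (sh.br a c X Z) vs)"
proof (induction vs arbitrary: X Y Z a b c ps)
  case Nil
  note X = mdpar_mpar[OF Nil(1)] and Y = Nil(2) and Z = Nil(3)
  note m = X[THEN sh.mpar_mlin] Y[THEN sh.mpar_mlin] Z[THEN sh.mpar_mlin]
  have c: "X zs \<in> carrier_of U" "Y zs \<in> carrier_of U" "Z zs \<in> carrier_of U" for zs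
    using m[THEN sh.mlin_carrier] by simp_all
  have par: "Y [] \<in> U (b + 1)" "Z [] \<in> U (c + 1)" "X [Z []] \<in> U (a + c + 1)"
    using sh.mpar_Nil[OF Y] sh.mpar_Nil[OF Z] sh.mpar_Cons[OF X sh.mpar_Nil[OF Z]] by (simp_all add: mem_shift)
  \<comment> \<open>The derivation rule leaves \<open>X [Z []]\<close> to the left of
    \<open>Y []\<close>, while the concatenation of \<open>Y\<close> with the bracket has it on the
    right; commutativity reconciles the two.\<close>
  show ?case
    using m c
    by (simp add: sh.br_Nil wdg_Nil wdg_mlin[OF Y Z] br_mlin[OF X Y] br_mlin[OF X Z] wdg_single[OF Y Z sh.mpar_Nil[OF X]]
        mder_Nil[OF mdpar_mder[OF Nil(1)] par(1,2)] prd_diff prd_sgn_pow carrier_sgn_pow prd_comm[OF par(3) par(1)])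
      (cases a; cases b; cases c; simp)
next
  case (Cons v vs)
  obtain p ps' where v: "v \<in> parity_shift U p" and vs: "sh.hom_list vs ps'"
    using Cons.prems(4) by (auto simp: list_all2_Cons1)
  note X = mdpar_mpar[OF Cons.prems(1)] and Y = Cons.prems(2) and Z = Cons.prems(3)
  note Xv = sh.contract_mpar[OF X v] and Yv = sh.contract_mpar[OF Y v] and Zv = sh.contract_mpar[OF Z v]
  note m = X[THEN sh.mpar_mlin] Y[THEN sh.mpar_mlin] Z[THEN sh.mpar_mlin]
  have L: "sh.br a (b + c + 1) X (wdg c Y Z) (v # vs) = sh.br a (b + (c + p) + 1) X (wdg (c + p) Y (contract v Z)) vs
      + sgn_pow (p * (c + 1)) (sh.br a (b + p + c + 1) X (wdg c (contract v Y) Z) vs)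
      + sgn_pow (p * (b + c + 1)) (sh.br (a + p) (b + c + 1) (contract v X) (wdg c Y Z) vs)"
  proof -
    have "contract v (sh.br a (b + c + 1) X (wdg c Y Z)) =
        sh.br a (b + c + 1 + p) X (wdg (c + p) Y (contract v Z) + sgn_pow (p * (c + 1)) (wdg c (contract v Y) Z))
        + sgn_pow (p * (b + c + 1)) (sh.br (a + p) (b + c + 1) (contract v X) (wdg c Y Z))"
      by (simp only: sh.contract_br[OF X wdg.op_mpar[OF Y Z] v] wdg.contract_op[OF Y Z v])
    then show ?thesis
      using m wdg_mlin[OF Y Zv] wdg_mlin[OF Yv Z]
      by (simp add: eval_Cons_eq_contract sh.br_add_right sh.br_sgn_right sgn_pow_mlin sgn_pow_fun ac_simps)
  qed
  have R: "wdg c (sh.br a b X Y) Z (v # vs) = wdg (c + p) (sh.br a b X Y) (contract v Z) vs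
      + sgn_pow (p * (c + 1)) (wdg c (sh.br a (b + p) X (contract v Y)) Z vs)
      + sgn_pow (p * (b + c + 1)) (wdg c (sh.br (a + p) b (contract v X) Y) Z vs)"
  proof -
    have "contract v (wdg c (sh.br a b X Y) Z) = wdg (c + p) (sh.br a b X Y) (contract v Z)
        + sgn_pow (p * (c + 1)) (wdg c (sh.br a (b + p) X (contract v Y) + sgn_pow (p * b) (sh.br (a + p) b (contract v X) Y)) Z)"
      by (simp only: wdg.contract_op[OF sh.br_mpar[OF X Y] Z v] sh.contract_br[OF X Y v])
    then show ?thesis
      using m br_mlin[OF X Yv] br_mlin[OF Xv Y]
      by (simp add: eval_Cons_eq_contract wdg.add_left wdg.sgn_left sgn_pow_mlin sgn_pow_fun sgn_pow_add sgn_pow_sgn_pow algebra_simps)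
  qed
  have T: "wdg (a + c) Y (sh.br a c X Z) (v # vs) = wdg (a + (c + p)) Y (sh.br a (c + p) X (contract v Z)) vs
      + sgn_pow (p * c) (wdg (a + p + c) Y (sh.br (a + p) c (contract v X) Z) vs)
      + sgn_pow (p * (a + c + 1)) (wdg (a + c) (contract v Y) (sh.br a c X Z) vs)"
  proof -
    have "contract v (wdg (a + c) Y (sh.br a c X Z)) =
        wdg (a + c + p) Y (sh.br a (c + p) X (contract v Z) + sgn_pow (p * c) (sh.br (a + p) c (contract v X) Z))
        + sgn_pow (p * (a + c + 1)) (wdg (a + c) (contract v Y) (sh.br a c X Z))"
      by (simp only: wdg.contract_op[OF Y sh.br_mpar[OF X Z] v] sh.contract_br[OF X Z v])
    then show ?thesis
      using m br_mlin[OF X Zv] br_mlin[OF Xv Z]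
      by (simp add: eval_Cons_eq_contract wdg.add_right wdg.sgn_right sgn_pow_mlin sgn_pow_fun ac_simps)
  qed
  have signs: "L1 + sgn_pow (p * (c + 1)) L2 + sgn_pow (p * (b + c + 1)) L3
      = R1 + sgn_pow (p * (c + 1)) R2 + sgn_pow (p * (b + c + 1)) R3
        + sgn_pow (a * (b + 1)) (T1 + sgn_pow (p * c) T3 + sgn_pow (p * (a + c + 1)) T2)"
    if "L1 = R1 + sgn_pow (a * (b + 1)) T1" "L2 = R2 + sgn_pow (a * (b + p + 1)) T2"
      "L3 = R3 + sgn_pow ((a + p) * (b + 1)) T3" for L1 L2 L3 R1 R2 R3 T1 T2 T3 :: 'b
    unfolding that by (cases a; cases b; cases c; cases p; simp)
  show ?case
    unfolding L R T
    by (rule signs[OF Cons.IH[OF Cons.prems(1) Y Zv vs] Cons.IH[OF Cons.prems(1) Yv Z vs]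
          Cons.IH[OF contract_mdpar[OF Cons.prems(1) v] Y Z vs]])
qed

lemma leibniz_wdg:
  assumes X: "X \<in> mdpar a" and Y: "Y \<in> sh.mpar b" and Z: "Z \<in> sh.mpar c"
  shows "sh.br a (b + c + 1) X (wdg c Y Z)
    = wdg c (sh.br a b X Y) Z + sgn_pow (a * (b + 1)) (wdg (a + c) Y (sh.br a c X Z))"
proof (rule sh.mlin_ext)
  note X' = mdpar_mpar[OF X]
  show "sh.br a (b + c + 1) X (wdg c Y Z) \<in> sh.mlin"
    by (rule br_mlin[OF X' wdg.op_mpar[OF Y Z]])
  show "wdg c (sh.br a b X Y) Z + sgn_pow (a * (b + 1)) (wdg (a + c) Y (sh.br a c X Z)) \<in> sh.mlin"
    by (intro sh.mlin_plus sgn_pow_mlin wdg_mlin[OF sh.br_mpar[OF X' Y] Z] wdg_mlin[OF Y sh.br_mpar[OF X' Z]])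
qed (use leibniz_hom[OF X Y Z] in \<open>simp add: sgn_pow_fun\<close>)

section \<open>The full prolongation as the space of multiderivations\<close>

lemma mder_0 [simp]: "0 \<in> mder"
  unfolding mder_def using carrierI by auto

lemma mder_plus:
  assumes "f \<in> mder" "g \<in> mder" "f \<in> sh.mlin" "g \<in> sh.mlin" shows "f + g \<in> mder"
  unfolding mder_def
proof (intro CollectI allI impI, elim conjE)
  fix xs ps a p b q assume h: "sh.hom_list xs ps" "a \<in> U p" "b \<in> U q"
  have "f zs \<in> carrier_of U" "g zs \<in> carrier_of U" for zs
    using assms(3,4)[THEN sh.mlin_carrier] by simp_all
  then show "(f + g) (xs @ [prd a b]) = prd ((f + g) (xs @ [a])) b + sgn_pow (p * q) (prd ((f + g) (xs @ [b])) a)"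
    using mderD[OF assms(1) h] mderD[OF assms(2) h] carrierI[OF h(2)] carrierI[OF h(3)]
    by (simp add: prd_add_left sgn_pow_add)
qed

lemma mder_fscale:
  assumes "f \<in> mder" "f \<in> sh.mlin" shows "fscale scale r f \<in> mder"
  unfolding mder_def
proof (intro CollectI allI impI, elim conjE)
  fix xs ps a p b q assume h: "sh.hom_list xs ps" "a \<in> U p" "b \<in> U q"
  have "f zs \<in> carrier_of U" for zs
    using assms(2)[THEN sh.mlin_carrier] by simp
  then show "fscale scale r f (xs @ [prd a b])
      = prd (fscale scale r f (xs @ [a])) b + sgn_pow (p * q) (prd (fscale scale r f (xs @ [b])) a)"
    using mderD[OF assms(1) h] carrierI[OF h(2)] carrierI[OF h(3)]
    by (simp add: fscale_def prd_scale_left sgn_pow_scale scale_right_distrib)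
qed

lemma mder_restrict:
  assumes f: "f \<in> mder" shows "restrict_arity k f \<in> mder"
  unfolding mder_def
proof (intro CollectI allI impI, elim conjE)
  fix xs ps a p b q assume h: "sh.hom_list xs ps" "a \<in> U p" "b \<in> U q"
  then show "restrict_arity k f (xs @ [prd a b])
      = prd (restrict_arity k f (xs @ [a])) b + sgn_pow (p * q) (prd (restrict_arity k f (xs @ [b])) a)"
    using mderD[OF f h] carrierI[OF h(2)] carrierI[OF h(3)] by (simp add: restrict_arity_def)
qed

lemma hcomp_prd:
  assumes x: "x \<in> carrier_of U" and b: "b \<in> U s"
  shows "hcomp U (r + s) (prd x b) = prd (hcomp U r x) b"
proof (rule hcomp_eqI)
  show "prd (hcomp U r x) b \<in> U (r + s)" by (rule prd_parity[OF hcomp_mem[OF x] b])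
  have "prd x b - prd (hcomp U r x) b = prd (hcomp U (r + 1) x) b"
    using x carrierI[OF b] by (simp add: hcomp_compl[symmetric] prd_diff hcomp_carrier)
  then show "prd x b - prd (hcomp U r x) b \<in> U (r + s + 1)"
    using prd_parity[OF hcomp_mem[OF x] b, of "r + 1"] by (simp add: ac_simps)
qed

lemma hcomp_shift: "hcomp (parity_shift U) r x = hcomp U (r + 1) x"
  by (simp add: hcomp_def mem_shift)

text \<open>The derivation identity is projected onto a single parity; by \<open>hcomp_prd\<close>,
  multiplication by a homogeneous element commutes with the projection up to a shift of its
  index.\<close>

lemma mder_parity_part:
  assumes f: "f \<in> sh.mlin" "f \<in> mder" shows "sh.parity_part r f \<in> mder"
  unfolding mder_def
proof (intro CollectI allI impI, elim conjE)
  fix xs ps a p b q assume h: "sh.hom_list xs ps" "a \<in> U p" "b \<in> U q"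
  define t where "t = r + sum_list ps"
  have c: "f zs \<in> carrier_of U" for zs
    using f(1)[THEN sh.mlin_carrier] by simp
  have hom: "sh.hom_list (xs @ [w]) (ps @ [e + 1])" if "w \<in> U e" for w e
    using h(1) that by (simp add: list_all2_appendI mem_shift)
  \<comment> \<open>The shift in the parity of the last argument and the shift in that of the value
    cancel.\<close>
  have val: "sh.parity_part r f (xs @ [w]) = hcomp U (t + e) (f (xs @ [w]))" if "w \<in> U e" for w e
    using sh.parity_part_hom[OF f(1) hom[OF that], of r] by (simp add: hcomp_shift t_def ac_simps)
  have "hcomp U (t + (p + q)) (f (xs @ [prd a b]))
    = hcomp U (t + p + q) (prd (f (xs @ [a])) b) + sgn_pow (p * q) (hcomp U (t + q + p) (prd (f (xs @ [b])) a))"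
    using c carrierI[OF h(2)] carrierI[OF h(3)]
    by (simp add: mderD[OF f(2) h] hcomp_add hcomp_sgn_pow prd_carrier carrier_sgn_pow ac_simps)
  then show "sh.parity_part r f (xs @ [prd a b])
      = prd (sh.parity_part r f (xs @ [a])) b + sgn_pow (p * q) (prd (sh.parity_part r f (xs @ [b])) a)"
    by (simp only: val[OF h(2)] val[OF h(3)] val[OF prd_parity[OF h(2,3)]] hcomp_prd[OF c h(2)] hcomp_prd[OF c h(3)])
qed

text \<open>Brackets with constants are contractions, so the defining condition says that all
  contractions of \<open>X\<close> are multiderivations. As \<open>X\<close> has at least two
  arguments, there is always a leading one to contract before the last is tested.\<close>

lemma W_as_Suc_Suc:
  assumes IH: "W_as scale U prd (Suc n) = {f \<in> sh.mlin \<inter> mder. arity_in {Suc n} f}"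
  shows "W_as scale U prd (Suc (Suc n)) = {f \<in> sh.mlin \<inter> mder. arity_in {Suc (Suc n)} f}"
proof -
  have "(\<forall>Y\<in>hom_sym scale (parity_shift U) 0. W_bracket scale (parity_shift U) X Y \<in> W_as scale U prd (Suc n))
    \<longleftrightarrow> X \<in> mder" if X: "X \<in> sh.mlin" "arity_in {Suc (Suc n)} X" for X
  proof
    assume L: "\<forall>Y\<in>hom_sym scale (parity_shift U) 0. W_bracket scale (parity_shift U) X Y \<in> W_as scale U prd (Suc n)"
    have contr: "contract v X \<in> mder" if "v \<in> carrier_of U" for v
    proof -
      \<comment> \<open>The vector \<open>v\<close> as an element of degree -1.\<close>
      define Y where "Y = (\<lambda>vs :: 'b list. if vs = [] then v else 0)"
      have "Y \<in> sh.mlin" unfolding sh.mlin_def Y_def using that by auto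
      moreover have "arity_in {0} Y" by (simp add: Y_def arity_in_def)
      moreover from calculation have "Y \<in> hom_sym scale (parity_shift U) 0" by (simp add: sh.hom_sym_iff)
      with L IH have "W_bracket scale (parity_shift U) X Y \<in> mder" by blast
      ultimately show ?thesis
        using sh.W_bracket_arity_0[OF X(1) fin_arity_single[OF X(2)], of Y] by (simp add: Y_def)
    qed
    show "X \<in> mder" unfolding mder_def
    proof (intro CollectI allI impI, elim conjE)
      fix xs ps a p b q assume h: "sh.hom_list xs ps" "a \<in> U p" "b \<in> U q"
      show "X (xs @ [prd a b]) = prd (X (xs @ [a])) b + sgn_pow (p * q) (prd (X (xs @ [b])) a)"
      proof (cases xs)
        case Nil
        then have "X (xs @ [w]) = 0" for w using X(2) by (auto simp: arity_in_def)
        then show ?thesis using carrierI[OF h(2)] carrierI[OF h(3)] by simp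
      next
        case (Cons v ys)
        then obtain e es where v: "v \<in> parity_shift U e" and ys: "sh.hom_list ys es"
          using h(1) by (auto simp: list_all2_Cons1)
        have "contract v X \<in> mder" using contr sh.carrierI[OF v] by simp
        from mderD[OF this ys h(2,3)] show ?thesis by (simp add: contract_def Cons)
      qed
    qed
  next
    assume D: "X \<in> mder"
    show "\<forall>Y\<in>hom_sym scale (parity_shift U) 0. W_bracket scale (parity_shift U) X Y \<in> W_as scale U prd (Suc n)"
    proof
      fix Y assume "Y \<in> hom_sym scale (parity_shift U) 0"
      then have Y: "Y \<in> sh.mlin" "arity_in {0} Y" by (auto simp: sh.hom_sym_iff)
      have eq: "W_bracket scale (parity_shift U) X Y = contract (Y []) X"
        by (rule sh.W_bracket_arity_0[OF X(1) fin_arity_single[OF X(2)] Y])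
      have y: "Y [] \<in> carrier_of (parity_shift U)" by (rule sh.mlin_carrier[OF Y(1)])
      note yp = sh.hcomp_mem[OF y]
      have m: "contract (hcomp (parity_shift U) p (Y [])) X \<in> sh.mlin" for p
        by (rule sh.contract_mlin[OF X(1) sh.hcomp_carrier[OF y]])
      \<comment> \<open>\<open>contract_mder\<close> speaks of a homogeneous vector, so
        \<open>Y []\<close> is decomposed.\<close>
      have "contract (Y []) X = contract (hcomp (parity_shift U) 0 (Y [])) X + contract (hcomp (parity_shift U) 1 (Y [])) X"
        by (subst sh.contract_add[symmetric, OF X(1) sh.hcomp_carrier[OF y] sh.hcomp_carrier[OF y]])
          (simp only: sh.hcomp_decomp[OF y])
      then have "contract (Y []) X \<in> mder"
        using mder_plus[OF contract_mder[OF D yp] contract_mder[OF D yp] m m, of 0 1] by simp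
      moreover have "contract (Y []) X \<in> sh.mlin" by (rule sh.contract_mlin[OF X(1) y])
      moreover have "arity_in {Suc n} (contract (Y []) X)"
        using X(2) by (auto simp: arity_in_def contract_def)
      ultimately show "W_bracket scale (parity_shift U) X Y \<in> W_as scale U prd (Suc n)"
        using IH eq by simp
    qed
  qed
  then show ?thesis by (auto simp: sh.hom_sym_iff)
qed

text \<open>In arity 0 both sides of the derivation identity vanish, since it concerns nonempty
  lists; in arity 1 the identity with no preceding arguments is the definition of
  \<open>der\<close>.\<close>

lemma W_as_eq: "W_as scale U prd n = {f \<in> sh.mlin \<inter> mder. arity_in {n} f}"
proof (cases n)
  case 0
  have "f \<in> mder" if "arity_in {0} f" for f
    unfolding mder_def
  proof (intro CollectI allI impI, elim conjE)
    fix xs ps a p b q assume h: "sh.hom_list xs ps" "a \<in> U p" "b \<in> U q"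
    have "f (xs @ [w]) = 0" for w using that by (auto simp: arity_in_def)
    then show "f (xs @ [prd a b]) = prd (f (xs @ [a])) b + sgn_pow (p * q) (prd (f (xs @ [b])) a)"
      using carrierI[OF h(2)] carrierI[OF h(3)] by simp
  qed
  then show ?thesis using 0 by (auto simp: sh.hom_sym_iff)
next
  case (Suc m)
  have "W_as scale U prd (Suc m) = {f \<in> sh.mlin \<inter> mder. arity_in {Suc m} f}"
  proof (induction m)
    case 0
    have "f \<in> mder" if f: "arity_in {Suc 0} f" and d: "\<forall>p q. \<forall>a\<in>U p. \<forall>b\<in>U q.
        f [prd a b] = prd (f [a]) b + sgn_pow (p * q) (prd (f [b]) a)" for f
      unfolding mder_def
    proof (intro CollectI allI impI, elim conjE)
      fix xs ps a p b q assume h: "sh.hom_list xs ps" "a \<in> U p" "b \<in> U q"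
      show "f (xs @ [prd a b]) = prd (f (xs @ [a])) b + sgn_pow (p * q) (prd (f (xs @ [b])) a)"
      proof (cases xs)
        case Nil then show ?thesis using d h by simp
      next
        case (Cons x ys)
        then have "f (xs @ [w]) = 0" for w using f by (auto simp: arity_in_def)
        then show ?thesis using carrierI[OF h(2)] carrierI[OF h(3)] by simp
      qed
    qed
    moreover have "\<forall>p q. \<forall>a\<in>U p. \<forall>b\<in>U q. f [prd a b] = prd (f [a]) b + sgn_pow (p * q) (prd (f [b]) a)"
      if "f \<in> mder" for f using mder_Nil[OF that] by blast
    ultimately show ?case
      unfolding W_as.simps der_def sh.hom_sym_iff One_nat_def by blast
  qed (rule W_as_Suc_Suc)
  then show ?thesis using Suc by simp
qed

lemma sum_of_family_W_as: "sum_of_family (W_as scale U prd) = {f \<in> sh.mlin \<inter> mder. fin_arity f}"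
proof -
  have "W_as scale U prd = (\<lambda>n. {f \<in> sh.mlin \<inter> mder. arity_in {n} f})"
    using W_as_eq by (rule ext)
  then show ?thesis
    using sum_of_family_arity[of "sh.mlin \<inter> mder"] by (simp add: sh.mlin_plus mder_plus sh.restrict_mlin mder_restrict)
qed

lemma W_as_parity_eq: "W_as_parity scale U prd q = {f \<in> mdpar q. fin_arity f}"
  unfolding W_as_parity_def sum_of_family_W_as mdpar_def sh.mpar_def by blast

lemma superspace_W_as: "superspace (fscale scale) (W_as_parity scale U prd)"
proof -
  have "superspace (fscale scale) (\<lambda>q. {f \<in> sh.mpar q. f \<in> sh.mlin \<inter> mder \<and> fin_arity f})"
    by (rule sh.superspace_mpar) (auto intro: sh.mlin_plus mder_plus sh.mlin_fscale mder_fscale)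
  moreover have "W_as_parity scale U prd = (\<lambda>q. {f \<in> sh.mpar q. f \<in> sh.mlin \<inter> mder \<and> fin_arity f})"
    using W_as_parity_eq sh.mpar_mlin unfolding mdpar_def by fastforce
  ultimately show ?thesis by simp
qed

lemma carrier_W_as: "carrier_of (W_as_parity scale U prd) = {f \<in> sh.mlin \<inter> mder. fin_arity f}"
proof (intro equalityI subsetI)
  fix f assume "f \<in> carrier_of (W_as_parity scale U prd)"
  then show "f \<in> {f \<in> sh.mlin \<inter> mder. fin_arity f}"
    unfolding carrier_of_def W_as_parity_eq
    by (auto intro: sh.mlin_plus mder_plus fin_arity_add dest: mdpar_mlin mdpar_mder)
next
  fix f assume f: "f \<in> {f \<in> sh.mlin \<inter> mder. fin_arity f}"
  then have "sh.parity_part q f \<in> W_as_parity scale U prd q" for q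
    by (simp add: W_as_parity_eq mdpar_def sh.parity_part_mpar mder_parity_part sh.parity_part_fin_arity)
  moreover have "f = sh.parity_part 0 f + sh.parity_part 1 f" using f by (simp add: sh.parity_part_decomp)
  ultimately show "f \<in> carrier_of (W_as_parity scale U prd)"
    unfolding carrier_of_def by blast
qed

section \<open>The Gerstenhaber superspace and its operations\<close>

lemma G_parity_eq: "G_parity scale U prd q = {f \<in> mdpar (q + 1). fin_arity f}"
  by (simp add: G_parity_def parity_shift_def W_as_parity_eq)

lemma parity_shift_G: "parity_shift (G_parity scale U prd) = W_as_parity scale U prd"
  by (simp add: G_parity_def parity_shift_def fun_eq_iff)

lemma superspace_G: "superspace (fscale scale) (G_parity scale U prd)"
  unfolding G_parity_def by (rule superspace.superspace_shift[OF superspace_W_as])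

lemma carrier_G: "carrier_of (G_parity scale U prd) = {f \<in> sh.mlin \<inter> mder. fin_arity f}"
  unfolding G_parity_def superspace.carrier_of_parity_shift[OF superspace_W_as] carrier_W_as ..

interpretation G: superspace "fscale scale" "G_parity scale U prd"
  by (rule superspace_G)

lemma carrier_W_as_W: "f \<in> sh.mlin \<Longrightarrow> fin_arity f \<Longrightarrow> f \<in> carrier_of (W_parity scale (parity_shift U))"
proof -
  assume f: "f \<in> sh.mlin" "fin_arity f"
  then have "sh.parity_part q f \<in> W_parity scale (parity_shift U) q" for q
    by (simp add: sh.W_parity_eq sh.parity_part_mpar sh.parity_part_fin_arity)
  moreover have "f = sh.parity_part 0 f + sh.parity_part 1 f" using f by (simp add: sh.parity_part_decomp)
  ultimately show "f \<in> carrier_of (W_parity scale (parity_shift U))"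
    unfolding carrier_of_def by blast
qed

lemma hcomp_G:
  assumes "f \<in> carrier_of (G_parity scale U prd)"
  shows "hcomp (G_parity scale U prd) q f = sh.parity_part (q + 1) f"
proof (rule G.hcomp_eqI)
  have f: "f \<in> sh.mlin" "f \<in> mder" "fin_arity f" using assms by (simp_all add: carrier_G)
  then show "sh.parity_part (q + 1) f \<in> G_parity scale U prd q"
    by (simp add: G_parity_eq mdpar_def sh.parity_part_mpar mder_parity_part sh.parity_part_fin_arity)
  have "f - sh.parity_part (q + 1) f = sh.parity_part q f"
    using sh.parity_part_decomp[OF f(1)] by (cases q) (auto simp: algebra_simps)
  then show "f - sh.parity_part (q + 1) f \<in> G_parity scale U prd (q + 1)"
    using f by (simp add: G_parity_eq mdpar_def sh.parity_part_mpar mder_parity_part sh.parity_part_fin_arity)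
qed

text \<open>\<open>q\<close> is a parity in \<open>G_parity\<close>, while \<open>wdg\<close> is
  indexed by the parity of the map on the shifted superspace; hence \<open>q + 1\<close>.\<close>

lemma wedge_eq:
  "wedge scale U prd X Y = (\<Sum>q\<in>{0, 1}. wdg (q + 1) X (hcomp (G_parity scale U prd) q Y))"
  unfolding wedge_def Let_def
proof (rule sum.cong[OF refl])
  fix q :: bit
  define Z where "Z = hcomp (G_parity scale U prd) q Y"
  have "multilin_ext (parity_shift U) (\<lambda>ps as. \<Sum>h\<le>length as. \<Sum>\<sigma>\<in>shuffle_perms h (length as).
      sgn_pow (interchanges ps \<sigma> + q * (\<Sum>i<h. ps ! \<sigma> i))
        (prd (X (map (\<lambda>i. as ! \<sigma> i) [0..<h])) (Z (map (\<lambda>i. as ! \<sigma> i) [h..<length as])))) vs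
    = wdg (q + 1) X Z vs" for vs
    unfolding wdg_def
  proof (rule multilin_ext_cong)
    fix ps :: "bit list" and ws :: "'b list"
    assume len: "length ps = length vs" "length ws = length vs"
    \<comment> \<open>\<open>sum_shuffles\<close> needs a summand that depends on the list of
      selected indices, so the sum over positions is rewritten as one over that list.\<close>
    have sl: "(\<Sum>i<h. ps ! \<sigma> i) = sum_list (map ((!) ps) (map \<sigma> [0..<h]))" for h \<sigma>
      by (simp add: sum_list_distinct_conv_sum_set comp_def atLeast0LessThan)
    have "(\<Sum>h\<le>length ws. \<Sum>\<sigma>\<in>shuffle_perms h (length ws).
        sgn_pow (interchanges ps \<sigma> + q * (\<Sum>i<h. ps ! \<sigma> i))
          (prd (X (map (\<lambda>i. ws ! \<sigma> i) [0..<h])) (Z (map (\<lambda>i. ws ! \<sigma> i) [h..<length ws]))))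
      = (\<Sum>S\<in>Pow {..<length ws}. sgn_pow (cross ps S + q * sum_list (map ((!) ps) (select (length ws) S)))
          (prd (X (map ((!) ws) (select (length ws) S))) (Z (map ((!) ws) (select (length ws) (- S))))))"
      using sum_shuffles[of ps "length ws" "\<lambda>e I J. sgn_pow (e + q * sum_list (map ((!) ps) I))
          (prd (X (map ((!) ws) I)) (Z (map ((!) ws) J)))"] len
      unfolding sl by (simp add: comp_def)
    then show "(\<Sum>h\<le>length ws. \<Sum>\<sigma>\<in>shuffle_perms h (length ws).
        sgn_pow (interchanges ps \<sigma> + q * (\<Sum>i<h. ps ! \<sigma> i))
          (prd (X (map (\<lambda>i. ws ! \<sigma> i) [0..<h])) (Z (map (\<lambda>i. ws ! \<sigma> i) [h..<length ws]))))
      = wdg_form (q + 1) X Z ps ws"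
      using len by (simp add: wdg_form_def nths_eq_map_select)
  qed
  from ext[of _ "wdg (q + 1) X Z", OF this]
  show "multilin_ext (parity_shift U) (\<lambda>ps as. \<Sum>h\<le>length as. \<Sum>\<sigma>\<in>shuffle_perms h (length as).
      sgn_pow (interchanges ps \<sigma> + q * (\<Sum>i<h. ps ! \<sigma> i))
        (prd (X (map (\<lambda>i. as ! \<sigma> i) [0..<h])) (hcomp (G_parity scale U prd) q Y (map (\<lambda>i. as ! \<sigma> i) [h..<length as]))))
    = wdg (q + 1) X (hcomp (G_parity scale U prd) q Y)"
    unfolding Z_def .
qed

lemma wdg_0 [simp]: "X \<in> sh.mlin \<Longrightarrow> wdg q X 0 = 0"
  using wdg_add_right[of X 0 0 q] by simp

lemma G_mlin: "X \<in> carrier_of (G_parity scale U prd) \<Longrightarrow> X \<in> sh.mlin"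
  by (simp add: carrier_G)

lemma G_hcomp_mlin: "X \<in> carrier_of (G_parity scale U prd) \<Longrightarrow> hcomp (G_parity scale U prd) p X \<in> sh.mlin"
  using G.hcomp_carrier G_mlin by blast

lemma wedge_hom:
  assumes X: "X \<in> carrier_of (G_parity scale U prd)" and Y: "Y \<in> G_parity scale U prd q"
  shows "wedge scale U prd X Y = wdg (q + 1) X Y"
  unfolding wedge_eq G.hcomp_homogeneous[OF Y]
  using G_mlin[OF X] by (cases q; simp)

lemma wdg_fin_arity:
  assumes "X \<in> sh.mlin" "fin_arity X" "Y \<in> sh.mlin" "fin_arity Y"
  shows "fin_arity (wdg q X Y)"
proof -
  obtain H K where HK: "finite H" "arity_in H X" "finite K" "arity_in K Y"
    using assms(2,4) unfolding fin_arity_def by blast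
  have "arity_in {n. \<exists>h\<in>H. \<exists>k\<in>K. n = h + k} (wdg q X Y)"
    by (rule wdg_arity[OF assms(1) HK(2) assms(3) HK(4)])
  moreover have "{n. \<exists>h\<in>H. \<exists>k\<in>K. n = h + k} = (\<lambda>(h, k). h + k) ` (H \<times> K)" by auto
  ultimately show ?thesis
    unfolding fin_arity_def using HK(1,3) by (metis finite_SigmaI finite_imageI)
qed

lemma br_fin_arity:
  assumes "X \<in> sh.mlin" "fin_arity X" "Y \<in> sh.mlin" "fin_arity Y"
  shows "fin_arity (sh.br p q X Y)"
proof -
  obtain H K where HK: "finite H" "arity_in H X" "finite K" "arity_in K Y"
    using assms(2,4) unfolding fin_arity_def by blast
  \<comment> \<open>Truncated subtraction sends the pair \<open>(0, 0)\<close> to a spurious arity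
    0; a finite superset of the arities is enough here.\<close>
  have "arity_in ((\<lambda>(h, k). h + k - 1) ` (H \<times> K)) (box (parity_shift U) X Y)"
    by (rule arity_in_mono[OF sh.box_arity[OF assms(1) HK(2,4)]]) force
  moreover have "arity_in ((\<lambda>(h, k). h + k - 1) ` (H \<times> K)) (box (parity_shift U) Y X)"
    by (rule arity_in_mono[OF sh.box_arity[OF assms(3) HK(4,2)]]) force
  ultimately have "fin_arity (box (parity_shift U) X Y)" "fin_arity (box (parity_shift U) Y X)"
    unfolding fin_arity_def using HK(1,3) by (metis finite_SigmaI finite_imageI)+
  then have "fin_arity (box (parity_shift U) X Y + - sgn_pow (p * q) (box (parity_shift U) Y X))"
    unfolding sgn_pow_def by (intro fin_arity_add fin_arity_minus) (simp_all add: fin_arity_minus)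
  then show ?thesis by (simp add: sh.br_def)
qed

lemma superalgebra_wedge:
  "superalgebra (fscale scale) (G_parity scale U prd) (wedge scale U prd)"
proof
  fix X Y p q assume X: "X \<in> G_parity scale U prd p" and Y: "Y \<in> G_parity scale U prd q"
  have "wdg (q + 1) X Y \<in> mdpar (p + 1 + (q + 1) + 1)"
    using X Y by (intro wdg_mdpar) (simp_all add: G_parity_eq)
  moreover have "fin_arity (wdg (q + 1) X Y)"
    using X Y by (intro wdg_fin_arity) (auto simp: G_parity_eq dest: mdpar_mlin)
  ultimately show "wedge scale U prd X Y \<in> G_parity scale U prd (p + q)"
    using wedge_hom[OF G.carrierI[OF X] Y] by (simp add: G_parity_eq ac_simps)
qed (simp_all add: wedge_eq wdg_add_left wdg_add_right wdg_scale G_mlin G_hcomp_mlin sum.distrib G.hcomp_add G.hcomp_scale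
    G.scale_right_distrib)

lemma comm_assoc_wedge:
  "comm_assoc_superalgebra (fscale scale) (G_parity scale U prd) (wedge scale U prd)"
proof -
  interpret GW: superalgebra "fscale scale" "G_parity scale U prd" "wedge scale U prd"
    by (rule superalgebra_wedge)
  show ?thesis
  proof
    fix X Y p q assume X: "X \<in> G_parity scale U prd p" and Y: "Y \<in> G_parity scale U prd q"
    then have "X \<in> sh.mpar (p + 1)" "Y \<in> sh.mpar (q + 1)" by (auto simp: G_parity_eq mdpar_mpar)
    from wdg_comm[OF this] show "wedge scale U prd X Y = sgn_pow (p * q) (wedge scale U prd Y X)"
      by (simp add: wedge_hom[OF G.carrierI[OF X] Y] wedge_hom[OF G.carrierI[OF Y] X])
  next
    fix X Y Z assume X: "X \<in> carrier_of (G_parity scale U prd)"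
      and Y: "Y \<in> carrier_of (G_parity scale U prd)" and Z: "Z \<in> carrier_of (G_parity scale U prd)"
    have hom: "wedge scale U prd (wedge scale U prd X Y) Z = wedge scale U prd X (wedge scale U prd Y Z)"
      if X: "X \<in> G_parity scale U prd p" and Y: "Y \<in> G_parity scale U prd q" and Z: "Z \<in> G_parity scale U prd r"
      for X Y Z p q r
    proof -
      have "X \<in> sh.mpar (p + 1)" "Y \<in> sh.mpar (q + 1)" "Z \<in> sh.mpar (r + 1)"
        using X Y Z by (auto simp: G_parity_eq mdpar_mpar)
      note a = wdg_assoc[OF this]
      have "wedge scale U prd (wedge scale U prd X Y) Z = wdg (r + 1) (wdg (q + 1) X Y) Z"
        using wedge_hom[OF G.carrierI[OF GW.prd_parity[OF X Y]] Z] wedge_hom[OF G.carrierI[OF X] Y] by simp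
      moreover have "wedge scale U prd X (wedge scale U prd Y Z) = wdg (q + r + 1) X (wdg (r + 1) Y Z)"
        using wedge_hom[OF G.carrierI[OF X] GW.prd_parity[OF Y Z]] wedge_hom[OF G.carrierI[OF Y] Z] by simp
      moreover have "q + 1 + (r + 1) + 1 = q + r + 1" by (cases q; cases r; simp)
      ultimately show ?thesis using a by simp
    qed
    \<comment> \<open>Associativity passes from homogeneous to arbitrary elements one factor at a
      time, beginning with the last.\<close>
    have 1: "wedge scale U prd (wedge scale U prd X Y) Z = wedge scale U prd X (wedge scale U prd Y Z)"
      if X: "X \<in> G_parity scale U prd p" and Y: "Y \<in> G_parity scale U prd q" for X Y p q
      using Z
      by (induction rule: G.carrier_induct)
        (simp_all add: hom[OF X Y] GW.prd_add_right GW.prd_carrier G.carrierI[OF X] G.carrierI[OF Y] del: plus_fun_apply)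
    have 2: "wedge scale U prd (wedge scale U prd X Y) Z = wedge scale U prd X (wedge scale U prd Y Z)"
      if X: "X \<in> G_parity scale U prd p" for X p
      using Y
      by (induction rule: G.carrier_induct)
        (simp_all add: 1[OF X] GW.prd_add_right GW.prd_add_left GW.prd_carrier G.carrierI[OF X] Z del: plus_fun_apply)
    show "wedge scale U prd (wedge scale U prd X Y) Z = wedge scale U prd X (wedge scale U prd Y Z)"
      using X
      by (induction rule: G.carrier_induct)
        (simp_all add: 2 GW.prd_add_left GW.prd_carrier Y Z del: plus_fun_apply)
  qed
qed

text \<open>\<open>W_bracket\<close> decomposes its arguments within the whole universal Lie
  superalgebra; this inclusion lets \<open>W_bracket_hom\<close> apply to homogeneous elements of
  the prolongation.\<close>

lemma W_as_W: "X \<in> W_as_parity scale U prd p \<Longrightarrow> X \<in> W_parity scale (parity_shift U) p"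
  by (simp add: W_as_parity_eq sh.W_parity_eq mdpar_mpar)

lemma W_as_carrier_W:
  "X \<in> carrier_of (W_as_parity scale U prd) \<Longrightarrow> X \<in> carrier_of (W_parity scale (parity_shift U))"
  by (simp add: carrier_W_as carrier_W_as_W)

lemma superalgebra_bracket:
  "superalgebra (fscale scale) (W_as_parity scale U prd) (W_bracket scale (parity_shift U))"
proof -
  interpret D: superspace "fscale scale" "W_as_parity scale U prd" by (rule superspace_W_as)
  show ?thesis
  proof
    fix X Y p q assume X: "X \<in> W_as_parity scale U prd p" and Y: "Y \<in> W_as_parity scale U prd q"
    have "sh.br p q X Y \<in> mdpar (p + q)"
      using X Y by (intro br_mdpar) (simp_all add: W_as_parity_eq)
    moreover have "fin_arity (sh.br p q X Y)"
      using X Y by (intro br_fin_arity) (auto simp: W_as_parity_eq dest: mdpar_mlin)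
    ultimately show "W_bracket scale (parity_shift U) X Y \<in> W_as_parity scale U prd (p + q)"
      using sh.W_bracket_hom[OF W_as_W[OF X] W_as_W[OF Y]] by (simp add: W_as_parity_eq)
  qed (simp_all add: sh.W_bracket_add_left sh.W_bracket_add_right sh.W_bracket_scale W_as_carrier_W)
qed

lemma lie_superalgebra_bracket:
  "lie_superalgebra (fscale scale) (W_as_parity scale U prd) (W_bracket scale (parity_shift U))"
proof -
  interpret D: superalgebra "fscale scale" "W_as_parity scale U prd" "W_bracket scale (parity_shift U)"
    by (rule superalgebra_bracket)
  note hom = sh.W_bracket_hom[OF W_as_W W_as_W]
  show ?thesis
  proof
    fix X Y p q assume X: "X \<in> W_as_parity scale U prd p" and Y: "Y \<in> W_as_parity scale U prd q"
    show "W_bracket scale (parity_shift U) X Y = - sgn_pow (p * q) (W_bracket scale (parity_shift U) Y X)"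
      unfolding hom[OF X Y] hom[OF Y X] by (rule sh.br_skew)
    fix Z assume "Z \<in> carrier_of (W_as_parity scale U prd)"
    then show "W_bracket scale (parity_shift U) X (W_bracket scale (parity_shift U) Y Z)
      = W_bracket scale (parity_shift U) (W_bracket scale (parity_shift U) X Y) Z
        + sgn_pow (p * q) (W_bracket scale (parity_shift U) Y (W_bracket scale (parity_shift U) X Z))"
    proof (induction rule: D.carrier_induct)
      case (homogeneous r Z)
      have "X \<in> sh.mpar p" "Y \<in> sh.mpar q" "Z \<in> sh.mpar r"
        using X Y homogeneous by (auto simp: W_as_parity_eq mdpar_mpar)
      from sh.br_jacobi[OF this] show ?case
        using hom[OF X D.prd_parity[OF Y homogeneous]] hom[OF Y homogeneous] hom[OF D.prd_parity[OF X Y] homogeneous]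
          hom[OF X Y] hom[OF Y D.prd_parity[OF X homogeneous]] hom[OF X homogeneous] by simp
    next
      case (add Z Z')
      then show ?case
        using D.carrierI[OF X] D.carrierI[OF Y]
        by (simp add: D.prd_add_right D.prd_carrier sgn_pow_add del: plus_fun_apply)
    qed
  qed
qed

lemma odd_poisson:
  "odd_poisson_superalgebra (fscale scale) (G_parity scale U prd) (wedge scale U prd) (W_bracket scale (parity_shift U))"
proof -
  interpret GW: comm_assoc_superalgebra "fscale scale" "G_parity scale U prd" "wedge scale U prd"
    by (rule comm_assoc_wedge)
  interpret D: lie_superalgebra "fscale scale" "W_as_parity scale U prd" "W_bracket scale (parity_shift U)"
    by (rule lie_superalgebra_bracket)
  have GD: "carrier_of (G_parity scale U prd) = carrier_of (W_as_parity scale U prd)"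
    by (simp add: carrier_G carrier_W_as)
  have shift: "X \<in> G_parity scale U prd p \<longleftrightarrow> X \<in> W_as_parity scale U prd (p + 1)" for X p
    by (simp add: G_parity_eq W_as_parity_eq)
  note hom = sh.W_bracket_hom[OF W_as_W W_as_W]
  have leib: "W_bracket scale (parity_shift U) X (wedge scale U prd Y Z)
      = wedge scale U prd (W_bracket scale (parity_shift U) X Y) Z
        + sgn_pow ((p + 1) * q) (wedge scale U prd Y (W_bracket scale (parity_shift U) X Z))"
    if X: "X \<in> G_parity scale U prd p" and Y: "Y \<in> G_parity scale U prd q"
      and Z: "Z \<in> carrier_of (G_parity scale U prd)" for X Y Z p q
    using Z
  proof (induction rule: G.carrier_induct)
    case (homogeneous r Z)
    note XW = X[unfolded shift] and YW = Y[unfolded shift] and ZW = homogeneous[unfolded shift]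
    have m: "X \<in> mdpar (p + 1)" "Y \<in> sh.mpar (q + 1)" "Z \<in> sh.mpar (r + 1)"
      using X Y homogeneous by (auto simp: G_parity_eq mdpar_mpar)
    \<comment> \<open>Measured by \<open>G_parity\<close> the bracket is an odd operation, whence
      the extra 1.\<close>
    have XZ: "W_bracket scale (parity_shift U) X Z \<in> G_parity scale U prd (p + r + 1)"
      using D.prd_parity[OF XW ZW] by (simp add: shift ac_simps)
    have XY: "W_bracket scale (parity_shift U) X Y \<in> G_parity scale U prd (p + q + 1)"
      using D.prd_parity[OF XW YW] by (simp add: shift ac_simps)
    have "q + 1 + (r + 1) + 1 = q + r + 1" by (cases q; cases r; simp)
    moreover have "p + 1 + (r + 1) = p + r" by (cases p; cases r; simp)
    ultimately show ?case
      using leibniz_wdg[OF m] hom[OF XW YW] hom[OF XW ZW]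
        wedge_hom[OF G.carrierI[OF Y] homogeneous] wedge_hom[OF G.carrierI[OF Y] XZ]
        wedge_hom[OF G.carrierI[OF XY] homogeneous] hom[OF XW GW.prd_parity[OF Y homogeneous, unfolded shift]]
      by simp
  next
    case (add Z Z')
    note c = G.carrierI[OF X] G.carrierI[OF Y]
    note [simp] = GW.prd_carrier D.prd_carrier[folded GD] GW.prd_add_right D.prd_add_right[folded GD]
    show ?case
      using add c by (simp add: sgn_pow_add add_ac del: plus_fun_apply)
  qed
  show ?thesis
    unfolding odd_poisson_superalgebra_def odd_poisson_superalgebra_axioms_def parity_shift_G
    using comm_assoc_wedge lie_superalgebra_bracket leib by blast
qed

lemma graded_odd_poisson:
  "graded_odd_poisson_superalgebra (fscale scale) (G_parity scale U prd) (wedge scale U prd)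
    (W_bracket scale (parity_shift U)) (G_piece scale U prd)"
proof -
  interpret P: odd_poisson_superalgebra "fscale scale" "G_parity scale U prd" "wedge scale U prd"
    "W_bracket scale (parity_shift U)"
    by (rule odd_poisson)
  have piece: "G_piece scale U prd k = {f \<in> sh.mlin \<inter> mder. arity_in {k} f}" for k
    by (simp add: G_piece_def W_as_eq)
  have pieceD: "X \<in> carrier_of (G_parity scale U prd)" "X \<in> sh.mlin" "arity_in {k} X" "fin_arity X"
    if "X \<in> G_piece scale U prd k" for X k
    using that by (auto simp: piece carrier_G fin_arity_single)
  have pieceI: "X \<in> G_piece scale U prd k" if "X \<in> carrier_of (G_parity scale U prd)" "arity_in {k} X" for X k
    using that by (simp add: piece carrier_G)
  \<comment> \<open>The set of arities is a singleton, or empty if \<open>h\<close> and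
    \<open>k\<close> are both 0; the empty case yields the vanishing of brackets of
    constants.\<close>
  have br_ar: "arity_in {n. h + k = n + 1} (W_bracket scale (parity_shift U) X Y)"
    if X: "X \<in> G_piece scale U prd h" and Y: "Y \<in> G_piece scale U prd k" for X Y h k
    unfolding sh.W_bracket_eq sh.hcomp_W[OF pieceD(2,4)[OF X]] sh.hcomp_W[OF pieceD(2,4)[OF Y]]
  proof (intro arity_in_sum)
    fix p q :: bit
    have m: "sh.parity_part p X \<in> sh.mlin" "sh.parity_part q Y \<in> sh.mlin"
      "arity_in {h} (sh.parity_part p X)" "arity_in {k} (sh.parity_part q Y)"
      using pieceD[OF X] pieceD[OF Y] by (auto intro: sh.parity_part_mlin sh.parity_part_arity)
    have a: "arity_in {n. h + k = n + 1} (box (parity_shift U) (sh.parity_part p X) (sh.parity_part q Y))"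
      using sh.box_arity[OF m(1,3,4)] by simp
    have b: "arity_in {n. h + k = n + 1} (box (parity_shift U) (sh.parity_part q Y) (sh.parity_part p X))"
      using sh.box_arity[OF m(2,4,3)] by (simp add: add.commute)
    have "arity_in {n. h + k = n + 1} (- sgn_pow (p * q) (box (parity_shift U) (sh.parity_part q Y) (sh.parity_part p X)))"
      using b arity_in_minus by (cases "p * q") auto
    from arity_in_add[OF a this]
    show "arity_in {n. h + k = n + 1} (sh.br p q (sh.parity_part p X) (sh.parity_part q Y))"
      by (simp add: sh.br_def)
  qed
  have br_car: "W_bracket scale (parity_shift U) X Y \<in> carrier_of (G_parity scale U prd)"
    if "X \<in> G_piece scale U prd h" "Y \<in> G_piece scale U prd k" for X Y h k
    using P.shifted.prd_carrier[of X Y] pieceD(1)[OF that(1)] pieceD(1)[OF that(2)]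
    by (simp add: G.carrier_of_parity_shift)
  show ?thesis
  proof
    show "G.subspace (G_piece scale U prd k)" for k
    proof (rule G.subspaceI)
      show "0 \<in> G_piece scale U prd k" by (simp add: piece)
      show "x + y \<in> G_piece scale U prd k" if "x \<in> G_piece scale U prd k" "y \<in> G_piece scale U prd k" for x y
        using that arity_in_add[of "{k}" x "{k}" y] by (auto simp: piece intro: sh.mlin_plus mder_plus)
      show "fscale scale r x \<in> G_piece scale U prd k" if "x \<in> G_piece scale U prd k" for r x
      proof -
        have "arity_in {k} (fscale scale r x)"
          using that by (auto simp: piece arity_in_def fscale_def)
        with that show ?thesis by (simp add: piece sh.mlin_fscale mder_fscale)
      qed
    qed
    show "\<exists>x0\<in>G_piece scale U prd k \<inter> G_parity scale U prd 0. \<exists>x1\<in>G_piece scale U prd k \<inter> G_parity scale U prd 1. x = x0 + x1"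
      if x: "x \<in> G_piece scale U prd k" for x k
    proof (intro bexI)
      note d = pieceD[OF x]
      \<comment> \<open>The shift exchanges parities: the even component in \<open>G_parity\<close>
        is \<open>parity_part 1\<close>.\<close>
      show "x = sh.parity_part 1 x + sh.parity_part 0 x" using sh.parity_part_decomp[OF d(2)] by (simp add: add.commute)
      have "sh.parity_part q x \<in> G_piece scale U prd k" for q
        using x by (simp add: piece sh.parity_part_mlin mder_parity_part sh.parity_part_arity)
      moreover have "sh.parity_part q x \<in> G_parity scale U prd (q + 1)" for q
        using x d by (simp add: piece G_parity_eq mdpar_def sh.parity_part_mpar mder_parity_part sh.parity_part_fin_arity)
      from this[of 0] this[of 1] have "sh.parity_part 0 x \<in> G_parity scale U prd 1" "sh.parity_part 1 x \<in> G_parity scale U prd 0"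
        by simp_all
      ultimately show "sh.parity_part 0 x \<in> G_piece scale U prd k \<inter> G_parity scale U prd 1"
        "sh.parity_part 1 x \<in> G_piece scale U prd k \<inter> G_parity scale U prd 0" by simp_all
    qed
    show "carrier_of (G_parity scale U prd) = sum_of_family (G_piece scale U prd)"
      unfolding carrier_G sum_of_family_W_as[symmetric] G_piece_def[abs_def] ..
    show "f k = 0"
      if K: "finite K" and f: "\<And>k. k \<in> K \<Longrightarrow> f k \<in> G_piece scale U prd k" and 0: "(\<Sum>k\<in>K. f k) = 0" and k: "k \<in> K"
      for K f k
    proof
      fix vs
      show "f k vs = 0 vs"
      proof (cases "length vs = k")
        case True
        \<comment> \<open>At a list of length \<open>k\<close> all other summands vanish, so
          evaluation there isolates \<open>f k\<close>.\<close>
        have "(\<Sum>j\<in>K. f j vs) = (\<Sum>j\<in>K. if j = k then f k vs else 0)"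
          using pieceD(3)[OF f] True by (intro sum.cong) (auto simp: arity_in_def)
        then have "(\<Sum>j\<in>K. f j vs) = f k vs" using K k by simp
        moreover have "(\<Sum>j\<in>K. f j vs) = 0" using fun_cong[OF 0, of vs] by (simp add: sum_apply)
        ultimately show ?thesis by simp
      next
        case False
        then show ?thesis using pieceD(3)[OF f[OF k]] by (auto simp: arity_in_def)
      qed
    qed
    show "wedge scale U prd X Y \<in> G_piece scale U prd (h + k)"
      if X: "X \<in> G_piece scale U prd h" and Y: "Y \<in> G_piece scale U prd k" for X Y h k
    proof (rule pieceI)
      show "wedge scale U prd X Y \<in> carrier_of (G_parity scale U prd)"
        by (rule P.prd_carrier[OF pieceD(1)[OF X] pieceD(1)[OF Y]])
      show "arity_in {h + k} (wedge scale U prd X Y)"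
        unfolding wedge_eq hcomp_G[OF pieceD(1)[OF Y]]
      proof (intro arity_in_sum)
        fix q :: bit
        show "arity_in {h + k} (wdg (q + 1) X (sh.parity_part (q + 1) Y))"
          using wdg_arity[OF pieceD(2,3)[OF X] sh.parity_part_mlin[OF pieceD(2)[OF Y]] sh.parity_part_arity[OF pieceD(3)[OF Y]]]
          by simp
      qed
    qed
    show "W_bracket scale (parity_shift U) X Y \<in> G_piece scale U prd (h + k - 1)"
      if X: "X \<in> G_piece scale U prd h" and Y: "Y \<in> G_piece scale U prd k" and "1 \<le> h + k" for X Y h k
    proof (rule pieceI[OF br_car[OF X Y]])
      show "arity_in {h + k - 1} (W_bracket scale (parity_shift U) X Y)"
        by (rule arity_in_mono[OF br_ar[OF X Y]]) auto
    qed
    show "W_bracket scale (parity_shift U) X Y = 0"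
      if "X \<in> G_piece scale U prd 0" "Y \<in> G_piece scale U prd 0" for X Y
      using br_ar[OF that] by (simp add: arity_in_def fun_eq_iff)
  qed
qed

end

theorem proposition3p4:
  fixes scale :: "'f::field_char_0 \<Rightarrow> 'a::ab_group_add \<Rightarrow> 'a"
    and A :: "bit \<Rightarrow> 'a set"
    and prd :: "'a \<Rightarrow> 'a \<Rightarrow> 'a"
  assumes "comm_assoc_superalgebra scale A prd"
  shows "graded_odd_poisson_superalgebra (fscale scale)
           (G_parity scale A prd) (wedge scale A prd) (W_bracket scale (parity_shift A))
           (G_piece scale A prd)"
  using assms by (rule comm_assoc_superalgebra.graded_odd_poisson)

end
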